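(* Let $K$ be a compact metrizable hypergroup and let $1<p\le b\le p'<\infty$, where $\frac1p+\frac1{p'}=1$. There is a constant $C>0$ such that for every function $\varphi:\widehat K\to(0,\infty)$ with $$M_\varphi:=\sup_{y>0}\,y\sum_{\pi\in\widehat K,\ \varphi(\pi)\ge y}k_\pi^2<\infty$$ and every $f\in L^p(K)$, $$\left(\sum_{\pi\in\widehat K}k_\pi^2\left(\frac{\|\widehat f(\pi)\|_{\mathrm{HS}}}{\sqrt{k_\pi}}\,\varphi(\pi)^{\frac1b-\frac1{p'}}\right)^b\right)^{\frac1b}\le C\,M_\varphi^{\frac1b-\frac1{p'}}\,\|f\|_{L^p(K)} .$$
   Context: A compact hypergroup is a nonempty compact Hausdorff space $K$ with a weakly continuous associative convolution $*$ on the Banach space $M(K)$ of bounded regular (complex) Borel measures, making $(M(K),* )$ a Banach algebra, such that: (i) for $x,y\in K$, $\delta_x*\delta_y$ is a probability measure with compact support and $(x,y)\mapsto\operatorname{supp}(\delta_x*\delta_y)$ is continuous from $K\times K$ into the space of nonempty compact subsets of $K$ with the Michael (Vietoris) topology; (ii) there is a unique $e\in K$ with $\delta_x*\delta_e=\delta_e*\delta_x=\delta_x$ for all $x$; (iii) there is a homeomorphism $x\mapsto\check x$ of $K$ of order two inducing an involution on $M(K)$, where $\check\mu(E)=\mu(\check E)$ for Borel $E$, and $e\in\operatorname{supp}(\delta_x*\delta_y)$ if and only if $x=\check y$. $\lambda$ denotes the normalized Haar measure of $K$ (the left-invariant one: $\int_K f(x*y)\,d\lambda(y)=\int_K f(y)\,d\lambda(y)$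 for all $x\in K$ and continuous $f$, where $f(x*y)=\int f\,d(\delta_x*\delta_y)$), and $L^p(K)=L^p(K,\lambda)$. $\widehat K$ is the set of equivalence classes of irreducible representations of $K$, i.e. irreducible $*$-algebra representations $\pi$ of $M(K)$ on a Hilbert space $\mathcal H_\pi$ with $\pi(\delta_e)=I$ and $\mu\mapsto\langle\pi(\mu)u,v\rangle$ continuous on the cone $M(K)^+$ of positive measures with the weak topology; write $\pi(x)=\pi(\delta_x)$. All such $\pi$ are finite dimensional; $d_\pi=\dim\mathcal H_\pi$, and $\pi(x)=[\pi_{i,j}(x)]$ is the matrix in a fixed orthonormal basis. $\widehat K$ is countable since $K$ is metrizable. The hyperdimension $k_\pi\ge d_\pi$ is the constant with $\int_K\pi_{i,j}\overline{\pi'_{m,l}}\,d\lambda=1/k_\pi$ if $i=m$, $j=l$, $\pi=\pi'$, and $0$ otherwise. The Fourier transform is $\widehat f(\pi)=\int_K f(x)\,\bar\pi(x)\,d\lambda(x)\in\mathbb C^{d_\pi\times d_\pi}$ with $\bar\pi$ the conjugate representation (entries $\overline{\pi_{i,j}}$), and $\|\cdot\|_{\mathrm{HS}}$ is the Hilbert–Schmidt norm. Empty sums are zero. *)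

theory Defs
  imports
    "HOL-Probability.Probability"
    "Jordan_Normal_Form.Schur_Decomposition"
begin

section \<open>Complex Borel measures\<close>

text \<open>A complex measure is represented by its values on Borel sets; it takes the value 0 on
  sets that are not Borel, so that equality of measures is equality of set functions.\<close>

type_synonym 'a cmeas = "'a set \<Rightarrow> complex"

definition tvar :: "'a::topological_space cmeas \<Rightarrow> 'a set \<Rightarrow> ennreal" where
  "tvar \<mu> E = (SUP P \<in> {P. finite P \<and> disjoint P \<and> P \<subseteq> sets borel \<and> \<Union>P = E}.
                 \<Sum>A\<in>P. ennreal (cmod (\<mu> A)))"

definition tv_norm :: "'a::topological_space cmeas \<Rightarrow> ennreal" where
  "tv_norm \<mu> = tvar \<mu> UNIV"

definition complex_measures :: "'a::topological_space cmeas set" where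
  "complex_measures = {\<mu>.
     (\<forall>E. E \<notin> sets borel \<longrightarrow> \<mu> E = 0) \<and>
     (\<forall>A::nat \<Rightarrow> 'a set. range A \<subseteq> sets borel \<and> disjoint_family A \<longrightarrow>
        (\<lambda>n. \<mu> (A n)) sums \<mu> (\<Union>n. A n)) \<and>
     tv_norm \<mu> < \<infinity> \<and>
     (\<forall>E\<in>sets borel. \<forall>\<epsilon>>0. \<exists>C U. compact C \<and> open U \<and> C \<subseteq> E \<and> E \<subseteq> U \<and> tvar \<mu> (U - C) < \<epsilon>)}"

definition positive_measures :: "'a::topological_space cmeas set" where
  "positive_measures = {\<mu> \<in> complex_measures. \<forall>E. \<mu> E \<in> \<real>\<^sub>\<ge>\<^sub>0}"

definition probability_measures :: "'a::topological_space cmeas set" where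
  "probability_measures = {\<mu> \<in> positive_measures. \<mu> UNIV = 1}"

definition of_measure :: "'a measure \<Rightarrow> 'a cmeas" where
  "of_measure N = (\<lambda>E. complex_of_real (measure N E))"

definition dirac :: "'a::topological_space \<Rightarrow> 'a cmeas" where
  "dirac x = of_measure (return borel x)"

text \<open>Positive part in the Jordan decomposition of a real set function: its value on \<open>E\<close> is the
  supremum of the values on Borel subsets of \<open>E\<close> (\<open>ennreal\<close> truncates negative values to 0).\<close>

definition jordan_pos :: "('a::topological_space set \<Rightarrow> real) \<Rightarrow> 'a measure" where
  "jordan_pos \<nu> = measure_of UNIV (sets borel)
     (\<lambda>E. SUP A \<in> {A \<in> sets borel. A \<subseteq> E}. ennreal (\<nu> A))"

definition cm_integral :: "'a::topological_space cmeas \<Rightarrow> ('a \<Rightarrow> complex) \<Rightarrow> complex" where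
  "cm_integral \<mu> f =
     (integral\<^sup>L (jordan_pos (\<lambda>E. Re (\<mu> E))) f - integral\<^sup>L (jordan_pos (\<lambda>E. - Re (\<mu> E))) f)
     + \<i> * (integral\<^sup>L (jordan_pos (\<lambda>E. Im (\<mu> E))) f - integral\<^sup>L (jordan_pos (\<lambda>E. - Im (\<mu> E))) f)"

definition weak_topology :: "'a::topological_space cmeas topology" where
  "weak_topology = topology_generated_by
     {{\<mu> \<in> complex_measures. cm_integral \<mu> f \<in> U} | f U. continuous_on UNIV f \<and> open U}"

definition weak_cone_topology :: "'a::topological_space cmeas topology" where
  "weak_cone_topology = subtopology weak_topology positive_measures"

definition cm_support :: "'a::topological_space cmeas \<Rightarrow> 'a set" where
  "cm_support \<mu> = {x. \<forall>U. open U \<and> x \<in> U \<longrightarrow> tvar \<mu> U > 0}"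

text \<open>Michael topology on the nonempty compact subsets; nonemptiness is enforced by
  \<open>C \<inter> U \<noteq> {}\<close>.\<close>

definition michael_topology :: "'a::topological_space set topology" where
  "michael_topology = topology_generated_by
     {{C. compact C \<and> C \<inter> U \<noteq> {} \<and> C \<subseteq> V} | U V. open U \<and> open V}"


section \<open>Compact hypergroups\<close>

definition cm_check :: "('a \<Rightarrow> 'a) \<Rightarrow> 'a cmeas \<Rightarrow> 'a cmeas" where
  "cm_check chk \<mu> = (\<lambda>E. \<mu> (chk ` E))"

text \<open>The conjugate-linear adjoint on the convolution algebra, as needed for
  \<open>*\<close>-representations; on real measures it agrees with \<^const>\<open>cm_check\<close>.\<close>

definition cm_star :: "('a \<Rightarrow> 'a) \<Rightarrow> 'a cmeas \<Rightarrow> 'a cmeas" where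
  "cm_star chk \<mu> = (\<lambda>E. cnj (cm_check chk \<mu> E))"

text \<open>The space is the whole type. Weak continuity of the convolution is, as usual for
  hypergroups, joint continuity on the cone of positive measures: joint weak continuity on all
  of the measure algebra fails for infinite spaces. Uniqueness of the identity is
  automatic, since two identities satisfy \<open>dirac e = conv (dirac e) (dirac e') = dirac e'\<close>.
  The involution may be the identity map.\<close>

locale compact_hypergroup =
  fixes conv :: "'a::t2_space cmeas \<Rightarrow> 'a cmeas \<Rightarrow> 'a cmeas"
    and chk :: "'a \<Rightarrow> 'a"
    and e :: 'a
  assumes compact_space: "compact (UNIV :: 'a set)"
    and conv_closed: "\<And>\<mu> \<nu>. \<mu> \<in> complex_measures \<Longrightarrow> \<nu> \<in> complex_measures \<Longrightarrow>
          conv \<mu> \<nu> \<in> complex_measures"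
    and conv_linear_left: "\<And>a b \<mu> \<mu>' \<nu>. \<mu> \<in> complex_measures \<Longrightarrow> \<mu>' \<in> complex_measures \<Longrightarrow>
          \<nu> \<in> complex_measures \<Longrightarrow>
          conv (\<lambda>E. a * \<mu> E + b * \<mu>' E) \<nu> = (\<lambda>E. a * conv \<mu> \<nu> E + b * conv \<mu>' \<nu> E)"
    and conv_linear_right: "\<And>a b \<mu> \<nu> \<nu>'. \<mu> \<in> complex_measures \<Longrightarrow> \<nu> \<in> complex_measures \<Longrightarrow>
          \<nu>' \<in> complex_measures \<Longrightarrow>
          conv \<mu> (\<lambda>E. a * \<nu> E + b * \<nu>' E) = (\<lambda>E. a * conv \<mu> \<nu> E + b * conv \<mu> \<nu>' E)"
    and conv_assoc: "\<And>\<mu> \<nu> \<rho>. \<mu> \<in> complex_measures \<Longrightarrow> \<nu> \<in> complex_measures \<Longrightarrow>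
          \<rho> \<in> complex_measures \<Longrightarrow> conv (conv \<mu> \<nu>) \<rho> = conv \<mu> (conv \<nu> \<rho>)"
    and conv_norm: "\<And>\<mu> \<nu>. \<mu> \<in> complex_measures \<Longrightarrow> \<nu> \<in> complex_measures \<Longrightarrow>
          tv_norm (conv \<mu> \<nu>) \<le> tv_norm \<mu> * tv_norm \<nu>"
    and conv_weakly_continuous:
          "continuous_map (prod_topology weak_cone_topology weak_cone_topology) weak_topology
             (\<lambda>(\<mu>, \<nu>). conv \<mu> \<nu>)"
    and conv_dirac_prob: "\<And>x y. conv (dirac x) (dirac y) \<in> probability_measures"
    and conv_dirac_compact_support: "\<And>x y. compact (cm_support (conv (dirac x) (dirac y)))"
    and conv_dirac_support_continuous:
          "continuous_map (euclidean :: ('a \<times> 'a) topology) michael_topology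
             (\<lambda>(x, y). cm_support (conv (dirac x) (dirac y)))"
    and identity_right: "\<And>x. conv (dirac x) (dirac e) = dirac x"
    and identity_left: "\<And>x. conv (dirac e) (dirac x) = dirac x"
    and chk_continuous: "continuous_on UNIV chk"
    and chk_chk: "\<And>x. chk (chk x) = x"
    and conv_check: "\<And>\<mu> \<nu>. \<mu> \<in> complex_measures \<Longrightarrow> \<nu> \<in> complex_measures \<Longrightarrow>
          cm_check chk (conv \<mu> \<nu>) = conv (cm_check chk \<nu>) (cm_check chk \<mu>)"
    and identity_in_support: "\<And>x y. e \<in> cm_support (conv (dirac x) (dirac y)) \<longleftrightarrow> x = chk y"

definition normalized_haar_measure ::
    "('a::t2_space cmeas \<Rightarrow> 'a cmeas \<Rightarrow> 'a cmeas) \<Rightarrow> 'a measure \<Rightarrow> bool" where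
  "normalized_haar_measure conv haar \<longleftrightarrow>
     sets haar = sets borel \<and> prob_space haar \<and> of_measure haar \<in> complex_measures \<and>
     (\<forall>x. \<forall>f :: 'a \<Rightarrow> complex. continuous_on UNIV f \<longrightarrow>
        (LINT y|haar. cm_integral (conv (dirac x) (dirac y)) f) = (LINT y|haar. f y))"


section \<open>The dual\<close>

text \<open>All irreducible representations of a compact hypergroup are finite dimensional, so up to
  unitary equivalence they act on the Hilbert spaces \<open>\<complex>\<^sup>d\<close>. A representation on \<open>\<complex>\<^sup>d\<close> is
  a pair \<open>(d, \<rho>)\<close>, where only the values of \<open>\<rho>\<close> on \<^const>\<open>complex_measures\<close> matter.\<close>

type_synonym 'a hg_rep = "nat \<times> ('a cmeas \<Rightarrow> complex mat)"

definition is_rep :: "('a::t2_space cmeas \<Rightarrow> 'a cmeas \<Rightarrow> 'a cmeas) \<Rightarrow> ('a \<Rightarrow> 'a) \<Rightarrow> 'a \<Rightarrow>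
    'a hg_rep \<Rightarrow> bool" where
  "is_rep conv chk e = (\<lambda>(d, \<rho>).
     (\<forall>\<mu>\<in>complex_measures. \<rho> \<mu> \<in> carrier_mat d d) \<and>
     (\<forall>a b. \<forall>\<mu>\<in>complex_measures. \<forall>\<nu>\<in>complex_measures.
        \<rho> (\<lambda>E. a * \<mu> E + b * \<nu> E) = a \<cdot>\<^sub>m \<rho> \<mu> + b \<cdot>\<^sub>m \<rho> \<nu>) \<and>
     (\<forall>\<mu>\<in>complex_measures. \<forall>\<nu>\<in>complex_measures. \<rho> (conv \<mu> \<nu>) = \<rho> \<mu> * \<rho> \<nu>) \<and>
     (\<forall>\<mu>\<in>complex_measures. \<rho> (cm_star chk \<mu>) = mat_adjoint (\<rho> \<mu>)) \<and>
     \<rho> (dirac e) = 1\<^sub>m d \<and>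
     (\<forall>u\<in>carrier_vec d. \<forall>v\<in>carrier_vec d.
        continuous_map weak_cone_topology euclidean (\<lambda>\<mu>. (\<rho> \<mu> *\<^sub>v u) \<bullet>c v)))"

definition irreducible_rep :: "'a::t2_space hg_rep \<Rightarrow> bool" where
  "irreducible_rep = (\<lambda>(d, \<rho>). d > 0 \<and>
     (\<forall>W \<subseteq> carrier_vec d.
        0\<^sub>v d \<in> W \<and> (\<forall>u\<in>W. \<forall>v\<in>W. u + v \<in> W) \<and> (\<forall>c. \<forall>u\<in>W. c \<cdot>\<^sub>v u \<in> W) \<and>
        (\<forall>\<mu>\<in>complex_measures. \<forall>u\<in>W. \<rho> \<mu> *\<^sub>v u \<in> W)
        \<longrightarrow> W = {0\<^sub>v d} \<or> W = carrier_vec d))"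

definition irreps :: "('a::t2_space cmeas \<Rightarrow> 'a cmeas \<Rightarrow> 'a cmeas) \<Rightarrow> ('a \<Rightarrow> 'a) \<Rightarrow> 'a \<Rightarrow>
    'a hg_rep set" where
  "irreps conv chk e = {r. is_rep conv chk e r \<and> irreducible_rep r}"

definition equivalent_reps :: "'a::t2_space hg_rep \<Rightarrow> 'a hg_rep \<Rightarrow> bool" where
  "equivalent_reps = (\<lambda>(d, \<rho>) (d', \<sigma>). d = d' \<and>
     (\<exists>U \<in> carrier_mat d d. U * mat_adjoint U = 1\<^sub>m d \<and> mat_adjoint U * U = 1\<^sub>m d \<and>
        (\<forall>\<mu>\<in>complex_measures. U * \<rho> \<mu> = \<sigma> \<mu> * U)))"

definition dual :: "('a::t2_space cmeas \<Rightarrow> 'a cmeas \<Rightarrow> 'a cmeas) \<Rightarrow> ('a \<Rightarrow> 'a) \<Rightarrow> 'a \<Rightarrow>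
    'a hg_rep set set" where
  "dual conv chk e = irreps conv chk e //
     {(r, s). r \<in> irreps conv chk e \<and> s \<in> irreps conv chk e \<and> equivalent_reps r s}"

text \<open>Choosing a representative of a class fixes an orthonormal basis of the representation
  space.\<close>

definition rep_of :: "'a hg_rep set \<Rightarrow> 'a hg_rep" where
  "rep_of \<pi> = (SOME r. r \<in> \<pi>)"

definition rep_dim :: "'a hg_rep set \<Rightarrow> nat" where
  "rep_dim \<pi> = fst (rep_of \<pi>)"

definition rep_coeff :: "'a::t2_space hg_rep set \<Rightarrow> nat \<Rightarrow> nat \<Rightarrow> 'a \<Rightarrow> complex" where
  "rep_coeff \<pi> i j x = snd (rep_of \<pi>) (dirac x) $$ (i, j)"

definition hyperdim :: "('a::t2_space cmeas \<Rightarrow> 'a cmeas \<Rightarrow> 'a cmeas) \<Rightarrow> ('a \<Rightarrow> 'a) \<Rightarrow> 'a \<Rightarrow>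
    'a measure \<Rightarrow> 'a hg_rep set \<Rightarrow> real" where
  "hyperdim conv chk e haar \<pi> = (THE k.
     \<forall>\<pi>'\<in>dual conv chk e. \<forall>i<rep_dim \<pi>. \<forall>j<rep_dim \<pi>. \<forall>m<rep_dim \<pi>'. \<forall>l<rep_dim \<pi>'.
       (LINT x|haar. rep_coeff \<pi> i j x * cnj (rep_coeff \<pi>' m l x)) =
         (if i = m \<and> j = l \<and> \<pi> = \<pi>' then complex_of_real (1 / k) else 0))"


section \<open>Fourier transform and function spaces\<close>

definition fourier :: "'a::t2_space measure \<Rightarrow> ('a \<Rightarrow> complex) \<Rightarrow> 'a hg_rep set \<Rightarrow> complex mat" where
  "fourier haar f \<pi> = mat (rep_dim \<pi>) (rep_dim \<pi>)
     (\<lambda>(i, j). LINT x|haar. f x * cnj (rep_coeff \<pi> i j x))"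

definition hs_norm :: "complex mat \<Rightarrow> real" where
  "hs_norm A = sqrt (\<Sum>i<dim_row A. \<Sum>j<dim_col A. (cmod (A $$ (i, j)))\<^sup>2)"

definition Lp_space :: "real \<Rightarrow> 'a measure \<Rightarrow> ('a \<Rightarrow> complex) set" where
  "Lp_space p N = {f \<in> borel_measurable N. integrable N (\<lambda>x. cmod (f x) powr p)}"

definition Lp_norm :: "real \<Rightarrow> 'a measure \<Rightarrow> ('a \<Rightarrow> complex) \<Rightarrow> real" where
  "Lp_norm p N f = (LINT x|N. cmod (f x) powr p) powr (1 / p)"

definition M_sup :: "('a::t2_space cmeas \<Rightarrow> 'a cmeas \<Rightarrow> 'a cmeas) \<Rightarrow> ('a \<Rightarrow> 'a) \<Rightarrow> 'a \<Rightarrow>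
    'a measure \<Rightarrow> ('a hg_rep set \<Rightarrow> real) \<Rightarrow> ennreal" where
  "M_sup conv chk e haar \<phi> = (SUP y \<in> {0<..}. ennreal y *
     (\<Sum>\<^sub>\<infinity>\<pi> \<in> {\<pi> \<in> dual conv chk e. \<phi> \<pi> \<ge> y}. ennreal ((hyperdim conv chk e haar \<pi>)\<^sup>2)))"

end

theory Submission
  imports Defs "Jordan_Normal_Form.Spectral_Radius"
begin

text \<open>Put \<open>a f \<pi> = \<parallel>f^(\<pi>)\<parallel> / sqrt k\<close> and give \<open>\<pi>\<close> the weight \<open>k\<^sup>2\<close>. Orthogonality of the matrix
  coefficients makes \<open>f \<mapsto> a f\<close> of type \<open>(2, 2)\<close> (Bessel), and \<open>\<parallel>\<pi>(x)\<parallel> \<le> sqrt d \<le> sqrt k\<close> in the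
  Hilbert-Schmidt norm makes it of type \<open>(1, \<infinity>)\<close>. Marcinkiewicz interpolation between these gives
  the Hausdorff-Young inequality (the case \<open>b = p'\<close>); applied to \<open>a f / \<phi>\<close> with the weight
  \<open>k\<^sup>2 \<phi>\<^sup>2\<close>, for which finiteness of \<open>M\<close> is the weak type \<open>(1, 1)\<close>, it gives the Paley inequality
  (the case \<open>b = p\<close>). Hoelder's inequality interpolates between the two.

  The orthogonality relations follow from Schur's lemma once translations have the expected
  adjoints, \<open>\<integral> f(x * y) g(y) dy = \<integral> f(y) g(chk(x) * y) dy\<close>; unlike for groups this is not immediate from
  the invariance of Haar measure and is proved with an approximate identity.\<close>

section \<open>Complex measures and total variation\<close>

text \<open>In a group, translation by \<open>chk x\<close> undoes translation by \<open>x\<close>,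
  and the adjoint formula is a substitution. Here \<open>conv (dirac (chk x)) (dirac x)\<close> is
  in general a spread-out probability measure; all that is known is that \<open>e\<close> lies in
  its support. There is nothing to substitute, and the axiom on supports has to produce the kernels
  that replace the inverse. A second obstacle: convolution and representations are assumed weakly
  continuous on the cone of positive measures only, while irreducibility and equivalence refer to
  all complex measures. Hence complex measures are written as combinations of positive ones, and
  functionals on the cone are recovered from their values at point masses by Riemann sums. On the
  dual side all estimates concern finite sets \<open>F\<close> of classes and an arbitrary bound
  \<open>M\<close> for the finite weighted sums, with a constant that depends on the exponents
  alone; summability and the bound for the full sum then follow together, since the terms are
  nonnegative.\<close>

lemma complex_measures_outside: "\<mu> \<in> complex_measures \<Longrightarrow> E \<notin> sets borel \<Longrightarrow> \<mu> E = 0"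
  by (simp add: complex_measures_def)

lemma complex_measures_sums:
  fixes A :: "nat \<Rightarrow> 'a::topological_space set"
  assumes "\<mu> \<in> complex_measures" "range A \<subseteq> sets borel" "disjoint_family A"
  shows "(\<lambda>n. \<mu> (A n)) sums \<mu> (\<Union>n. A n)"
  using assms by (auto simp: complex_measures_def)

lemma complex_measures_empty:
  assumes "\<mu> \<in> complex_measures" shows "\<mu> {} = 0"
proof -
  have "(\<lambda>n::nat. \<mu> {}) sums \<mu> (\<Union>n::nat. {})"
    by (rule complex_measures_sums[OF assms]) (auto simp: disjoint_family_on_def)
  then show ?thesis
    using summable_LIMSEQ_zero[OF sums_summable] LIMSEQ_const_iff by blast
qed

text \<open>\<open>tvar\<close> ranges over sets of blocks that cover \<open>E\<close> exactly. The
  family is completed by the remainder \<open>R\<close>, and its empty members, which may repeat,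
  are dropped so that the indexing becomes injective.\<close>

lemma sum_cmod_le_tvar:
  fixes \<mu> :: "'a::topological_space cmeas"
  assumes "finite I" "disjoint_family_on B I" "\<And>i. i \<in> I \<Longrightarrow> B i \<in> sets borel"
    and "\<And>i. i \<in> I \<Longrightarrow> B i \<subseteq> E" "E \<in> sets borel" "\<mu> {} = 0"
  shows "(\<Sum>i\<in>I. ennreal (cmod (\<mu> (B i)))) \<le> tvar \<mu> E"
proof -
  define J where "J = {i\<in>I. B i \<noteq> {}}"
  define R where "R = E - (\<Union>i\<in>I. B i)"
  define P where "P = insert R (B ` J)"
  have JI: "J \<subseteq> I" "finite J" using assms by (auto simp: J_def)
  have inj: "inj_on B J"
    using assms(2) unfolding J_def inj_on_def disjoint_family_on_def by blast
  have "(\<Sum>i\<in>I. ennreal (cmod (\<mu> (B i)))) = (\<Sum>i\<in>J. ennreal (cmod (\<mu> (B i))))"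
    by (rule sum.mono_neutral_right) (use assms in \<open>auto simp: J_def\<close>)
  also have "\<dots> = (\<Sum>A\<in>B`J. ennreal (cmod (\<mu> A)))"
    by (simp add: sum.reindex[OF inj])
  also have "\<dots> \<le> (\<Sum>A\<in>P. ennreal (cmod (\<mu> A)))"
    by (rule sum_mono2) (use JI in \<open>auto simp: P_def\<close>)
  also have "\<dots> \<le> tvar \<mu> E"
    unfolding tvar_def
  proof (rule SUP_upper, safe)
    show "finite P" using JI by (simp add: P_def)
    have "disjoint (B ` J)"
      using disjoint_family_on_mono[OF JI(1) assms(2)] by (rule disjoint_family_on_disjoint_image)
    moreover have "disjnt A R \<and> disjnt R A" if "A \<in> B ` J" for A
      using that JI(1) by (auto simp: R_def disjnt_def)
    ultimately show "disjoint P"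
      unfolding P_def pairwise_insert by blast
    have "R \<in> sets borel" using assms by (auto simp: R_def)
    then show "\<And>x. x \<in> P \<Longrightarrow> x \<in> sets borel" using assms JI by (auto simp: P_def)
    show "\<And>x X. x \<in> X \<Longrightarrow> X \<in> P \<Longrightarrow> x \<in> E"
      using assms JI by (auto simp: P_def R_def)
    fix x assume "x \<in> E"
    then show "x \<in> \<Union>P" by (auto simp: P_def R_def J_def)
  qed
  finally show ?thesis .
qed

lemma tvar_least:
  assumes "\<And>P. finite P \<Longrightarrow> disjoint P \<Longrightarrow> P \<subseteq> sets borel \<Longrightarrow> \<Union>P = E \<Longrightarrow>
     (\<Sum>A\<in>P. ennreal (cmod (\<mu> A))) \<le> c"
  shows "tvar \<mu> E \<le> c"
  unfolding tvar_def by (rule SUP_least) (use assms in auto)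

lemma cmod_le_tvar:
  assumes "E \<in> sets borel" "\<mu> {} = 0"
  shows "ennreal (cmod (\<mu> E)) \<le> tvar \<mu> E"
  using sum_cmod_le_tvar[of "{()}" "\<lambda>_. E" E \<mu>] assms by (simp add: disjoint_family_on_def)

lemma tvar_mono_set:
  assumes "E \<subseteq> F" "F \<in> sets borel" "\<mu> {} = 0"
  shows "tvar \<mu> E \<le> tvar \<mu> F"
proof (rule tvar_least)
  fix P assume P: "finite P" "disjoint P" "P \<subseteq> sets borel" "\<Union>P = E"
  show "(\<Sum>A\<in>P. ennreal (cmod (\<mu> A))) \<le> tvar \<mu> F"
    by (rule sum_cmod_le_tvar) (use P assms in \<open>auto simp: disjoint_family_on_def disjoint_def\<close>)
qed

lemma tvar_mono_fun:
  assumes "\<And>A. A \<in> sets borel \<Longrightarrow> cmod (\<nu> A) \<le> cmod (\<mu> A)"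
  shows "tvar \<nu> E \<le> tvar \<mu> E"
proof (rule tvar_least)
  fix P assume P: "finite P" "disjoint P" "P \<subseteq> sets borel" "\<Union>P = E"
  have "(\<Sum>A\<in>P. ennreal (cmod (\<nu> A))) \<le> (\<Sum>A\<in>P. ennreal (cmod (\<mu> A)))"
    using P assms by (intro sum_mono ennreal_leI) blast
  also have "\<dots> \<le> tvar \<mu> E"
    unfolding tvar_def by (rule SUP_upper) (use P in blast)
  finally show "(\<Sum>A\<in>P. ennreal (cmod (\<nu> A))) \<le> tvar \<mu> E" .
qed

lemma tvar_lincomb:
  assumes "E \<in> sets borel" "\<mu> {} = 0" "\<nu> {} = 0"
  shows "tvar (\<lambda>E. a * \<mu> E + b * \<nu> E) E \<le> ennreal (cmod a) * tvar \<mu> E + ennreal (cmod b) * tvar \<nu> E"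
proof (rule tvar_least)
  fix P :: "'a set set" assume P: "finite P" "disjoint P" "P \<subseteq> sets borel" "\<Union>P = E"
  have *: "(\<Sum>A\<in>P. ennreal (cmod (\<xi> A))) \<le> tvar \<xi> E" if "\<xi> {} = 0" for \<xi> :: "'a cmeas"
    by (rule sum_cmod_le_tvar)
      (use P assms that in \<open>auto simp: disjoint_family_on_def disjoint_def\<close>)
  have "(\<Sum>A\<in>P. ennreal (cmod (a * \<mu> A + b * \<nu> A)))
     \<le> (\<Sum>A\<in>P. ennreal (cmod a) * ennreal (cmod (\<mu> A)) + ennreal (cmod b) * ennreal (cmod (\<nu> A)))"
    by (intro sum_mono)
      (auto simp: ennreal_mult[symmetric] norm_mult[symmetric] simp flip: ennreal_plus
         intro!: ennreal_leI norm_triangle_ineq)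
  also have "\<dots> = ennreal (cmod a) * (\<Sum>A\<in>P. ennreal (cmod (\<mu> A)))
      + ennreal (cmod b) * (\<Sum>A\<in>P. ennreal (cmod (\<nu> A)))"
    by (simp only: sum.distrib sum_distrib_left)
  also have "\<dots> \<le> ennreal (cmod a) * tvar \<mu> E + ennreal (cmod b) * tvar \<nu> E"
    by (intro add_mono mult_left_mono *) (use assms in auto)
  finally show "(\<Sum>A\<in>P. ennreal (cmod (a * \<mu> A + b * \<nu> A))) \<le> \<dots>" .
qed

lemma tvar_finite:
  assumes "\<mu> \<in> complex_measures" shows "tvar \<mu> E < \<infinity>"
  using tvar_mono_set[of E UNIV \<mu>] complex_measures_empty[OF assms] assms
  by (auto simp: complex_measures_def tv_norm_def)

text \<open>Superadditivity: a partition of \<open>E\<close> and one of \<open>F\<close> together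
  partition the union. They can have no block in common except the empty set, which is removed
  before the two sums are merged.\<close>

lemma tvar_disjoint_union:
  assumes "\<mu> {} = 0" "E \<in> sets borel" "F \<in> sets borel" "E \<inter> F = {}"
  shows "tvar \<mu> E + tvar \<mu> F \<le> tvar \<mu> (E \<union> F)"
proof -
  define \<P> where "\<P> = (\<lambda>E. {P. finite P \<and> disjoint P \<and> P \<subseteq> sets borel \<and> \<Union>P = (E::'a set)})"
  define S where "S = (\<lambda>P. \<Sum>A\<in>P. ennreal (cmod (\<mu> A)))"
  have tv: "tvar \<mu> E = (SUP P\<in>\<P> E. S P)" for E by (simp add: tvar_def \<P>_def S_def)
  have ne: "{X} \<in> \<P> X" if "X \<in> sets borel" for X using that by (auto simp: \<P>_def disjoint_def)
  have "S P + S Q \<le> tvar \<mu> (E \<union> F)" if P: "P \<in> \<P> E" and Q: "Q \<in> \<P> F" for P Q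
  proof -
    have PQ: "\<And>A. A \<in> P \<Longrightarrow> A \<in> Q \<Longrightarrow> A = {}" using P Q assms(4) by (auto simp: \<P>_def)
    have dP: "\<And>A B. A \<in> P \<Longrightarrow> B \<in> P \<Longrightarrow> A \<noteq> B \<Longrightarrow> A \<inter> B = {}"
      and dQ: "\<And>A B. A \<in> Q \<Longrightarrow> B \<in> Q \<Longrightarrow> A \<noteq> B \<Longrightarrow> A \<inter> B = {}"
      using P Q by (auto simp: \<P>_def disjoint_def)
    have dPQ: "\<And>A B. A \<in> P \<Longrightarrow> B \<in> Q \<Longrightarrow> A \<inter> B = {}"
      using P Q assms(4) by (fastforce simp: \<P>_def)
    have "S P + S Q = (\<Sum>A\<in>P - {{}}. ennreal (cmod (\<mu> A))) + (\<Sum>A\<in>Q - {{}}. ennreal (cmod (\<mu> A)))"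
      unfolding S_def using P Q assms(1)
      by (intro arg_cong2[where f="(+)"] sum.mono_neutral_right) (auto simp: \<P>_def)
    also have "\<dots> = (\<Sum>A\<in>(P - {{}}) \<union> (Q - {{}}). ennreal (cmod (\<mu> A)))"
      by (rule sum.union_disjoint[symmetric]) (use P Q PQ in \<open>auto simp: \<P>_def\<close>)
    also have "\<dots> \<le> tvar \<mu> (E \<union> F)"
    proof (rule sum_cmod_le_tvar)
      show "disjoint_family_on (\<lambda>x. x) ((P - {{}}) \<union> (Q - {{}}))"
        unfolding disjoint_family_on_def
      proof (intro ballI impI)
        fix A B assume "A \<in> P - {{}} \<union> (Q - {{}})" "B \<in> P - {{}} \<union> (Q - {{}})" "A \<noteq> B"
        then show "A \<inter> B = {}" using dP[of A B] dQ[of A B] dPQ[of A B] dPQ[of B A] by auto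
      qed
    qed (use P Q assms in \<open>auto simp: \<P>_def\<close>)
    finally show ?thesis .
  qed
  note PQ = this
  have ne': "\<P> E \<noteq> {}" "\<P> F \<noteq> {}"
    using ne[OF assms(2)] ne[OF assms(3)] by auto
  have "(SUP P\<in>\<P> E. S P) + (SUP Q\<in>\<P> F. S Q) = (SUP P\<in>\<P> E. S P + (SUP Q\<in>\<P> F. S Q))"
    by (rule ennreal_SUP_add_left[symmetric, OF ne'(1)])
  also have "\<dots> = (SUP P\<in>\<P> E. SUP Q\<in>\<P> F. S P + S Q)"
    by (simp only: ennreal_SUP_add_right[OF ne'(2)])
  also have "\<dots> \<le> tvar \<mu> (E \<union> F)"
    by (intro SUP_least PQ)
  finally have "(SUP P\<in>\<P> E. S P) + (SUP Q\<in>\<P> F. S Q) \<le> tvar \<mu> (E \<union> F)" .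
  then show ?thesis by (simp add: tv)
qed

text \<open>Countable additivity of the total variation. Finite superadditivity gives one direction;
  for the other, each block of a partition is cut along the sets \<open>A n\<close> and the two sums
  are exchanged.\<close>

lemma tvar_suminf:
  fixes A :: "nat \<Rightarrow> 'a::topological_space set"
  assumes \<mu>: "\<mu> \<in> complex_measures" and A: "range A \<subseteq> sets borel" "disjoint_family A"
  shows "(\<Sum>n. tvar \<mu> (A n)) = tvar \<mu> (\<Union>n. A n)"
proof (rule antisym)
  note \<mu>0 = complex_measures_empty[OF \<mu>]
  have UA: "(\<Union>n. A n) \<in> sets borel" using A by auto
  have part: "(\<Sum>n<N. tvar \<mu> (A n)) \<le> tvar \<mu> (\<Union>n<N. A n)" for N
  proof (induction N)
    case (Suc N)
    have "(\<Sum>n<Suc N. tvar \<mu> (A n)) \<le> tvar \<mu> (\<Union>n<N. A n) + tvar \<mu> (A N)"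
      using Suc by (simp add: add.commute add_left_mono)
    also have "\<dots> \<le> tvar \<mu> ((\<Union>n<N. A n) \<union> A N)"
    proof (rule tvar_disjoint_union)
      show "(\<Union>n<N. A n) \<inter> A N = {}"
        using disjoint_family_onD[OF A(2), of _ N] by fastforce
    qed (use A \<mu>0 in auto)
    also have "(\<Union>n<N. A n) \<union> A N = (\<Union>n<Suc N. A n)" by (auto simp: less_Suc_eq)
    finally show ?case .
  qed simp
  show "(\<Sum>n. tvar \<mu> (A n)) \<le> tvar \<mu> (\<Union>n. A n)"
    by (rule suminf_le_const) (auto intro!: order_trans[OF part] tvar_mono_set \<mu>0 UA)
  show "tvar \<mu> (\<Union>n. A n) \<le> (\<Sum>n. tvar \<mu> (A n))"
  proof (rule tvar_least)
    fix P :: "'a set set" assume P: "finite P" "disjoint P" "P \<subseteq> sets borel" "\<Union>P = (\<Union>n. A n)"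
    have one: "ennreal (cmod (\<mu> B)) \<le> (\<Sum>n. ennreal (cmod (\<mu> (B \<inter> A n))))" if B: "B \<in> P" for B
    proof -
      have "(\<lambda>n. \<mu> (B \<inter> A n)) sums \<mu> (\<Union>n. B \<inter> A n)"
        using A B P by (intro complex_measures_sums[OF \<mu>]) (auto simp: disjoint_family_on_def)
      also have "(\<Union>n. B \<inter> A n) = B" using B P by auto
      finally have s: "(\<lambda>n. \<mu> (B \<inter> A n)) sums \<mu> B" .
      show ?thesis
      proof (cases "summable (\<lambda>n. cmod (\<mu> (B \<inter> A n)))")
        case True
        then show ?thesis
          using s summable_norm[OF True] by (simp add: sums_iff suminf_ennreal2 ennreal_leI)
      next
        \<comment> \<open>If the moduli are not summable, the right-hand side is infinite and the
          bound is trivial.\<close>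
        case False
        have "(\<Sum>n. ennreal (cmod (\<mu> (B \<inter> A n)))) = \<infinity>"
          unfolding infinity_ennreal_def by (rule ccontr, drule summable_suminf_not_top[rotated]) (use False in auto)
        then show ?thesis by simp
      qed
    qed
    have "(\<Sum>B\<in>P. ennreal (cmod (\<mu> B))) \<le> (\<Sum>B\<in>P. \<Sum>n. ennreal (cmod (\<mu> (B \<inter> A n))))"
      by (intro sum_mono one)
    also have "\<dots> = (\<Sum>n. \<Sum>B\<in>P. ennreal (cmod (\<mu> (B \<inter> A n))))"
      by (rule suminf_sum[symmetric]) auto
    also have "\<dots> \<le> (\<Sum>n. tvar \<mu> (A n))"
    proof (rule suminf_le)
      fix n show "(\<Sum>B\<in>P. ennreal (cmod (\<mu> (B \<inter> A n)))) \<le> tvar \<mu> (A n)"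
        using P A by (intro sum_cmod_le_tvar \<mu>0) (auto simp: disjoint_def disjoint_family_on_def)
    qed auto
    finally show "(\<Sum>B\<in>P. ennreal (cmod (\<mu> B))) \<le> (\<Sum>n. tvar \<mu> (A n))" .
  qed
qed

lemma complex_measures_regular:
  assumes "\<mu> \<in> complex_measures" "E \<in> sets borel" "\<epsilon> > 0"
  obtains C U where "compact C" "open U" "C \<subseteq> E" "E \<subseteq> U" "tvar \<mu> (U - C) < \<epsilon>"
  using assms unfolding complex_measures_def by blast

text \<open>Finite variation and regularity are inherited from the dominating measure: the same
  \<open>C\<close> and \<open>U\<close> serve for \<open>\<nu>\<close>.\<close>

lemma complex_measures_dominated:
  fixes \<mu> \<nu> :: "'a::topological_space cmeas"
  assumes "\<mu> \<in> complex_measures" "\<And>E. E \<notin> sets borel \<Longrightarrow> \<nu> E = 0"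
    and "\<And>A::nat \<Rightarrow> 'a set. range A \<subseteq> sets borel \<Longrightarrow> disjoint_family A \<Longrightarrow>
        (\<lambda>n. \<nu> (A n)) sums \<nu> (\<Union>n. A n)"
    and "\<And>E. E \<in> sets borel \<Longrightarrow> tvar \<nu> E \<le> tvar \<mu> E"
  shows "\<nu> \<in> complex_measures"
  unfolding complex_measures_def
proof (safe, goal_cases)
  case (3)
  then show ?case using assms(4)[of UNIV] tvar_finite[OF assms(1), of UNIV]
    by (auto simp: tv_norm_def)
next
  case (4 E \<epsilon>)
  obtain C U where CU: "compact C" "open U" "C \<subseteq> E" "E \<subseteq> U" "tvar \<mu> (U - C) < \<epsilon>"
    using complex_measures_regular[OF assms(1) 4] .
  have "tvar \<nu> (U - C) < \<epsilon>"
  proof (cases "U - C \<in> sets borel")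
    case True
    then show ?thesis using CU(5) assms(4)[of "U - C"] by (meson le_less_trans)
  next
    \<comment> \<open>In a space that is not Hausdorff a compact \<open>C\<close> may fail to be
      Borel. A set that is not Borel has no finite Borel partition, and \<open>tvar\<close> is then
      a supremum over the empty set, which is 0.\<close>
    case False
    have "P \<subseteq> sets borel \<Longrightarrow> finite P \<Longrightarrow> \<Union>P \<noteq> U - C" for P
      using False sets.finite_Union by metis
    then have "tvar \<nu> (U - C) \<le> 0"
      by (intro tvar_least) blast
    then show ?thesis using 4 by simp
  qed
  then show ?case using CU(1-4) by blast
qed (use assms in auto)

lemma complex_measures_lincomb:
  fixes \<mu> \<nu> :: "'a::t2_space cmeas"
  assumes \<mu>: "\<mu> \<in> complex_measures" and \<nu>: "\<nu> \<in> complex_measures"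
  shows "(\<lambda>E. a * \<mu> E + b * \<nu> E) \<in> complex_measures"
  unfolding complex_measures_def
proof (safe, goal_cases)
  case (1 E)
  then show ?case using complex_measures_outside[OF \<mu>] complex_measures_outside[OF \<nu>] by simp
next
  case (2 A)
  then show ?case
    using complex_measures_sums[OF \<mu>, of A] complex_measures_sums[OF \<nu>, of A]
    by (intro sums_add sums_mult) auto
next
  note z = complex_measures_empty[OF \<mu>] complex_measures_empty[OF \<nu>]
  case 3
  have "tvar (\<lambda>E. a * \<mu> E + b * \<nu> E) UNIV
      \<le> ennreal (cmod a) * tvar \<mu> UNIV + ennreal (cmod b) * tvar \<nu> UNIV"
    by (rule tvar_lincomb) (use z in auto)
  also have "\<dots> < \<infinity>"
    using tvar_finite[OF \<mu>, of UNIV] tvar_finite[OF \<nu>, of UNIV]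
    by (simp add: ennreal_mult_less_top)
  finally show ?case by (simp add: tv_norm_def)
next
  note z = complex_measures_empty[OF \<mu>] complex_measures_empty[OF \<nu>]
  case (4 E \<epsilon>)
  \<comment> \<open>The summand 1 makes the final estimate strict and keeps the divisor positive
    when \<open>a\<close> and \<open>b\<close> vanish.\<close>
  define M where "M = 1 + cmod a + cmod b"
  have M: "M > 0" by (auto simp: M_def add_pos_nonneg)
  \<comment> \<open>The tolerance \<open>\<epsilon>\<close> is an extended number and may be
    infinite; the minimum with 1 allows the computation to be carried out with a real
    number.\<close>
  define \<eta> where "\<eta> = min \<epsilon> 1 / ennreal M"
  have fin: "min \<epsilon> 1 < \<infinity>"
    unfolding infinity_ennreal_def by (rule le_less_trans[OF min.cobounded2 ennreal_one_less_top])
  define e where "e = enn2real (min \<epsilon> 1)"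
  have e: "min \<epsilon> 1 = ennreal e" "e > 0"
    using fin 4(2) by (simp_all add: e_def enn2real_positive_iff)
  have \<eta>: "\<eta> = ennreal (e / M)" "\<eta> > 0"
    using e M by (auto simp: \<eta>_def divide_ennreal)
  obtain C U where CU: "compact C" "open U" "C \<subseteq> E" "E \<subseteq> U" "tvar \<mu> (U - C) < \<eta>"
    using complex_measures_regular[OF \<mu> 4(1) \<eta>(2)] .
  obtain C' U' where CU': "compact C'" "open U'" "C' \<subseteq> E" "E \<subseteq> U'" "tvar \<nu> (U' - C') < \<eta>"
    using complex_measures_regular[OF \<nu> 4(1) \<eta>(2)] .
  define D where "D = U \<inter> U' - (C \<union> C')"
  have bor: "U - C \<in> sets borel" "U' - C' \<in> sets borel" "D \<in> sets borel"
    using CU CU' by (auto simp: D_def compact_imp_closed)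
  have "tvar (\<lambda>E. a * \<mu> E + b * \<nu> E) D \<le> ennreal (cmod a) * tvar \<mu> D + ennreal (cmod b) * tvar \<nu> D"
    by (rule tvar_lincomb) (use z bor in auto)
  also have "\<dots> \<le> ennreal (cmod a) * \<eta> + ennreal (cmod b) * \<eta>"
    using order_trans[OF tvar_mono_set[of D "U - C" \<mu>] less_imp_le[OF CU(5)]]
      order_trans[OF tvar_mono_set[of D "U' - C'" \<nu>] less_imp_le[OF CU'(5)]] bor z
    by (intro add_mono mult_left_mono) (auto simp: D_def)
  also have "\<dots> = ennreal ((cmod a + cmod b) * e / M)"
    unfolding \<eta>(1) using M e
    by (simp add: ennreal_mult[symmetric] ring_distribs add_divide_distrib flip: ennreal_plus)
  also have "\<dots> < ennreal e"
    using e M by (intro ennreal_lessI) (auto simp: M_def field_simps)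
  also have "ennreal e \<le> \<epsilon>" using e(1) by (metis min.cobounded1)
  finally have "tvar (\<lambda>E. a * \<mu> E + b * \<nu> E) D < \<epsilon>" .
  moreover have "compact (C \<union> C')" "open (U \<inter> U')" "C \<union> C' \<subseteq> E" "E \<subseteq> U \<inter> U'"
    using CU CU' by auto
  ultimately show ?case unfolding D_def by blast
qed

section \<open>Decomposition of complex measures into positive ones\<close>

lemma sum_tvar_le:
  assumes "\<mu> {} = 0" "finite P" "disjoint P" "P \<subseteq> sets borel"
  shows "(\<Sum>A\<in>P. tvar \<mu> A) \<le> tvar \<mu> (\<Union>P)"
  using assms(2-)
proof (induction P rule: finite_induct)
  case (insert A P)
  have "disjoint P" "\<forall>B\<in>P. disjnt A B" "P \<subseteq> sets borel"
    using insert by (auto simp: pairwise_insert)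
  then have "A \<inter> \<Union>P = {}" by (auto simp: disjnt_def)
  have "(\<Sum>B\<in>insert A P. tvar \<mu> B) \<le> tvar \<mu> A + tvar \<mu> (\<Union>P)"
    using insert \<open>disjoint P\<close> by (auto intro: add_left_mono)
  also have "\<dots> \<le> tvar \<mu> (A \<union> \<Union>P)"
    by (rule tvar_disjoint_union) (use assms(1) insert \<open>A \<inter> \<Union>P = {}\<close> in auto)
  finally show ?case by simp
qed simp

text \<open>The variation of a complex measure as a measure. Its additivity is that of
  \<open>tvar\<close>, and its own variation is at most that of \<open>\<mu>\<close>, which supplies
  finiteness and regularity.\<close>

lemma tvar_positive_measure:
  fixes \<mu> :: "'a::topological_space cmeas"
  assumes \<mu>: "\<mu> \<in> complex_measures"
  shows "(\<lambda>E. if E \<in> sets borel then complex_of_real (enn2real (tvar \<mu> E)) else 0) \<in> positive_measures"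
    (is "?\<nu> \<in> _")
proof -
  note \<mu>0 = complex_measures_empty[OF \<mu>]
  have e: "ennreal (enn2real (tvar \<mu> E)) = tvar \<mu> E" for E
    using tvar_finite[OF \<mu>, of E] by simp
  have "?\<nu> \<in> complex_measures"
  proof (rule complex_measures_dominated[OF \<mu>])
    fix A :: "nat \<Rightarrow> 'a set" assume A: "range A \<subseteq> sets borel" "disjoint_family A"
    have "(\<lambda>n. tvar \<mu> (A n)) sums tvar \<mu> (\<Union>n. A n)"
      using summable_sums[OF summableI, of "\<lambda>n. tvar \<mu> (A n)"] tvar_suminf[OF \<mu> A] by simp
    then have "(\<lambda>n. ennreal (enn2real (tvar \<mu> (A n)))) sums ennreal (enn2real (tvar \<mu> (\<Union>n. A n)))"
      by (simp only: e)
    then have "(\<lambda>n. enn2real (tvar \<mu> (A n))) sums enn2real (tvar \<mu> (\<Union>n. A n))"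
      by (subst (asm) sums_ennreal) auto
    then have "(\<lambda>n. complex_of_real (enn2real (tvar \<mu> (A n)))) sums
      complex_of_real (enn2real (tvar \<mu> (\<Union>n. A n)))"
      by (simp add: sums_of_real_iff)
    moreover have "A n \<in> sets borel" "(\<Union>n. A n) \<in> sets borel" for n using A by auto
    ultimately show "(\<lambda>n. ?\<nu> (A n)) sums ?\<nu> (\<Union>n. A n)" by simp
  next
    fix E :: "'a set" assume "E \<in> sets borel"
    show "tvar ?\<nu> E \<le> tvar \<mu> E"
    proof (rule tvar_least)
      fix P :: "'a set set" assume P: "finite P" "disjoint P" "P \<subseteq> sets borel" "\<Union>P = E"
      have "(\<Sum>A\<in>P. ennreal (cmod (?\<nu> A))) = (\<Sum>A\<in>P. tvar \<mu> A)"
        using P by (intro sum.cong) (auto simp: e)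
      also have "\<dots> \<le> tvar \<mu> (\<Union>P)" by (rule sum_tvar_le) (use P \<mu>0 in auto)
      finally show "(\<Sum>A\<in>P. ennreal (cmod (?\<nu> A))) \<le> tvar \<mu> E" using P by simp
    qed
  qed auto
  then show ?thesis
    by (auto simp: positive_measures_def complex_nonneg_Reals_iff)
qed

lemma complex_measures_Re:
  assumes \<mu>: "\<mu> \<in> complex_measures"
  shows "(\<lambda>E. complex_of_real (Re (\<mu> E))) \<in> complex_measures"
proof (rule complex_measures_dominated[OF \<mu>])
  fix E :: "'a set" 
  show "tvar (\<lambda>E. complex_of_real (Re (\<mu> E))) E \<le> tvar \<mu> E"
    by (rule tvar_mono_fun) (simp add: abs_Re_le_cmod)
qed (use complex_measures_outside[OF \<mu>] complex_measures_sums[OF \<mu>] in \<open>auto intro!: sums_of_real sums_Re\<close>)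

lemma positive_measures_complex: "\<mu> \<in> positive_measures \<Longrightarrow> \<mu> \<in> complex_measures"
  by (simp add: positive_measures_def)

text \<open>Reduces a property that is stable under linear combinations to the positive cone.
  Instead of a Hahn decomposition, a real measure is written as the sum of itself and its variation,
  minus its variation; both of these are positive.\<close>

lemma complex_measures_induct [consumes 1, case_names positive lincomb]:
  fixes \<mu> :: "'a::t2_space cmeas"
  assumes \<mu>: "\<mu> \<in> complex_measures"
    and pos: "\<And>\<mu>. \<mu> \<in> positive_measures \<Longrightarrow> Q \<mu>"
    and lin: "\<And>a b \<mu> \<nu>. \<mu> \<in> complex_measures \<Longrightarrow> \<nu> \<in> complex_measures \<Longrightarrow> Q \<mu> \<Longrightarrow> Q \<nu> \<Longrightarrow>
       Q (\<lambda>E. a * \<mu> E + b * \<nu> E)"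
  shows "Q \<mu>"
proof -
  have real: "Q (\<lambda>E. complex_of_real (Re (\<nu> E)))" if \<nu>: "\<nu> \<in> complex_measures" for \<nu> :: "'a cmeas"
  proof -
    define P where "P = (\<lambda>E. if E \<in> sets borel then complex_of_real (enn2real (tvar \<nu> E)) else 0)"
    have P: "P \<in> positive_measures" unfolding P_def by (rule tvar_positive_measure[OF \<nu>])
    define S where "S = (\<lambda>E. 1 * complex_of_real (Re (\<nu> E)) + 1 * P E)"
    have S: "S \<in> complex_measures"
      unfolding S_def by (intro complex_measures_lincomb complex_measures_Re \<nu> positive_measures_complex P)
    have "S E \<in> \<real>\<^sub>\<ge>\<^sub>0" for E
    proof (cases "E \<in> sets borel")
      case True
      have "ennreal (cmod (\<nu> E)) \<le> tvar \<nu> E"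
        by (rule cmod_le_tvar[OF True]) (rule complex_measures_empty[OF \<nu>])
      then have "cmod (\<nu> E) \<le> enn2real (tvar \<nu> E)"
        using tvar_finite[OF \<nu>, of E] using enn2real_mono by fastforce
      then have "0 \<le> Re (\<nu> E) + enn2real (tvar \<nu> E)"
        using abs_Re_le_cmod[of "\<nu> E"] by linarith
      then show ?thesis using True by (simp add: S_def P_def complex_nonneg_Reals_iff)
    next
      case False
      then show ?thesis by (simp add: S_def P_def complex_measures_outside[OF \<nu>])
    qed
    then have "S \<in> positive_measures" using S by (simp add: positive_measures_def)
    then have "Q (\<lambda>E. 1 * S E + (-1) * P E)"
      by (intro lin pos positive_measures_complex P)
    then show ?thesis by (simp add: S_def)
  qed
  \<comment> \<open>\<open>Re (N E)\<close> is the imaginary part of \<open>\<mu> E\<close>. The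
    summand with factor 0 only matches the shape of the closure under combinations.\<close>
  define N where "N = (\<lambda>E. (-\<i>) * \<mu> E + 0 * \<mu> E)"
  have N: "N \<in> complex_measures" unfolding N_def by (rule complex_measures_lincomb[OF \<mu> \<mu>])
  have "Q (\<lambda>E. 1 * complex_of_real (Re (\<mu> E)) + \<i> * complex_of_real (Re (N E)))"
    by (intro lin real complex_measures_Re \<mu> N)
  moreover have "1 * complex_of_real (Re (\<mu> E)) + \<i> * complex_of_real (Re (N E)) = \<mu> E" for E
    by (simp add: N_def complex_eq_iff)
  ultimately show ?thesis by simp
qed

section \<open>Positive set functions as measures\<close>

lemma space_eq_UNIV: "sets m = sets (borel :: 'a::topological_space measure) \<Longrightarrow> space m = UNIV"
  using sets_eq_imp_space_eq[of m borel] by simp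

text \<open>For a positive measure the supremum in \<open>jordan_pos\<close> is attained at
  \<open>E\<close> itself, and the three other Jordan parts in \<open>cm_integral\<close> are null.
  The integral defined by Jordan parts is thus the Lebesgue integral.\<close>

lemma cm_integral_of_measure:
  fixes m :: "'a::topological_space measure" and f :: "'a \<Rightarrow> complex"
  assumes "finite_measure m" and m: "sets m = sets borel"
  shows "cm_integral (of_measure m) f = (LINT x|m. f x)"
proof -
  interpret finite_measure m by fact
  have sp: "space m = UNIV" using m by (rule space_eq_UNIV)
  have "jordan_pos (\<lambda>E. measure m E) = measure_of (space m) (sets m) (emeasure m)"
    unfolding jordan_pos_def sp m
  proof (rule measure_of_eq)
    fix E :: "'a set" assume "E \<in> sigma_sets UNIV (sets borel)"
    then have E: "E \<in> sets m" using sets.sigma_sets_eq[of "borel :: 'a measure"] m by simp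
    have "(SUP A\<in>{A \<in> sets borel. A \<subseteq> E}. ennreal (measure m A)) = ennreal (measure m E)"
      by (rule antisym) (auto intro!: SUP_least ennreal_leI finite_measure_mono SUP_upper E simp: m[symmetric])
    then show "(SUP A\<in>{A \<in> sets borel. A \<subseteq> E}. ennreal (measure m A)) = emeasure m E"
      by (simp add: emeasure_eq_measure)
  qed (simp add: sets.space_closed)
  then have 1: "jordan_pos (\<lambda>E. measure m E) = m" by (simp add: measure_of_of_measure)
  have z: "jordan_pos \<nu> = null_measure borel" if "\<And>E. \<nu> E \<le> 0" for \<nu> :: "'a set \<Rightarrow> real"
  proof -
    have "(SUP A\<in>{A \<in> sets borel. A \<subseteq> E}. ennreal (\<nu> A)) = 0" for E
      using that by (auto simp: ennreal_neg intro!: antisym SUP_least)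
    then show ?thesis unfolding jordan_pos_def null_measure_def by simp
  qed
  have "jordan_pos (\<lambda>E. - measure m E) = null_measure borel" "jordan_pos (\<lambda>_. 0) = (null_measure borel :: 'a measure)"
    by (rule z, simp)+
  then show ?thesis by (simp add: cm_integral_def of_measure_def 1 integral_null_measure)
qed

text \<open>Inverse of \<open>of_measure\<close> on \<open>positive_measures\<close>: the values
  there are real, so \<open>Re\<close> loses nothing.\<close>

definition to_measure :: "'a::topological_space cmeas \<Rightarrow> 'a measure" where
  "to_measure \<mu> = measure_of UNIV (sets borel) (\<lambda>E. ennreal (Re (\<mu> E)))"

lemma sets_to_measure [simp, measurable_cong]: "sets (to_measure \<mu>) = sets borel"
  unfolding to_measure_def by (metis sets.sigma_sets_eq sets_measure_of space_borel sets.space_closed)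

lemma space_to_measure [simp]: "space (to_measure \<mu>) = UNIV"
  unfolding to_measure_def by (metis space_measure_of space_borel sets.space_closed)

lemma emeasure_to_measure:
  fixes \<mu> :: "'a::topological_space cmeas"
  assumes \<mu>: "\<mu> \<in> positive_measures" and E: "E \<in> sets borel"
  shows "emeasure (to_measure \<mu>) E = ennreal (Re (\<mu> E))"
proof -
  have \<mu>': "\<mu> \<in> complex_measures" using \<mu> by (rule positive_measures_complex)
  have nn: "Re (\<mu> E) \<ge> 0" for E using \<mu> by (auto simp: positive_measures_def complex_nonneg_Reals_iff)
  show ?thesis
    unfolding to_measure_def
  proof (rule emeasure_measure_of_sigma)
    show "sigma_algebra UNIV (sets (borel :: 'a measure))"
      by (metis sets.sigma_algebra_axioms space_borel)
    show "positive (sets borel) (\<lambda>E. ennreal (Re (\<mu> E)))"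
      by (simp add: positive_def complex_measures_empty[OF \<mu>'])
    show "countably_additive (sets borel) (\<lambda>E. ennreal (Re (\<mu> E)))"
    proof (rule countably_additiveI)
      fix A :: "nat \<Rightarrow> 'a set" assume "range A \<subseteq> sets borel" "disjoint_family A"
      then have "(\<lambda>n. Re (\<mu> (A n))) sums Re (\<mu> (\<Union>n. A n))"
        by (intro sums_Re complex_measures_sums[OF \<mu>'])
      then show "(\<Sum>n. ennreal (Re (\<mu> (A n)))) = ennreal (Re (\<mu> (\<Union>n. A n)))"
        by (simp add: suminf_ennreal2 nn sums_iff)
    qed
  qed (use E in simp)
qed

lemma finite_measure_to_measure: "\<mu> \<in> positive_measures \<Longrightarrow> finite_measure (to_measure \<mu>)"
  by (intro finite_measureI) (simp add: emeasure_to_measure)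

lemma of_measure_to_measure:
  assumes \<mu>: "\<mu> \<in> positive_measures"
  shows "of_measure (to_measure \<mu>) = \<mu>"
proof
  fix E
  have "Re (\<mu> E) \<ge> 0" "\<mu> E = complex_of_real (Re (\<mu> E))"
    using \<mu> by (auto simp: positive_measures_def complex_nonneg_Reals_iff complex_eq_iff)
  moreover have "E \<notin> sets borel \<Longrightarrow> measure (to_measure \<mu>) E = 0 \<and> \<mu> E = 0"
    using complex_measures_outside[OF positive_measures_complex[OF \<mu>]]
    by (simp add: measure_def emeasure_notin_sets)
  ultimately show "of_measure (to_measure \<mu>) E = \<mu> E"
    by (cases "E \<in> sets borel") (auto simp: of_measure_def measure_def emeasure_to_measure[OF \<mu>])
qed

lemma cm_integral_to_measure: "\<mu> \<in> positive_measures \<Longrightarrow> cm_integral \<mu> f = (LINT x|to_measure \<mu>. f x)"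
  using cm_integral_of_measure[OF finite_measure_to_measure sets_to_measure, of \<mu> f] by (simp add: of_measure_to_measure)

lemma tvar_of_measure:
  fixes m :: "'a::topological_space measure"
  assumes "finite_measure m" and m: "sets m = sets borel" and E: "E \<in> sets borel"
  shows "tvar (of_measure m) E = emeasure m E"
proof -
  interpret finite_measure m by fact
  show ?thesis
  proof (rule antisym)
    show "emeasure m E \<le> tvar (of_measure m) E"
      using cmod_le_tvar[OF E, of "of_measure m"] by (simp add: of_measure_def emeasure_eq_measure)
    show "tvar (of_measure m) E \<le> emeasure m E"
    proof (rule tvar_least)
      fix P :: "'a set set" assume P: "finite P" "disjoint P" "P \<subseteq> sets borel" "\<Union>P = E"
      have "(\<Sum>A\<in>P. ennreal (cmod (of_measure m A))) = (\<Sum>A\<in>P. emeasure m A)"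
        by (simp add: of_measure_def emeasure_eq_measure)
      also have "\<dots> = emeasure m (\<Union>A\<in>P. A)"
        by (rule sum_emeasure) (use P m in \<open>auto simp: disjoint_family_on_def disjoint_def\<close>)
      finally show "(\<Sum>A\<in>P. ennreal (cmod (of_measure m A))) \<le> emeasure m E" using P by simp
    qed
  qed
qed

lemma positive_measures_of_measureI:
  assumes "finite_measure m" "sets m = sets borel"
    and "\<And>E \<epsilon>. E \<in> sets borel \<Longrightarrow> \<epsilon> > 0 \<Longrightarrow>
      \<exists>C U. compact C \<and> open U \<and> C \<subseteq> E \<and> E \<subseteq> U \<and> tvar (of_measure m) (U - C) < \<epsilon>"
  shows "of_measure m \<in> positive_measures"
proof -
  interpret finite_measure m by fact
  have "of_measure m \<in> complex_measures"
    unfolding complex_measures_def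
  proof (safe, goal_cases)
    case (1 E)
    then show ?case by (simp add: of_measure_def measure_def emeasure_notin_sets assms(2))
  next
    case (2 A)
    have "(\<lambda>n. measure m (A n)) sums measure m (\<Union>n. A n)"
      using 2 assms(2) by (intro finite_measure_UNION) auto
    then show ?case by (simp add: of_measure_def sums_of_real_iff)
  next
    case 3
    then show ?case using tvar_of_measure[OF assms(1,2), of UNIV]
      by (simp add: tv_norm_def less_top[symmetric])
  next
    case (4 E \<epsilon>)
    then show ?case by (rule assms(3))
  qed
  then show ?thesis
    by (auto simp: positive_measures_def of_measure_def complex_nonneg_Reals_iff)
qed

text \<open>Regularity is the only point: in a Hausdorff space a singleton is compact and its
  complement is open.\<close>

lemma dirac_positive: "dirac (x :: 'a::t2_space) \<in> positive_measures"
  unfolding dirac_def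
proof (rule positive_measures_of_measureI)
  show fin: "finite_measure (return borel x)"
    by (intro prob_space.finite_measure prob_space_return) simp
  fix E :: "'a set" and \<epsilon> :: ennreal assume E: "E \<in> sets borel" "\<epsilon> > 0"
  have tv: "tvar (of_measure (return borel x)) A = indicator A x" if "A \<in> sets borel" for A
    using tvar_of_measure[OF fin _ that] that by simp
  show "\<exists>C U. compact C \<and> open U \<and> C \<subseteq> E \<and> E \<subseteq> U \<and> tvar (of_measure (return borel x)) (U - C) < \<epsilon>"
  proof (cases "x \<in> E")
    case True
    then show ?thesis using E
      by (intro exI[of _ "{x}"] exI[of _ UNIV]) (auto simp: tv)
  next
    case False
    then show ?thesis using E
      by (intro exI[of _ "{}"] exI[of _ "- {x}"]) (auto simp: tv open_Compl)
  qed
qed simp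

lemma dirac_complex: "dirac (x :: 'a::t2_space) \<in> complex_measures"
  by (rule positive_measures_complex[OF dirac_positive])

lemma cm_integral_dirac:
  fixes f :: "'a::topological_space \<Rightarrow> complex"
  assumes "f \<in> borel_measurable borel"
  shows "cm_integral (dirac x) f = f x"
proof -
  have "finite_measure (return borel x)"
    by (intro prob_space.finite_measure prob_space_return) simp
  then show ?thesis
    unfolding dirac_def using assms by (simp add: cm_integral_of_measure integral_return)
qed

lemma positive_measures_lincomb:
  fixes \<mu> \<nu> :: "'a::t2_space cmeas"
  assumes "\<mu> \<in> positive_measures" "\<nu> \<in> positive_measures" "0 \<le> a" "0 \<le> (b::real)"
  shows "(\<lambda>E. complex_of_real a * \<mu> E + complex_of_real b * \<nu> E) \<in> positive_measures"
  using assms complex_measures_lincomb[of \<mu> \<nu>] unfolding positive_measures_def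
  by (auto intro!: nonneg_Reals_add_I nonneg_Reals_mult_I)

lemma positive_measures_zero: "(\<lambda>E. 0) \<in> (positive_measures :: 'a::t2_space cmeas set)"
  using positive_measures_lincomb[OF dirac_positive dirac_positive, of 0 0] by simp

text \<open>Stands in for uniform continuity where no metric is given: an open cover by sets on
  which \<open>P x\<close> holds has a finite subcover, which is made disjoint. The cells are the
  source of all Riemann sums below; those with index below \<open>n\<close> already fill the
  space.\<close>

lemma compact_partition:
  fixes P :: "'a::topological_space \<Rightarrow> 'a \<Rightarrow> bool"
  assumes "compact (UNIV :: 'a set)"
    and "\<And>x. \<exists>U. open U \<and> x \<in> U \<and> (\<forall>z\<in>U. P x z)"
  shows "\<exists>(n :: nat) a A. disjoint_family A \<and> (\<forall>k::nat. A k \<in> sets borel) \<and> (\<Union>k<n. A k) = UNIV \<and>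
    (\<forall>k<n. \<forall>z\<in>A k. P (a k) z)"
proof -
  obtain U where U: "\<And>x. open (U x)" "\<And>x. x \<in> U x" "\<And>x z. z \<in> U x \<Longrightarrow> P x z"
    using assms(2) by metis
  obtain C where C: "finite C" "UNIV \<subseteq> (\<Union>x\<in>C. U x)"
    by (rule compactE_image[OF assms(1), of UNIV U]) (use U in auto)
  obtain a and n :: nat where a: "C = a ` {i. i < n}"
    using C(1) by (metis finite_imp_nat_seg_image_inj_on)
  define A where "A = disjointed (\<lambda>k. U (a k))"
  show ?thesis
  proof (intro exI conjI allI impI ballI)
    show "disjoint_family A" unfolding A_def by (rule disjoint_family_disjointed)
    have "range A \<subseteq> sets borel"
      unfolding A_def by (rule sets.range_disjointed_sets) (use U in auto)
    then show "A k \<in> sets borel" for k by auto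
    have "(\<Union>k\<in>{0..<n}. A k) = (\<Union>k\<in>{0..<n}. U (a k))"
      unfolding A_def by (rule finite_UN_disjointed_eq)
    then show "(\<Union>k<n. A k) = UNIV"
      using C(2) a by (auto simp: atLeast0LessThan lessThan_def)
    fix k z assume "z \<in> A k"
    then show "P (a k) z" using U(3) disjointed_subset unfolding A_def by fastforce
  qed
qed

lemma compact_bounded_range:
  fixes f :: "'a::topological_space \<Rightarrow> complex"
  assumes "compact (UNIV :: 'a set)" "continuous_on UNIV f"
  obtains B where "B > 0" "\<And>x. cmod (f x) \<le> B"
  using compact_imp_bounded[OF compact_continuous_image[OF assms(2,1)]]
  by (auto simp: bounded_pos)

lemma integrable_continuous:
  fixes f :: "'a::topological_space \<Rightarrow> complex"
  assumes "compact (UNIV :: 'a set)" "continuous_on UNIV f" "finite_measure m" "sets m = sets borel"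
  shows "integrable m f"
proof -
  interpret finite_measure m by fact
  obtain B where "\<And>x. cmod (f x) \<le> B" using compact_bounded_range[OF assms(1,2)] by metis
  moreover have "f \<in> borel_measurable m"
    using borel_measurable_continuous_onI[OF assms(2)] assms(4) by (simp cong: measurable_cong_sets)
  ultimately show ?thesis by (intro integrable_const_bound[of _ B]) auto
qed

text \<open>The values \<open>c k\<close> are arbitrary complex numbers, so that they can be samples
  of \<open>f\<close> as well as integrals over a second variable.\<close>

lemma riemann_sum_bound:
  fixes f :: "'a::topological_space \<Rightarrow> complex" and A :: "nat \<Rightarrow> 'a set" and c :: "nat \<Rightarrow> complex"
  assumes "finite_measure m" "sets m = sets borel" "integrable m f"
    and A: "disjoint_family A" "\<And>k. A k \<in> sets borel" "(\<Union>k<n. A k) = UNIV"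
    and c: "\<And>k z. k < n \<Longrightarrow> z \<in> A k \<Longrightarrow> cmod (f z - c k) \<le> \<epsilon>"
  shows "cmod ((LINT x|m. f x) - (\<Sum>k<n. measure m (A k) * c k)) \<le> \<epsilon> * measure m UNIV"
proof -
  interpret finite_measure m by fact
  have sp: "space m = UNIV" using assms(2) by (rule space_eq_UNIV)
  define g where "g = (\<lambda>x. \<Sum>k<n. indicator (A k) x *\<^sub>R c k)"
  have Am: "A k \<in> sets m" for k using A assms(2) by simp
  have i: "integrable m (\<lambda>x. indicator (A k) x *\<^sub>R c k)" for k
    using Am by (auto simp: less_top[symmetric])
  have gi: "integrable m g" unfolding g_def by (intro Bochner_Integration.integrable_sum i)
  have "(LINT x|m. indicator (A k) x *\<^sub>R c k) = measure m (A k) *\<^sub>R c k" for k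
    using Am[of k] by (simp add: less_top[symmetric] sp)
  then have gI: "(LINT x|m. g x) = (\<Sum>k<n. measure m (A k) * c k)"
    unfolding g_def by (subst Bochner_Integration.integral_sum[OF i]) (simp add: scaleR_conv_of_real sp)
  have gc: "g x = c k" if "x \<in> A k" "k < n" for x k
  proof -
    have u: "x \<in> A j \<Longrightarrow> j = k" for j
      using that disjoint_family_onD[OF A(1), of j k] by blast
    have "indicator (A j) x *\<^sub>R c j = (if j = k then c k else 0)" for j
      using u[of j] that(1) by (cases "j = k") (auto simp: indicator_def)
    then have "g x = (\<Sum>j<n. if j = k then c k else 0)" by (simp only: g_def)
    then show ?thesis using that(2) by simp
  qed
  have bd: "cmod (f x - g x) \<le> \<epsilon>" for x
  proof -
    obtain k where "k < n" "x \<in> A k" using A(3) by blast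
    then show ?thesis using c gc by metis
  qed
  have "(LINT x|m. f x) - (\<Sum>k<n. measure m (A k) * c k) = (LINT x|m. f x - g x)"
    using gi assms(3) by (simp add: gI)
  also have "cmod \<dots> \<le> (LINT x|m. cmod (f x - g x))"
    by (rule integral_norm_bound)
  also have "\<dots> \<le> (LINT x|m. \<epsilon>)"
    by (rule integral_mono) (use gi assms(3) bd in auto)
  also have "\<dots> = \<epsilon> * measure m UNIV" by (simp add: sp)
  finally show ?thesis .
qed

text \<open>Closes the approximation arguments: the accumulated factor \<open>M\<close> may be any
  real number that does not depend on \<open>\<epsilon>\<close>.\<close>

lemma nonpos_if_le_eps_mult:
  fixes x :: real
  assumes "\<And>\<epsilon>. \<epsilon> > 0 \<Longrightarrow> x \<le> \<epsilon> * M"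
  shows "x \<le> 0"
proof (rule tendsto_lowerbound)
  show "((\<lambda>\<epsilon>. \<epsilon> * M) \<longlongrightarrow> 0) (at_right 0)"
    by (auto intro!: tendsto_eq_intros)
  show "\<forall>\<^sub>F \<epsilon> in at_right 0. x \<le> \<epsilon> * M"
    using assms by (auto simp: eventually_at_right_field intro!: exI[of _ 1])
qed simp

lemma measure_to_measure: "\<mu> \<in> positive_measures \<Longrightarrow> complex_of_real (measure (to_measure \<mu>) E) = \<mu> E"
  using fun_cong[OF of_measure_to_measure, of \<mu> E] by (simp add: of_measure_def)

text \<open>Linearity in the measure is hidden by the Jordan decomposition inside
  \<open>cm_integral\<close>. Riemann sums are visibly linear in the measure, and a single
  partition, chosen for \<open>f\<close> alone, serves all three measures.\<close>

lemma cm_integral_lincomb: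
  fixes \<mu> \<nu> :: "'a::t2_space cmeas"
  assumes K: "compact (UNIV :: 'a set)" and f: "continuous_on UNIV f"
    and \<mu>: "\<mu> \<in> positive_measures" and \<nu>: "\<nu> \<in> positive_measures" and ab: "0 \<le> a" "0 \<le> (b::real)"
  shows "cm_integral (\<lambda>E. complex_of_real a * \<mu> E + complex_of_real b * \<nu> E) f
     = a * cm_integral \<mu> f + b * cm_integral \<nu> f"
proof -
  define \<xi> where "\<xi> = (\<lambda>E. complex_of_real a * \<mu> E + complex_of_real b * \<nu> E)"
  have \<xi>: "\<xi> \<in> positive_measures" unfolding \<xi>_def by (rule positive_measures_lincomb[OF \<mu> \<nu> ab])
  define M where "M = measure (to_measure \<xi>) UNIV + a * measure (to_measure \<mu>) UNIV + b * measure (to_measure \<nu>) UNIV"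
  have "cmod (cm_integral \<xi> f - (a * cm_integral \<mu> f + b * cm_integral \<nu> f)) \<le> \<epsilon> * M"
    if \<epsilon>: "\<epsilon> > 0" for \<epsilon>
  proof -
    have "\<exists>U. open U \<and> x \<in> U \<and> (\<forall>z\<in>U. cmod (f z - f x) \<le> \<epsilon>)" for x
      using f \<epsilon> by (intro exI[of _ "f -` ball (f x) \<epsilon>"])
        (auto intro!: open_vimage simp: dist_norm norm_minus_commute)
    note this' = this
    obtain n :: nat and p A where A0: "disjoint_family A \<and> (\<forall>k::nat. A k \<in> sets borel) \<and> (\<Union>k<n. A k) = UNIV \<and>
      (\<forall>k<n. \<forall>z\<in>A k. cmod (f z - f (p k)) \<le> \<epsilon>)"
      using compact_partition[OF K, of "\<lambda>x z. cmod (f z - f x) \<le> \<epsilon>", OF this'] by blast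
    then have A: "disjoint_family A" "\<And>k. A k \<in> sets borel" "(\<Union>k<n. A k) = UNIV"
      "\<And>k z. k < n \<Longrightarrow> z \<in> A k \<Longrightarrow> cmod (f z - f (p k)) \<le> \<epsilon>" by auto
    define S where "S = (\<lambda>\<mu>. \<Sum>k<n. \<mu> (A k) * f (p k))"
    have b: "cmod (cm_integral \<rho> f - S \<rho>) \<le> \<epsilon> * measure (to_measure \<rho>) UNIV" if \<rho>: "\<rho> \<in> positive_measures" for \<rho>
      using riemann_sum_bound[OF finite_measure_to_measure[OF \<rho>] sets_to_measure integrable_continuous[OF K f finite_measure_to_measure[OF \<rho>] sets_to_measure] A]
      by (simp add: cm_integral_to_measure[OF \<rho>] S_def measure_to_measure[OF \<rho>])
    have "S \<xi> = a * S \<mu> + b * S \<nu>"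
      by (simp add: S_def \<xi>_def algebra_simps sum.distrib sum_distrib_left)
    then have "cm_integral \<xi> f - (a * cm_integral \<mu> f + b * cm_integral \<nu> f)
       = (cm_integral \<xi> f - S \<xi>) - (a * (cm_integral \<mu> f - S \<mu>) + b * (cm_integral \<nu> f - S \<nu>))"
      by (simp add: algebra_simps)
    also have "cmod \<dots> \<le> cmod (cm_integral \<xi> f - S \<xi>) +
       (cmod (a * (cm_integral \<mu> f - S \<mu>)) + cmod (b * (cm_integral \<nu> f - S \<nu>)))"
      by (rule order_trans[OF norm_triangle_ineq4 add_left_mono[OF norm_triangle_ineq]])
    also have "\<dots> = cmod (cm_integral \<xi> f - S \<xi>) +
       (a * cmod (cm_integral \<mu> f - S \<mu>) + b * cmod (cm_integral \<nu> f - S \<nu>))"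
      using ab by (simp add: norm_mult)
    also have "\<dots> \<le> \<epsilon> * measure (to_measure \<xi>) UNIV +
       (a * (\<epsilon> * measure (to_measure \<mu>) UNIV) + b * (\<epsilon> * measure (to_measure \<nu>) UNIV))"
      by (intro add_mono mult_left_mono b \<xi> \<mu> \<nu> ab)
    finally show ?thesis by (simp add: M_def algebra_simps)
  qed
  then have "cmod (cm_integral \<xi> f - (a * cm_integral \<mu> f + b * cm_integral \<nu> f)) \<le> 0"
    by (rule nonpos_if_le_eps_mult)
  then show ?thesis by (simp add: \<xi>_def)
qed

section \<open>Weak topology and Riemann sums\<close>

lemma topspace_weak_topology: "topspace weak_topology = (complex_measures :: 'a::topological_space cmeas set)"
proof -
  let ?B = "{{\<mu> \<in> complex_measures. cm_integral \<mu> f \<in> U} |(f :: 'a \<Rightarrow> complex) U. continuous_on UNIV f \<and> open U}"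
  have "complex_measures = {\<mu> \<in> complex_measures. cm_integral \<mu> (\<lambda>_ :: 'a. 0) \<in> UNIV}" by simp
  moreover have "\<dots> \<in> ?B" by (intro CollectI exI conjI) (rule refl, auto)
  ultimately have "complex_measures \<in> ?B" by simp
  then have "complex_measures \<subseteq> \<Union>?B" by (rule Union_upper)
  moreover have "\<Union>?B \<subseteq> complex_measures" by (rule Union_least) auto
  ultimately show ?thesis
    unfolding weak_topology_def topology_generated_by_topspace by (rule antisym[rotated])
qed

lemma topspace_weak_cone: "topspace weak_cone_topology = positive_measures"
  unfolding weak_cone_topology_def topspace_subtopology topspace_weak_topology
  by (auto simp: positive_measures_def)

lemma continuous_map_cm_integral:
  assumes "continuous_on UNIV f"
  shows "continuous_map weak_topology euclidean (\<lambda>\<mu>. cm_integral \<mu> f)"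
  unfolding continuous_map topspace_weak_topology
proof (safe, simp)
  fix U :: "complex set" assume "openin euclidean U"
  then show "openin weak_topology {\<mu> \<in> complex_measures. cm_integral \<mu> f \<in> U}"
    unfolding weak_topology_def using assms by (intro topology_generated_by_Basis) auto
qed

lemma continuous_map_dirac:
  "continuous_map euclidean weak_cone_topology (dirac :: 'a::t2_space \<Rightarrow> 'a cmeas)"
  unfolding weak_cone_topology_def
proof (rule continuous_map_into_subtopology)
  show "continuous_map euclidean weak_topology (dirac :: 'a \<Rightarrow> 'a cmeas)"
    unfolding weak_topology_def
  proof (rule continuous_on_generated_topo)
    fix S :: "'a cmeas set"
    assume "S \<in> {{\<mu> \<in> complex_measures. cm_integral \<mu> f \<in> U} |f U. continuous_on UNIV f \<and> open U}"
    then obtain f U where S: "S = {\<mu> \<in> complex_measures. cm_integral \<mu> f \<in> U}"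
      and f: "continuous_on UNIV f" "open U" by blast
    have "dirac -` S = f -` U"
      using cm_integral_dirac[OF borel_measurable_continuous_onI[OF f(1)]]
      by (auto simp: S dirac_complex)
    then show "openin euclidean (dirac -` S \<inter> topspace euclidean)"
      using open_vimage[OF f(2,1)] by simp
  next
    note eq = topspace_weak_topology[unfolded weak_topology_def topology_generated_by_topspace, where 'a='a]
    show "dirac ` topspace euclidean \<subseteq> \<Union> {{\<mu> \<in> complex_measures. cm_integral \<mu> f \<in> U} |(f :: 'a \<Rightarrow> complex) U. continuous_on UNIV f \<and> open U}"
      unfolding eq image_subset_iff using dirac_complex by blast
  qed
qed (auto simp: dirac_positive)

text \<open>The topology is given by a subbasis, and finitely many test functions with one tolerance
  describe a neighbourhood inside any open set. In the induction on the generation of the topology,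
  an intersection merges the test sets and a union keeps one of them.\<close>

lemma weak_cone_neighbourhood:
  fixes S :: "'a::topological_space cmeas set"
  assumes S: "openin weak_cone_topology S" and \<nu>: "\<nu> \<in> S"
  shows "\<exists>G \<epsilon>. finite G \<and> (\<forall>g\<in>G. continuous_on UNIV g) \<and> \<epsilon> > 0 \<and>
    (\<forall>\<nu>'\<in>positive_measures. (\<forall>g\<in>G. cmod (cm_integral \<nu>' g - cm_integral \<nu> g) < \<epsilon>) \<longrightarrow> \<nu>' \<in> S)"
proof -
  \<comment> \<open>The induction takes place in all of \<open>complex_measures\<close>, where the
    topology is generated; the cone is brought in only afterwards.\<close>
  define R where "R = (\<lambda>(T :: 'a cmeas set) \<nu> (G :: ('a \<Rightarrow> complex) set) \<epsilon>. finite G \<and> (\<forall>g\<in>G. continuous_on UNIV g) \<and> (\<epsilon>::real) > 0 \<and>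
    (\<forall>\<nu>'\<in>complex_measures. (\<forall>g\<in>G. cmod (cm_integral \<nu>' g - cm_integral \<nu> g) < \<epsilon>) \<longrightarrow> \<nu>' \<in> T))"
  obtain T where T: "openin weak_topology T" "S = T \<inter> positive_measures"
    using S unfolding weak_cone_topology_def openin_subtopology by blast
  have "generate_topology_on {{\<mu> \<in> complex_measures. cm_integral \<mu> f \<in> U} |f U. continuous_on UNIV f \<and> open U} T"
    using T(1) unfolding weak_topology_def by (rule openin_topology_generated_by)
  then have "\<forall>\<nu>\<in>T. \<exists>G \<epsilon>. R T \<nu> G \<epsilon>"
  proof induction
    case Empty
    then show ?case by simp
  next
    case (Int a b)
    show ?case
    proof
      fix \<nu> assume \<nu>: "\<nu> \<in> a \<inter> b"
      obtain G \<epsilon> G' \<epsilon>' where "R a \<nu> G \<epsilon>" "R b \<nu> G' \<epsilon>'"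
        using Int.IH \<nu> by blast
      then have "R (a \<inter> b) \<nu> (G \<union> G') (min \<epsilon> \<epsilon>')" by (auto simp: R_def)
      then show "\<exists>G \<epsilon>. R (a \<inter> b) \<nu> G \<epsilon>" by blast
    qed
  next
    case (UN K)
    show ?case
    proof
      fix \<nu> assume "\<nu> \<in> \<Union>K"
      then obtain k where k: "k \<in> K" "\<nu> \<in> k" by blast
      obtain G \<epsilon> where "R k \<nu> G \<epsilon>"
        using UN.IH[OF k(1)] k(2) by blast
      then have "R (\<Union>K) \<nu> G \<epsilon>" using k(1) by (auto simp: R_def)
      then show "\<exists>G \<epsilon>. R (\<Union>K) \<nu> G \<epsilon>" by blast
    qed
  next
    case (Basis s)
    then obtain f U where s: "s = {\<mu> \<in> complex_measures. cm_integral \<mu> f \<in> U}"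
      and f: "continuous_on UNIV f" "open U" by blast
    show ?case
    proof
      fix \<nu> assume "\<nu> \<in> s"
      then obtain \<epsilon> where e: "\<epsilon> > 0" "\<And>z. dist z (cm_integral \<nu> f) < \<epsilon> \<Longrightarrow> z \<in> U"
        using f(2) s unfolding open_dist by auto
      then have "R s \<nu> {f} \<epsilon>" using f s by (auto simp: dist_norm R_def)
      then show "\<exists>G \<epsilon>. R s \<nu> G \<epsilon>" by blast
    qed
  qed
  then obtain G \<epsilon> where "R T \<nu> G \<epsilon>"
    using \<nu> T(2) by blast
  then show ?thesis
    by (intro exI[of _ G] exI[of _ \<epsilon>]) (auto simp: T(2) positive_measures_def R_def)
qed

lemma dirac_combination:
  fixes a :: "nat \<Rightarrow> 'a::t2_space" and c :: "nat \<Rightarrow> real"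
  assumes "\<And>k. k < n \<Longrightarrow> 0 \<le> c k"
  shows "(\<lambda>E. \<Sum>k<n. complex_of_real (c k) * dirac (a k) E) \<in> positive_measures"
  using assms
proof (induction n)
  case (Suc n)
  have "(\<lambda>E. complex_of_real 1 * (\<Sum>k<n. complex_of_real (c k) * dirac (a k) E) + complex_of_real (c n) * dirac (a n) E)
    \<in> positive_measures"
    by (intro positive_measures_lincomb dirac_positive Suc.IH) (use Suc.prems in auto)
  then show ?case by simp
qed (simp add: positive_measures_zero)

lemma cm_integral_combination:
  fixes \<mu> :: "nat \<Rightarrow> 'a::t2_space cmeas" and c :: "nat \<Rightarrow> real"
  assumes K: "compact (UNIV :: 'a set)" and f: "continuous_on UNIV f"
    and "\<And>k. k < n \<Longrightarrow> 0 \<le> c k" "\<And>k. \<mu> k \<in> positive_measures"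
  shows "(\<lambda>E. \<Sum>k<n. complex_of_real (c k) * \<mu> k E) \<in> positive_measures \<and>
    cm_integral (\<lambda>E. \<Sum>k<n. complex_of_real (c k) * \<mu> k E) f = (\<Sum>k<n. complex_of_real (c k) * cm_integral (\<mu> k) f)"
  using assms(3)
proof (induction n)
  case 0
  have "cm_integral (\<lambda>E. complex_of_real 0 * \<mu> 0 E + complex_of_real 0 * \<mu> 0 E) f = 0"
    by (subst cm_integral_lincomb[OF K f]) (use assms(4) in auto)
  then show ?case by (simp add: positive_measures_zero)
next
  case (Suc n)
  have p: "(\<lambda>E. \<Sum>k<n. complex_of_real (c k) * \<mu> k E) \<in> positive_measures" using Suc by simp
  have c: "0 \<le> c n" using Suc.prems by simp
  have "(\<lambda>E. complex_of_real 1 * (\<Sum>k<n. complex_of_real (c k) * \<mu> k E) + complex_of_real (c n) * \<mu> n E)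
    \<in> positive_measures"
    by (intro positive_measures_lincomb assms(4) p c) simp
  moreover have "cm_integral (\<lambda>E. complex_of_real 1 * (\<Sum>k<n. complex_of_real (c k) * \<mu> k E) + complex_of_real (c n) * \<mu> n E) f
    = (\<Sum>k<Suc n. complex_of_real (c k) * cm_integral (\<mu> k) f)"
    by (subst cm_integral_lincomb[OF K f p assms(4) _ c]) (use Suc in auto)
  ultimately show ?case by simp
qed

text \<open>A weakly continuous functional on the cone is determined by its values on point masses:
  Riemann sums approximate a measure weakly by combinations of point masses.\<close>

lemma cone_functional_integral:
  fixes \<Phi> :: "'a::t2_space cmeas \<Rightarrow> complex"
  assumes K: "compact (UNIV :: 'a set)"
    and \<Phi>: "continuous_map weak_cone_topology euclidean \<Phi>"
    and lin: "\<And>(n::nat) c a. (\<And>k. k < n \<Longrightarrow> 0 \<le> c k) \<Longrightarrow>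
      \<Phi> (\<lambda>E. \<Sum>k<n. complex_of_real (c k) * dirac (a k) E) = (\<Sum>k<n. complex_of_real (c k) * \<Phi> (dirac (a k)))"
    and \<nu>: "\<nu> \<in> positive_measures"
  shows "continuous_on UNIV (\<lambda>w. \<Phi> (dirac w))" "\<Phi> \<nu> = cm_integral \<nu> (\<lambda>w. \<Phi> (dirac w))"
proof -
  define F where "F = (\<lambda>w. \<Phi> (dirac w))"
  show "continuous_on UNIV (\<lambda>w. \<Phi> (dirac w))"
    using continuous_map_compose[OF continuous_map_dirac \<Phi>] by (simp add: o_def)
  then have F: "continuous_on UNIV F" by (simp add: F_def)
  define M where "M = measure (to_measure \<nu>) UNIV"
  have M: "M \<ge> 0" by (simp add: M_def)
  have "cmod (\<Phi> \<nu> - cm_integral \<nu> F) \<le> \<eta> * (1 + M)" if \<eta>: "\<eta> > 0" for \<eta>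
  proof -
    define S where "S = {\<nu>' \<in> topspace weak_cone_topology. \<Phi> \<nu>' \<in> ball (\<Phi> \<nu>) \<eta>}"
    have "openin weak_cone_topology S"
      unfolding S_def using \<Phi> by (rule openin_continuous_map_preimage) simp
    moreover have "\<nu> \<in> S" using \<nu> \<eta> by (simp add: S_def topspace_weak_cone)
    ultimately obtain G \<epsilon> where G: "finite G" "\<And>g. g \<in> G \<Longrightarrow> continuous_on UNIV g" "\<epsilon> > 0"
      "\<And>\<nu>'. \<nu>' \<in> positive_measures \<Longrightarrow> (\<And>g. g \<in> G \<Longrightarrow> cmod (cm_integral \<nu>' g - cm_integral \<nu> g) < \<epsilon>) \<Longrightarrow> \<nu>' \<in> S"
      using weak_cone_neighbourhood[of S \<nu>] by metis
    \<comment> \<open>The bound by \<open>\<eta>\<close> controls the integrand \<open>F\<close>.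
      The bound by \<open>\<epsilon> / (1 + M)\<close> gives
      \<open>\<delta> * M < \<epsilon>\<close>, which places the discrete measure
      \<open>\<nu>'\<close> below in the weak neighbourhood.\<close>
    define \<delta> where "\<delta> = min \<eta> (\<epsilon> / (1 + M))"
    have \<delta>: "\<delta> > 0" "\<delta> \<le> \<eta>" "\<delta> * M < \<epsilon>"
    proof -
      show "\<delta> > 0" "\<delta> \<le> \<eta>" using \<eta> G(3) M by (auto simp: \<delta>_def)
      have "\<delta> * M \<le> \<epsilon> / (1 + M) * M" using M by (intro mult_right_mono) (auto simp: \<delta>_def)
      also have "\<dots> < \<epsilon>" using G(3) M by (simp add: field_simps)
      finally show "\<delta> * M < \<epsilon>" .
    qed
    \<comment> \<open>One partition has to be fine enough for the test functions and for
      \<open>F\<close> at the same time.\<close>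
    define P where "P = (\<lambda>x z. \<forall>g\<in>insert F G. cmod (g z - g x) \<le> \<delta>)"
    have "\<exists>U. open U \<and> x \<in> U \<and> (\<forall>z\<in>U. P x z)" for x
    proof (intro exI conjI)
      show "open (\<Inter>g\<in>insert F G. g -` ball (g x) \<delta>)"
        using G F by (intro open_INT) (auto intro!: open_vimage)
      show "x \<in> (\<Inter>g\<in>insert F G. g -` ball (g x) \<delta>)" using \<delta> by auto
      show "\<forall>z\<in>(\<Inter>g\<in>insert F G. g -` ball (g x) \<delta>). P x z"
        by (auto simp: P_def dist_norm norm_minus_commute)
    qed
    note part = compact_partition[OF K, of P, OF this]
    obtain n :: nat and p A where A0: "disjoint_family A \<and> (\<forall>k::nat. A k \<in> sets borel) \<and> (\<Union>k<n. A k) = UNIV \<and>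
      (\<forall>k<n. \<forall>z\<in>A k. P (p k) z)"
      using part by blast
    then have A: "disjoint_family A" "\<And>k. A k \<in> sets borel" "(\<Union>k<n. A k) = UNIV"
      and PA: "\<And>g k z. g \<in> insert F G \<Longrightarrow> k < n \<Longrightarrow> z \<in> A k \<Longrightarrow> cmod (g z - g (p k)) \<le> \<delta>"
      by (auto simp: P_def)
    define c where "c = (\<lambda>k. measure (to_measure \<nu>) (A k))"
    \<comment> \<open>The mass of each cell is moved to the sample point of that cell.\<close>
    define \<nu>' where "\<nu>' = (\<lambda>E. \<Sum>k<n. complex_of_real (c k) * dirac (p k) E)"
    have c: "0 \<le> c k" for k by (simp add: c_def)
    have \<nu>': "\<nu>' \<in> positive_measures" unfolding \<nu>'_def by (rule dirac_combination) (rule c)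
    have approx: "cmod (cm_integral \<nu> g - (\<Sum>k<n. c k * g (p k))) \<le> \<delta> * M" if "g \<in> insert F G" for g :: "'a \<Rightarrow> complex"
    proof -
      have "continuous_on UNIV g" using that G F by auto
      then have "integrable (to_measure \<nu>) g"
        by (rule integrable_continuous[OF K _ finite_measure_to_measure[OF \<nu>] sets_to_measure])
      from riemann_sum_bound[OF finite_measure_to_measure[OF \<nu>] sets_to_measure this A, of "\<lambda>k. g (p k)" \<delta>] PA[OF that]
      show ?thesis by (simp add: c_def M_def cm_integral_to_measure[OF \<nu>])
    qed
    have "\<nu>' \<in> S"
    proof (rule G(4)[OF \<nu>'])
      fix g assume g: "g \<in> G"
      have "cm_integral \<nu>' g = (\<Sum>k<n. complex_of_real (c k) * cm_integral (dirac (p k)) g)"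
        unfolding \<nu>'_def using cm_integral_combination[OF K G(2)[OF g], of n c "\<lambda>k. dirac (p k)"] c dirac_positive
        by auto
      also have "\<dots> = (\<Sum>k<n. c k * g (p k))"
        using cm_integral_dirac[OF borel_measurable_continuous_onI[OF G(2)[OF g]]] by simp
      finally show "cmod (cm_integral \<nu>' g - cm_integral \<nu> g) < \<epsilon>"
        using approx[of g] g \<delta>(3) by (simp add: norm_minus_commute)
    qed
    then have "cmod (\<Phi> \<nu> - \<Phi> \<nu>') < \<eta>" by (simp add: S_def dist_norm)
    moreover have "\<Phi> \<nu>' = (\<Sum>k<n. c k * F (p k))"
      unfolding \<nu>'_def F_def by (rule lin) (rule c)
    moreover have "cmod (cm_integral \<nu> F - (\<Sum>k<n. c k * F (p k))) \<le> \<delta> * M"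
      by (rule approx) simp
    ultimately have "cmod (\<Phi> \<nu> - cm_integral \<nu> F) \<le> \<eta> + \<delta> * M"
      using norm_triangle_ineq4[of "\<Phi> \<nu> - \<Phi> \<nu>'" "cm_integral \<nu> F - (\<Sum>k<n. c k * F (p k))"] by simp
    also have "\<dots> \<le> \<eta> + \<eta> * M" using \<delta> M by (intro add_left_mono mult_right_mono) auto
    finally show ?thesis by (simp add: algebra_simps)
  qed
  then have "cmod (\<Phi> \<nu> - cm_integral \<nu> F) \<le> 0" by (rule nonpos_if_le_eps_mult)
  then show "\<Phi> \<nu> = cm_integral \<nu> (\<lambda>w. \<Phi> (dirac w))" by (simp add: F_def)
qed

text \<open>Compactness in the integration variable makes \<open>F (x', t)\<close> close to
  \<open>F (x, t)\<close> uniformly in \<open>t\<close> as soon as \<open>x'\<close> is near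
  \<open>x\<close>; the parameter space may be any topological space.\<close>

lemma continuous_param_integral:
  fixes F :: "'a::topological_space \<times> 'b::topological_space \<Rightarrow> complex"
  assumes K: "compact (UNIV :: 'b set)" and F: "continuous_on UNIV F"
    and m: "finite_measure m" "sets m = sets (borel :: 'b measure)"
  shows "continuous_on UNIV (\<lambda>x. LINT y|m. F (x, y))"
  unfolding continuous_on_def
proof
  interpret finite_measure m by fact
  fix x :: 'a
  have F': "continuous_on (UNIV \<times> UNIV) F" using F by simp
  have Fi: "integrable m (\<lambda>y. F (x, y))" for x
    by (rule integrable_continuous[OF K _ m]) (rule continuous_on_compose2[OF F], auto intro!: continuous_intros)
  show "((\<lambda>x. LINT y|m. F (x, y)) \<longlongrightarrow> (LINT y|m. F (x, y))) (at x within UNIV)"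
  proof (rule tendstoI)
    fix \<epsilon> :: real assume \<epsilon>: "\<epsilon> > 0"
    define M where "M = measure m UNIV"
    have M: "M \<ge> 0" by (simp add: M_def)
    obtain X0 where X0: "x \<in> X0" "open X0" "\<forall>x'\<in>X0 \<inter> UNIV. \<forall>t\<in>UNIV. dist (F (x', t)) (F (x, t)) \<le> \<epsilon> / (2 * (1 + M))"
      by (rule continuous_on_prod_compactE[OF F' K, of x "\<epsilon> / (2 * (1 + M))"]) (use \<epsilon> M in auto)
    have "dist (LINT y|m. F (x', y)) (LINT y|m. F (x, y)) < \<epsilon>" if "x' \<in> X0" for x'
    proof -
      have "dist (LINT y|m. F (x', y)) (LINT y|m. F (x, y)) = cmod (LINT y|m. F (x', y) - F (x, y))"
        using Fi by (simp add: dist_norm)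
      also have "\<dots> \<le> (LINT y|m. cmod (F (x', y) - F (x, y)))"
        by (rule integral_norm_bound)
      also have "\<dots> \<le> (LINT y|m. \<epsilon> / (2 * (1 + M)))"
        using Fi X0(3) that by (intro integral_mono) (auto simp: dist_norm)
      also have "\<dots> = \<epsilon> / (2 * (1 + M)) * M" by (simp add: M_def space_eq_UNIV[OF m(2)])
      also have "\<dots> < \<epsilon>"
      proof -
        have "\<epsilon> * M < \<epsilon> * (2 * (1 + M))" using \<epsilon> M by (intro mult_strict_left_mono) auto
        then show ?thesis using M by (simp add: field_simps)
      qed
      finally show ?thesis .
    qed
    then show "\<forall>\<^sub>F x' in at x within UNIV. dist (LINT y|m. F (x', y)) (LINT y|m. F (x, y)) < \<epsilon>"
      using X0 by (auto simp: eventually_at_topological)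
  qed
qed

text \<open>The product Borel structure is not needed here (it may be too small without a second
  countability class): a continuous kernel is uniformly close to a finite sum of kernels that are
  simple in the first variable.\<close>

lemma fubini_continuous:
  fixes F :: "'a::topological_space \<times> 'b::topological_space \<Rightarrow> complex"
  assumes K: "compact (UNIV :: 'a set)" "compact (UNIV :: 'b set)" and F: "continuous_on UNIV F"
    and m: "finite_measure m" "sets m = sets (borel :: 'a measure)"
    and m': "finite_measure m'" "sets m' = sets (borel :: 'b measure)"
  shows "(LINT x|m. LINT y|m'. F (x, y)) = (LINT y|m'. LINT x|m. F (x, y))"
proof -
  interpret m: finite_measure m by fact
  interpret m': finite_measure m' by fact
  define M where "M = measure m UNIV"
  define M' where "M' = measure m' UNIV"
  have F': "continuous_on (UNIV \<times> UNIV) F" using F by simp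
  have Fx: "continuous_on UNIV (\<lambda>y. F (x, y))" and Fy: "continuous_on UNIV (\<lambda>x. F (x, y))" for x y
    by (rule continuous_on_compose2[OF F], auto intro!: continuous_intros)+
  have Fxi: "integrable m' (\<lambda>y. F (x, y))" and Fyi: "integrable m (\<lambda>x. F (x, y))" for x y
    by (rule integrable_continuous K Fx Fy m m')+
  have c1: "integrable m (\<lambda>x. LINT y|m'. F (x, y))"
    by (intro integrable_continuous[OF K(1) _ m] continuous_param_integral[OF K(2) F m'])
  have "continuous_on UNIV (\<lambda>y. LINT x|m. (\<lambda>(y, x). F (x, y)) (y, x))"
    by (intro continuous_param_integral[OF K(1) _ m])
      (auto simp: case_prod_unfold intro!: continuous_on_compose2[OF F] continuous_intros)
  then have c2: "integrable m' (\<lambda>y. LINT x|m. F (x, y))"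
    by (intro integrable_continuous[OF K(2) _ m']) simp
  have "cmod ((LINT x|m. LINT y|m'. F (x, y)) - (LINT y|m'. LINT x|m. F (x, y))) \<le> \<epsilon> * (2 * M * M')"
    if \<epsilon>: "\<epsilon> > 0" for \<epsilon>
  proof -
    define P where "P = (\<lambda>x z. \<forall>y. cmod (F (z, y) - F (x, y)) \<le> \<epsilon>)"
    have "\<exists>U. open U \<and> x \<in> U \<and> (\<forall>z\<in>U. P x z)" for x
    proof -
      obtain X0 where "x \<in> X0" "open X0" "\<forall>x'\<in>X0 \<inter> UNIV. \<forall>t\<in>UNIV. dist (F (x', t)) (F (x, t)) \<le> \<epsilon>"
        by (rule continuous_on_prod_compactE[OF F' K(2), of x \<epsilon>]) (use \<epsilon> in auto)
      then show ?thesis by (intro exI[of _ X0]) (auto simp: P_def dist_norm)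
    qed
    note part = compact_partition[OF K(1), of P, OF this]
    obtain n :: nat and p A where A0: "disjoint_family A \<and> (\<forall>k::nat. A k \<in> sets borel) \<and> (\<Union>k<n. A k) = UNIV \<and>
      (\<forall>k<n. \<forall>z\<in>A k. P (p k) z)"
      using part by blast
    then have A: "disjoint_family A" "\<And>k. A k \<in> sets borel" "(\<Union>k<n. A k) = UNIV"
      and PA: "\<And>k z y. k < n \<Longrightarrow> z \<in> A k \<Longrightarrow> cmod (F (z, y) - F (p k, y)) \<le> \<epsilon>"
      by (auto simp: P_def)
    \<comment> \<open>The kernel is frozen at \<open>p k\<close> on each cell and integrated over
      the first variable. For a frozen kernel, exchanging the integrals is linearity of a finite
      sum; passing to it costs \<open>\<epsilon> * M * M'\<close> in either order.\<close>
    define S where "S = (\<lambda>y. \<Sum>k<n. measure m (A k) * F (p k, y))"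
    have Si: "integrable m' S" unfolding S_def by (intro Bochner_Integration.integrable_sum integrable_mult_right Fxi)
    have SI: "(LINT y|m'. S y) = (\<Sum>k<n. measure m (A k) * (LINT y|m'. F (p k, y)))"
      unfolding S_def by (subst Bochner_Integration.integral_sum) (auto intro!: Fxi)
    have "cmod ((LINT x|m. LINT y|m'. F (x, y)) - (\<Sum>k<n. measure m (A k) * (LINT y|m'. F (p k, y))))
      \<le> (\<epsilon> * M') * measure m UNIV"
    proof (rule riemann_sum_bound[OF m c1 A])
      fix k z assume kz: "k < n" "z \<in> A k"
      have "cmod ((LINT y|m'. F (z, y)) - (LINT y|m'. F (p k, y))) = cmod (LINT y|m'. F (z, y) - F (p k, y))"
        using Fxi by simp
      also have "\<dots> \<le> (LINT y|m'. cmod (F (z, y) - F (p k, y)))"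
        by (rule integral_norm_bound)
      also have "\<dots> \<le> (LINT y|m'. \<epsilon>)"
        using Fxi PA[OF kz] by (intro integral_mono) auto
      also have "\<dots> = \<epsilon> * M'" by (simp add: M'_def space_eq_UNIV[OF m'(2)])
      finally show "cmod ((LINT y|m'. F (z, y)) - (LINT y|m'. F (p k, y))) \<le> \<epsilon> * M'" .
    qed
    moreover have "cmod ((LINT y|m'. LINT x|m. F (x, y)) - (LINT y|m'. S y)) \<le> \<epsilon> * M * M'"
    proof -
      have "cmod ((LINT y|m'. LINT x|m. F (x, y)) - (LINT y|m'. S y)) = cmod (LINT y|m'. (LINT x|m. F (x, y)) - S y)"
        using c2 Si by simp
      also have "\<dots> \<le> (LINT y|m'. cmod ((LINT x|m. F (x, y)) - S y))"
        by (rule integral_norm_bound)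
      also have "\<dots> \<le> (LINT y|m'. \<epsilon> * M)"
      proof (rule integral_mono)
        fix y
        show "cmod ((LINT x|m. F (x, y)) - S y) \<le> \<epsilon> * M"
          unfolding S_def M_def by (rule riemann_sum_bound[OF m Fyi A]) (rule PA)
      qed (use c2 Si in auto)
      also have "\<dots> = \<epsilon> * M * M'" by (simp add: M'_def space_eq_UNIV[OF m'(2)])
      finally show ?thesis .
    qed
    ultimately show ?thesis
      using norm_triangle_ineq4[of "(LINT x|m. LINT y|m'. F (x, y)) - (LINT y|m'. S y)"
          "(LINT y|m'. LINT x|m. F (x, y)) - (LINT y|m'. S y)"]
      unfolding SI by (simp add: M_def algebra_simps)
  qed
  then have "cmod ((LINT x|m. LINT y|m'. F (x, y)) - (LINT y|m'. LINT x|m. F (x, y))) \<le> 0"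
    by (rule nonpos_if_le_eps_mult)
  then show ?thesis by simp
qed

section \<open>Translations\<close>

lemma Hausdorff_space_euclidean_t2: "Hausdorff_space (euclidean :: 'a::t2_space topology)"
  unfolding Hausdorff_space_def using separation_t2 by (auto simp: disjnt_def)

lemma compact_point_separation:
  fixes x :: "'a::t2_space"
  assumes "compact C" "x \<notin> C"
  shows "\<exists>V V'. open V \<and> open V' \<and> x \<in> V \<and> C \<subseteq> V' \<and> V \<inter> V' = {}"
proof -
  obtain V V' where "openin euclidean V" "openin euclidean V'" "{x} \<subseteq> V" "C \<subseteq> V'" "disjnt V V'"
    by (rule Hausdorff_space_compact_separation[OF Hausdorff_space_euclidean_t2, of "{x}" C])
      (use assms in \<open>auto simp: disjnt_def\<close>)
  then show ?thesis by (auto simp: disjnt_def)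
qed

text \<open>The complement of the support is a union of null open sets, but possibly an uncountable
  one. Inner regularity replaces it by a compact subset, for which finitely many of these sets
  suffice.\<close>

lemma emeasure_outside_support:
  fixes \<mu> :: "'a::t2_space cmeas"
  assumes \<mu>: "\<mu> \<in> positive_measures" and C: "closed (cm_support \<mu>)"
  shows "emeasure (to_measure \<mu>) (- cm_support \<mu>) = 0"
proof (rule ccontr)
  have tv: "tvar \<mu> A = emeasure (to_measure \<mu>) A" if "A \<in> sets borel" for A
    using tvar_of_measure[OF finite_measure_to_measure[OF \<mu>] sets_to_measure that] by (simp add: of_measure_to_measure[OF \<mu>])
  define N where "N = - cm_support \<mu>"
  have N: "N \<in> sets borel" "open N" using C by (auto simp: N_def)
  assume "emeasure (to_measure \<mu>) (- cm_support \<mu>) \<noteq> 0"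
  then have pos: "emeasure (to_measure \<mu>) N > 0" by (simp add: N_def zero_less_iff_neq_zero)
  \<comment> \<open>The assumed positive mass of \<open>N\<close> is itself the tolerance. Once
    \<open>C\<close> turns out to be null, \<open>N\<close> has less mass than itself.\<close>
  obtain C U where CU: "compact C" "open U" "C \<subseteq> N" "N \<subseteq> U" "tvar \<mu> (U - C) < emeasure (to_measure \<mu>) N"
    using complex_measures_regular[OF positive_measures_complex[OF \<mu>] N(1) pos] .
  have "\<exists>V. open V \<and> x \<in> V \<and> emeasure (to_measure \<mu>) V = 0" if "x \<in> C" for x
    using that CU(3) tv by (force simp: N_def cm_support_def)
  then obtain V where V: "\<And>x. x \<in> C \<Longrightarrow> open (V x)" "\<And>x. x \<in> C \<Longrightarrow> x \<in> V x" "\<And>x. x \<in> C \<Longrightarrow> emeasure (to_measure \<mu>) (V x) = 0"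
    by metis
  obtain D where D: "D \<subseteq> C" "finite D" "C \<subseteq> (\<Union>x\<in>D. V x)"
    by (rule compactE_image[OF CU(1), of C V]) (use V in auto)
  have "emeasure (to_measure \<mu>) C \<le> emeasure (to_measure \<mu>) (\<Union>x\<in>D. V x)"
  proof (rule emeasure_mono)
    have "open (\<Union>x\<in>D. V x)" using D V by (intro open_UN) auto
    then show "(\<Union>x\<in>D. V x) \<in> sets (to_measure \<mu>)" by simp
  qed (use D in simp)
  also have "\<dots> \<le> (\<Sum>x\<in>D. emeasure (to_measure \<mu>) (V x))"
    by (rule emeasure_subadditive_finite) (use D V in auto)
  also have "\<dots> = 0" using D V by (auto intro!: sum.neutral)
  finally have C0: "emeasure (to_measure \<mu>) C = 0" by simp
  have Cb: "C \<in> sets borel" using CU(1) by (intro borel_closed compact_imp_closed)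
  have "emeasure (to_measure \<mu>) N \<le> emeasure (to_measure \<mu>) ((U - C) \<union> C)"
    using CU Cb by (intro emeasure_mono) auto
  also have "\<dots> \<le> emeasure (to_measure \<mu>) (U - C) + emeasure (to_measure \<mu>) C"
    by (rule emeasure_subadditive) (use CU Cb in auto)
  also have "\<dots> < emeasure (to_measure \<mu>) N" using CU Cb C0 by (simp add: tv)
  finally show False by simp
qed

section \<open>Translates and associativity\<close>

context compact_hypergroup
begin

text \<open>The generalized translate \<open>f(x * y)\<close>: an average of \<open>f\<close> over
  the probability measure that replaces the product of two points.\<close>

definition transl :: "('a \<Rightarrow> complex) \<Rightarrow> 'a \<Rightarrow> 'a \<Rightarrow> complex" where
  "transl f x y = cm_integral (conv (dirac x) (dirac y)) f"

lemma conv_dirac_positive: "conv (dirac x) (dirac y) \<in> positive_measures"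
  using conv_dirac_prob[of x y] by (simp add: probability_measures_def)

lemma measure_conv_dirac: "measure (to_measure (conv (dirac x) (dirac y))) UNIV = 1"
  using conv_dirac_prob[of x y] measure_to_measure[OF conv_dirac_positive, of x y UNIV]
  by (simp add: probability_measures_def)

lemma prob_conv_dirac: "prob_space (to_measure (conv (dirac x) (dirac y)))"
  using finite_measure.emeasure_eq_measure[OF finite_measure_to_measure[OF conv_dirac_positive, of x y], of UNIV]
  by (intro prob_spaceI) (simp add: measure_conv_dirac)

lemma transl_to_measure: "transl f x y = (LINT w|to_measure (conv (dirac x) (dirac y)). f w)"
  unfolding transl_def by (rule cm_integral_to_measure[OF conv_dirac_positive])

lemma integrable_conv_dirac:
  "continuous_on UNIV f \<Longrightarrow> complex_integrable (to_measure (conv (dirac x) (dirac y))) f"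
  by (rule integrable_continuous[OF compact_space _ finite_measure_to_measure[OF conv_dirac_positive] sets_to_measure])

lemma conv_zero_right: "\<mu> \<in> complex_measures \<Longrightarrow> conv \<mu> (\<lambda>E. 0) = (\<lambda>E. 0)"
  using conv_linear_right[of \<mu> "dirac e" "dirac e" 0 0] by (simp add: dirac_complex)

lemma conv_zero_left: "\<mu> \<in> complex_measures \<Longrightarrow> conv (\<lambda>E. 0) \<mu> = (\<lambda>E. 0)"
  using conv_linear_left[of "dirac e" "dirac e" \<mu> 0 0] by (simp add: dirac_complex)

lemma conv_combination_right:
  assumes \<mu>: "\<mu> \<in> complex_measures" and c: "\<And>k. k < n \<Longrightarrow> 0 \<le> c k"
  shows "conv \<mu> (\<lambda>E. \<Sum>k<n::nat. complex_of_real (c k) * dirac (a k) E)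
     = (\<lambda>E. \<Sum>k<n. complex_of_real (c k) * conv \<mu> (dirac (a k)) E)"
  using c
proof (induction n)
  case (Suc n)
  have p: "(\<lambda>E. \<Sum>k<n. complex_of_real (c k) * dirac (a k) E) \<in> complex_measures"
    by (rule positive_measures_complex[OF dirac_combination]) (use Suc.prems in auto)
  show ?case
    using conv_linear_right[OF \<mu> p dirac_complex, of 1 "c n" "a n"] Suc by simp
qed (simp add: conv_zero_right[OF \<mu>])

lemma conv_combination_left:
  assumes \<mu>: "\<mu> \<in> complex_measures" and c: "\<And>k. k < n \<Longrightarrow> 0 \<le> c k"
  shows "conv (\<lambda>E. \<Sum>k<n::nat. complex_of_real (c k) * dirac (a k) E) \<mu>
     = (\<lambda>E. \<Sum>k<n. complex_of_real (c k) * conv (dirac (a k)) \<mu> E)"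
  using c
proof (induction n)
  case (Suc n)
  have p: "(\<lambda>E. \<Sum>k<n. complex_of_real (c k) * dirac (a k) E) \<in> complex_measures"
    by (rule positive_measures_complex[OF dirac_combination]) (use Suc.prems in auto)
  show ?case
    using conv_linear_left[OF p dirac_complex \<mu>, of 1 "c n" "a n"] Suc by simp
qed (simp add: conv_zero_left[OF \<mu>])

lemma continuous_map_conv:
  assumes "continuous_map X weak_cone_topology g" "continuous_map X weak_cone_topology h"
  shows "continuous_map X weak_topology (\<lambda>x. conv (g x) (h x))"
  using continuous_map_compose[OF continuous_map_pairedI[OF assms] conv_weakly_continuous]
  by (simp add: o_def)

text \<open>As a function of \<open>\<nu>\<close> the left-hand side is weakly continuous and
  additive on the cone, hence the integral of its values at point masses, which are translates of
  \<open>f\<close>. This makes associativity of \<open>conv\<close> available for functions.\<close>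

lemma transl_right:
  assumes f: "continuous_on UNIV f" and \<nu>: "\<nu> \<in> positive_measures"
  shows "cm_integral (conv (dirac u) \<nu>) f = cm_integral \<nu> (\<lambda>w. transl f u w)"
  unfolding transl_def
proof (rule cone_functional_integral(2)[OF compact_space _ _ \<nu>])
  show "continuous_map weak_cone_topology euclidean (\<lambda>\<nu>. cm_integral (conv (dirac u) \<nu>) f)"
    using continuous_map_compose[OF continuous_map_conv continuous_map_cm_integral[OF f], of weak_cone_topology "\<lambda>_. dirac u" "\<lambda>x. x"]
    by (simp add: o_def topspace_weak_cone dirac_positive)
  fix n :: nat and c :: "nat \<Rightarrow> real" and a
  assume c: "\<And>k. k < n \<Longrightarrow> 0 \<le> c k"
  show "cm_integral (conv (dirac u) (\<lambda>E. \<Sum>k<n. complex_of_real (c k) * dirac (a k) E)) f =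
    (\<Sum>k<n. complex_of_real (c k) * cm_integral (conv (dirac u) (dirac (a k))) f)"
    using conv_combination_right[OF dirac_complex, where c = c and n = n and a = a, OF c] cm_integral_combination[OF compact_space f, where c = c and n = n and \<mu> = "\<lambda>k. conv (dirac u) (dirac (a k))"]
      c conv_dirac_positive by auto
qed

lemma transl_left:
  assumes f: "continuous_on UNIV f" and \<nu>: "\<nu> \<in> positive_measures"
  shows "cm_integral (conv \<nu> (dirac u)) f = cm_integral \<nu> (\<lambda>w. transl f w u)"
  unfolding transl_def
proof (rule cone_functional_integral(2)[OF compact_space _ _ \<nu>])
  show "continuous_map weak_cone_topology euclidean (\<lambda>\<nu>. cm_integral (conv \<nu> (dirac u)) f)"
    using continuous_map_compose[OF continuous_map_conv continuous_map_cm_integral[OF f], of weak_cone_topology "\<lambda>x. x" "\<lambda>_. dirac u"]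
    by (simp add: o_def topspace_weak_cone dirac_positive)
  fix n :: nat and c :: "nat \<Rightarrow> real" and a
  assume c: "\<And>k. k < n \<Longrightarrow> 0 \<le> c k"
  show "cm_integral (conv (\<lambda>E. \<Sum>k<n. complex_of_real (c k) * dirac (a k) E) (dirac u)) f =
    (\<Sum>k<n. complex_of_real (c k) * cm_integral (conv (dirac (a k)) (dirac u)) f)"
    using conv_combination_left[OF dirac_complex, where c = c and n = n and a = a, OF c] cm_integral_combination[OF compact_space f, where c = c and n = n and \<mu> = "\<lambda>k. conv (dirac (a k)) (dirac u)"]
      c conv_dirac_positive by auto
qed

text \<open>Both sides integrate \<open>f\<close> against the product of the point masses at
  \<open>u\<close>, \<open>x\<close> and \<open>y\<close>, bracketed in the two possible
  ways.\<close>

lemma transl_transl: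
  assumes f: "continuous_on UNIV f"
  shows "transl (\<lambda>w. transl f u w) x y = transl (\<lambda>w. transl f w y) u x"
  using transl_right[OF f conv_dirac_positive, of u x y] transl_left[OF f conv_dirac_positive, of u x y]
  by (simp add: transl_def conv_assoc dirac_complex)

lemma continuous_map_dirac_comp:
  assumes "continuous_on UNIV g"
  shows "continuous_map euclidean weak_cone_topology (\<lambda>x. dirac (g x :: 'a))"
  using continuous_map_compose[of euclidean euclidean g, OF _ continuous_map_dirac] assms by (simp add: o_def)

lemma continuous_transl:
  fixes g h :: "'b::topological_space \<Rightarrow> 'a"
  assumes f: "continuous_on UNIV f" and gh: "continuous_on UNIV g" "continuous_on UNIV h"
  shows "continuous_on UNIV (\<lambda>x. transl f (g x) (h x))"
  using continuous_map_compose[OF continuous_map_conv[OF gh[THEN continuous_map_dirac_comp]] continuous_map_cm_integral[OF f]]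
  by (simp add: o_def transl_def)

text \<open>Here the integrand and the measure vary together, so \<open>continuous_transl\<close>
  does not apply to the outer translate. Continuity is read off from the triple convolution
  instead.\<close>

lemma continuous_transl_transl:
  fixes g h v :: "'b::topological_space \<Rightarrow> 'a"
  assumes f: "continuous_on UNIV f" and gh: "continuous_on UNIV g" "continuous_on UNIV h" "continuous_on UNIV v"
  shows "continuous_on UNIV (\<lambda>x. transl (\<lambda>w. transl f (g x) w) (h x) (v x))"
proof -
  have "continuous_map euclidean weak_cone_topology (\<lambda>x. conv (dirac (h x)) (dirac (v x)))"
    unfolding weak_cone_topology_def
    by (rule continuous_map_into_subtopology[OF continuous_map_conv[OF gh(2,3)[THEN continuous_map_dirac_comp]]])
      (auto simp: conv_dirac_positive)
  from continuous_map_compose[OF continuous_map_conv[OF gh(1)[THEN continuous_map_dirac_comp] this] continuous_map_cm_integral[OF f]]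
  have "continuous_on UNIV (\<lambda>x. cm_integral (conv (dirac (g x)) (conv (dirac (h x)) (dirac (v x)))) f)"
    by (simp add: o_def)
  then show ?thesis
    by (simp add: transl_right[OF f conv_dirac_positive] transl_def[of "\<lambda>w. transl f _ w"])
qed

section \<open>The involution on points, measures and functions\<close>

lemma chk_image: "chk ` E = chk -` E"
proof
  show "chk ` E \<subseteq> chk -` E" by (auto simp: chk_chk)
  show "chk -` E \<subseteq> chk ` E"
  proof
    fix x assume "x \<in> chk -` E"
    then have "chk (chk x) \<in> chk ` E" by blast
    then show "x \<in> chk ` E" by (simp add: chk_chk)
  qed
qed

lemma borel_measurable_chk: "chk \<in> borel \<rightarrow>\<^sub>M borel"
  by (rule borel_measurable_continuous_onI[OF chk_continuous])

lemma chk_vimage_borel: "chk -` E \<in> sets borel \<longleftrightarrow> E \<in> sets borel"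
proof -
  have *: "E \<in> sets borel \<Longrightarrow> chk -` E \<in> sets borel" for E
    using measurable_sets[OF borel_measurable_chk, of E] by simp
  have "chk -` chk -` E = E" by (simp add: vimage_def chk_chk)
  then show ?thesis using *[of E] *[of "chk -` E"] by metis
qed

lemma cm_check_dirac: "cm_check chk (dirac x) = dirac (chk x)"
proof
  fix E
  show "cm_check chk (dirac x) E = dirac (chk x) E"
  proof (cases "E \<in> sets borel")
    case True
    then have "chk -` E \<in> sets borel" by (simp add: chk_vimage_borel)
    with True show ?thesis
      by (simp add: cm_check_def dirac_def of_measure_def chk_image measure_return indicator_def)
  next
    case False
    then have "chk -` E \<notin> sets borel" by (simp add: chk_vimage_borel)
    with False show ?thesis
      using complex_measures_outside[OF dirac_complex[of x], of "chk -` E"]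
        complex_measures_outside[OF dirac_complex[of "chk x"], of E] by (simp add: cm_check_def chk_image)
  qed
qed

text \<open>Since \<open>chk\<close> is its own inverse, \<open>cm_check chk \<mu>\<close> is the
  image measure of \<open>\<mu>\<close> under \<open>chk\<close>.\<close>

lemma cm_integral_check:
  assumes \<mu>: "\<mu> \<in> positive_measures" and f: "continuous_on UNIV f"
  shows "cm_integral (cm_check chk \<mu>) f = cm_integral \<mu> (\<lambda>x. f (chk x))"
proof -
  interpret finite_measure "to_measure \<mu>" by (rule finite_measure_to_measure[OF \<mu>])
  have m: "chk \<in> to_measure \<mu> \<rightarrow>\<^sub>M borel" using borel_measurable_chk by (simp cong: measurable_cong_sets)
  have "cm_check chk \<mu> = of_measure (distr (to_measure \<mu>) borel chk)"
  proof
    fix E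
    show "cm_check chk \<mu> E = of_measure (distr (to_measure \<mu>) borel chk) E"
    proof (cases "E \<in> sets borel")
      case True
      then show ?thesis
        using measure_to_measure[OF \<mu>, of "chk -` E"] measure_distr[OF m, of E]
        by (simp add: cm_check_def chk_image of_measure_def)
    next
      case False
      then show ?thesis
        using complex_measures_outside[OF positive_measures_complex[OF \<mu>], of "chk -` E"]
        by (simp add: cm_check_def chk_image of_measure_def chk_vimage_borel measure_def emeasure_notin_sets)
    qed
  qed
  then show ?thesis
    using cm_integral_of_measure[OF finite_measure_distr[OF m], of f]
      integral_distr[OF m borel_measurable_continuous_onI[OF f]]
    by (simp add: cm_integral_to_measure[OF \<mu>])
qed

text \<open>The involution reverses products, so the two arguments change places. This is how
  invariance of Haar measure in one variable of a translate is carried over to the other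
  variable.\<close>

lemma transl_chk:
  assumes f: "continuous_on UNIV f"
  shows "transl f (chk x) (chk y) = transl (\<lambda>w. f (chk w)) y x"
  using conv_check[OF dirac_complex dirac_complex, of y x] cm_integral_check[OF conv_dirac_positive f, of y x]
  by (simp add: transl_def cm_check_dirac)

text \<open>Continuity of the supports makes the vanishing uniform: a bump near the identity gives a
  kernel supported near the diagonal.\<close>

lemma kernel_concentration:
  assumes W: "closed W" "\<And>x. (x, x) \<notin> W"
  shows "\<exists>U. open U \<and> e \<in> U \<and> (\<forall>k u w. (\<forall>x. x \<notin> U \<longrightarrow> k x = 0) \<longrightarrow> (u, w) \<in> W \<longrightarrow> transl k (chk u) w = 0)"
proof -
  define sp where "sp = (\<lambda>u w. cm_support (conv (dirac (chk u)) (dirac w)))"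
  have spc: "compact (sp u w)" for u w unfolding sp_def by (rule conv_dirac_compact_support)
  define R where "R = (\<lambda>p V N. open V \<and> e \<in> V \<and> open N \<and> p \<in> N \<and> (\<forall>u w. (u, w) \<in> N \<longrightarrow> sp u w \<inter> V = {}))"
  have loc: "\<exists>V N. R p V N" if "p \<in> W" for p
  proof -
    obtain u w where p: "p = (u, w)" by force
    have "u \<noteq> w" using W(2)[of u] that p by auto
    then have "e \<notin> sp u w"
      using identity_in_support[of "chk u" w] chk_chk by (metis sp_def)
    then have "\<exists>V V'. open V \<and> open V' \<and> e \<in> V \<and> sp u w \<subseteq> V' \<and> V \<inter> V' = {}"
      by (rule compact_point_separation[OF spc])
    then obtain V V' where V: "open V" "open V'" "e \<in> V" "sp u w \<subseteq> V'" "V \<inter> V' = {}" by blast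
    \<comment> \<open>A basic open set of the Michael topology. Its preimage consists of the pairs
      whose support stays inside \<open>V'\<close> and so misses the neighbourhood \<open>V\<close>
      of the identity; the intersection with \<open>UNIV\<close> excludes the empty set.\<close>
    define \<C> where "\<C> = {C :: 'a set. compact C \<and> C \<inter> UNIV \<noteq> {} \<and> C \<subseteq> V'}"
    have "openin michael_topology \<C>"
      unfolding michael_topology_def \<C>_def using V by (intro topology_generated_by_Basis) blast
    then have "openin euclidean {q \<in> topspace euclidean. (\<lambda>(x, y). cm_support (conv (dirac x) (dirac y))) q \<in> \<C>}"
      by (rule openin_continuous_map_preimage[OF conv_dirac_support_continuous])
    then have op: "open {q. (\<lambda>(x, y). cm_support (conv (dirac x) (dirac y))) q \<in> \<C>}" by simp
    define N where "N = (\<lambda>(u, w). (chk u, w)) -` {q. (\<lambda>(x, y). cm_support (conv (dirac x) (dirac y))) q \<in> \<C>}"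
    have "continuous_on UNIV (\<lambda>(u, w). (chk u, w :: 'a))"
      by (auto simp: case_prod_unfold intro!: continuous_intros continuous_on_compose2[OF chk_continuous])
    then have "open N" unfolding N_def by (rule open_vimage[OF op])
    \<comment> \<open>A measure with empty support would be null by
      \<open>emeasure_outside_support\<close>, against total mass 1.\<close>
    moreover have "sp u w \<noteq> {}"
    proof
      assume 0: "sp u w = {}"
      then have "emeasure (to_measure (conv (dirac (chk u)) (dirac w))) UNIV = 0"
        using emeasure_outside_support[OF conv_dirac_positive, of "chk u" w] by (simp add: sp_def)
      then show False using measure_conv_dirac[of "chk u" w] by (simp add: measure_def)
    qed
    then have "p \<in> N" using V spc[of u w] by (auto simp: N_def \<C>_def p sp_def)
    moreover have "\<forall>u w. (u, w) \<in> N \<longrightarrow> sp u w \<inter> V = {}" using V by (auto simp: N_def \<C>_def sp_def)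
    ultimately have "R p V N" using V by (simp add: R_def)
    then show ?thesis by blast
  qed
  then obtain V N where "\<And>p. p \<in> W \<Longrightarrow> R p (V p) (N p)" by metis
  then have VN: "\<And>p. p \<in> W \<Longrightarrow> open (V p)" "\<And>p. p \<in> W \<Longrightarrow> e \<in> V p" "\<And>p. p \<in> W \<Longrightarrow> open (N p)"
    "\<And>p. p \<in> W \<Longrightarrow> p \<in> N p" "\<And>p u w. p \<in> W \<Longrightarrow> (u, w) \<in> N p \<Longrightarrow> sp u w \<inter> V p = {}"
    unfolding R_def by blast+
  have "compact (UNIV :: ('a \<times> 'a) set)" using compact_Times[OF compact_space compact_space] by simp
  then have "compact W" using W(1) by (metis compact_Int_closed inf_top_left)
  then obtain D where D: "D \<subseteq> W" "finite D" "W \<subseteq> (\<Union>p\<in>D. N p)"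
    by (rule compactE_image[of W W N]) (use VN in auto)
  show ?thesis
  proof (intro exI conjI allI impI)
    show "open (\<Inter>p\<in>D. V p)" using D VN by (intro open_INT) auto
    show "e \<in> (\<Inter>p\<in>D. V p)" using D VN by auto
    fix k :: "'a \<Rightarrow> complex" and u w
    assume k: "\<forall>x. x \<notin> (\<Inter>p\<in>D. V p) \<longrightarrow> k x = 0" and uw: "(u, w) \<in> W"
    then obtain p where p: "p \<in> D" "(u, w) \<in> N p" using D by blast
    then have "k x = 0" if "x \<in> sp u w" for x
      using VN(5)[of p u w] D(1) that k by blast
    \<comment> \<open>The function \<open>k\<close> is known to vanish only on the support; the
      measure has no mass elsewhere.\<close>
    moreover have "AE x in to_measure (conv (dirac (chk u)) (dirac w)). x \<in> sp u w"
      using emeasure_outside_support[OF conv_dirac_positive compact_imp_closed[OF spc[of u w, unfolded sp_def]]]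
        compact_imp_closed[OF spc[of u w]]
      by (intro AE_I[of _ _ "- sp u w"]) (auto simp: sp_def)
    ultimately have "AE x in to_measure (conv (dirac (chk u)) (dirac w)). k x = 0" by (auto elim!: eventually_mono)
    then show "transl k (chk u) w = 0"
      unfolding transl_to_measure by (rule integral_eq_zero_AE)
  qed
qed

end

section \<open>Haar measure\<close>

lemma norm_integral_le_const:
  fixes f :: "'a \<Rightarrow> complex"
  assumes "prob_space m" "\<And>x. cmod (f x) \<le> c" "integrable m f"
  shows "cmod (LINT x|m. f x) \<le> c"
proof -
  interpret prob_space m by fact
  have "cmod (LINT x|m. f x) \<le> (LINT x|m. cmod (f x))" by (rule integral_norm_bound)
  also have "\<dots> \<le> (LINT x|m. c)" by (rule integral_mono) (use assms in auto)
  finally show ?thesis by (simp add: prob_space)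
qed

lemma cm_support_dirac: "cm_support (dirac (x :: 'a::t2_space)) \<subseteq> {x}"
proof
  fix y assume y: "y \<in> cm_support (dirac x)"
  show "y \<in> {x}"
  proof (rule ccontr)
    assume "y \<notin> {x}"
    then have "tvar (dirac x) (- {x}) > 0" using y by (auto simp: cm_support_def)
    moreover have "finite_measure (return borel x)"
      by (intro prob_space.finite_measure prob_space_return) simp
    ultimately show False
      using tvar_of_measure[of "return borel x" "- {x}"] by (simp add: dirac_def)
  qed
qed

locale haar_hypergroup = compact_hypergroup conv chk e
  for conv :: "'a::t2_space cmeas \<Rightarrow> 'a cmeas \<Rightarrow> 'a cmeas" and chk e +
  fixes haar :: "'a measure"
  assumes haar: "normalized_haar_measure conv haar"
begin

lemma sets_haar [simp, measurable_cong]: "sets haar = sets borel"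
  using haar by (simp add: normalized_haar_measure_def)

lemma space_haar [simp]: "space haar = UNIV"
  by (rule space_eq_UNIV[OF sets_haar])

lemma prob_space_haar: "prob_space haar"
  using haar by (simp add: normalized_haar_measure_def)

lemma finite_measure_haar: "finite_measure haar"
  using prob_space_haar by (rule prob_space.finite_measure)

lemma measure_haar_UNIV: "measure haar UNIV = 1"
  using prob_space.prob_space[OF prob_space_haar] by simp

lemma integrable_haar: "continuous_on UNIV f \<Longrightarrow> complex_integrable haar f"
  by (rule integrable_continuous[OF compact_space _ finite_measure_haar sets_haar])

lemma haar_transl:
  "continuous_on UNIV f \<Longrightarrow> (LINT y|haar. transl f x y) = (LINT y|haar. f y)"
  using haar by (simp add: normalized_haar_measure_def transl_def)

lemma continuous_chk: "continuous_on S g \<Longrightarrow> continuous_on S (\<lambda>x. chk (g x))"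
  by (rule continuous_on_compose2[OF chk_continuous]) auto

lemma continuous_comp_chk: "continuous_on UNIV f \<Longrightarrow> continuous_on UNIV (\<lambda>x. f (chk x))"
  by (rule continuous_on_compose2[OF _ chk_continuous]) auto

text \<open>\<open>f(chk x * y)\<close> is integrated over both variables. With \<open>y\<close> as
  the inner variable, left invariance gives the integral of \<open>f\<close>. With \<open>x\<close>
  as the inner variable, \<open>transl_chk\<close> turns the integrand into a left translate of
  \<open>f\<close> composed with \<open>chk\<close>.\<close>

lemma haar_chk:
  fixes f :: "'a \<Rightarrow> complex"
  assumes f: "continuous_on UNIV f"
  shows "(LINT x|haar. f (chk x)) = (LINT x|haar. f x)"
proof -
  define F where "F = (\<lambda>(x, y). transl f (chk x) y)"
  have F: "continuous_on UNIV F"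
    unfolding F_def case_prod_unfold by (intro continuous_transl f continuous_chk continuous_intros)
  have "(LINT x|haar. f x) = (LINT x|haar. LINT y|haar. F (x, y))"
    by (simp add: F_def haar_transl[OF f] measure_haar_UNIV)
  also have "\<dots> = (LINT y|haar. LINT x|haar. F (x, y))"
    by (rule fubini_continuous[OF compact_space compact_space F finite_measure_haar sets_haar finite_measure_haar sets_haar])
  also have "\<dots> = (LINT y|haar. LINT x|haar. transl (\<lambda>w. f (chk w)) (chk y) x)"
    using transl_chk[OF f, of _ "chk _"] by (simp add: F_def chk_chk)
  also have "\<dots> = (LINT x|haar. f (chk x))"
    by (simp add: haar_transl[OF continuous_comp_chk[OF f]] measure_haar_UNIV)
  finally show ?thesis by simp
qed

section \<open>Positivity of Haar integrals\<close>

lemma transl_of_real: "transl (\<lambda>x. complex_of_real (r x)) x y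
    = complex_of_real (LINT w|to_measure (conv (dirac x) (dirac y)). r w)"
  by (simp add: transl_to_measure)

lemma continuous_of_real: "continuous_on UNIV r \<Longrightarrow> continuous_on UNIV (\<lambda>x. complex_of_real (r x))"
  by (intro continuous_intros)

lemma integrable_haar_real:
  fixes r :: "'a \<Rightarrow> real"
  assumes "continuous_on UNIV r" shows "integrable haar r"
  using integrable_Re[OF integrable_haar[OF continuous_of_real[OF assms]]] by simp

lemma integrable_conv_dirac_real:
  fixes r :: "'a \<Rightarrow> real"
  assumes "continuous_on UNIV r" shows "integrable (to_measure (conv (dirac x) (dirac y))) r"
  using integrable_Re[OF integrable_conv_dirac[OF continuous_of_real[OF assms]]] by simp

text \<open>If the integral were 0, every left translate \<open>g x\<close> would vanish almost
  everywhere. Yet \<open>g x\<close> is positive at \<open>x\<close>, so the null open sets where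
  some \<open>g x\<close> is positive cover the space. By compactness finitely many of them do,
  which contradicts total mass 1.\<close>

lemma haar_bump_pos:
  fixes r :: "'a \<Rightarrow> real"
  assumes r: "continuous_on UNIV r" "\<And>x. 0 \<le> r x" "r e > 0"
  shows "(LINT x|haar. r x) > 0"
proof (rule ccontr)
  assume "\<not> ?thesis"
  moreover have "(LINT x|haar. r x) \<ge> 0" using r by (intro Bochner_Integration.integral_nonneg) auto
  ultimately have r0: "(LINT x|haar. r x) = 0" by simp
  define k where "k = (\<lambda>x. complex_of_real (r x))"
  have k: "continuous_on UNIV k" unfolding k_def by (rule continuous_of_real[OF r(1)])
  define g where "g = (\<lambda>x z. LINT w|to_measure (conv (dirac (chk x)) (dirac z)). r w)"
  have gk: "transl k (chk x) z = complex_of_real (g x z)" for x z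
    unfolding k_def g_def by (rule transl_of_real)
  have gc: "continuous_on UNIV (g x)" for x
  proof -
    have "continuous_on UNIV (\<lambda>z. Re (transl k (chk x) z))"
      by (intro continuous_intros continuous_transl k)
    then show ?thesis by (simp add: gk)
  qed
  have gn: "g x z \<ge> 0" for x z unfolding g_def using r by (intro Bochner_Integration.integral_nonneg) auto
  have g0: "emeasure haar {z. g x z > 0} = 0" for x
  proof -
    have "complex_of_real (LINT z|haar. g x z) = complex_of_real (LINT z|haar. r z)"
      using haar_transl[OF k, of "chk x"] by (simp add: gk) (simp add: k_def)
    then have "(LINT z|haar. g x z) = 0" using r0 by simp
    then have "AE z in haar. g x z = 0"
      using integral_nonneg_eq_0_iff_AE[OF integrable_haar_real[OF gc]] gn by simp
    moreover have "{z. g x z > 0} \<in> sets haar"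
      using open_Collect_less[OF continuous_on_const gc, of 0 x] by simp
    ultimately show ?thesis
      by (subst (asm) AE_iff_measurable[of "{z. g x z > 0}"]) (use gn in \<open>auto simp: less_le\<close>)
  qed
  \<comment> \<open>The axiom on supports enters: \<open>e\<close> lies in the support of the
    product of the point masses at \<open>chk x\<close> and \<open>x\<close>, so this product
    charges the neighbourhood \<open>V\<close> of \<open>e\<close>, where \<open>r\<close> is
    bounded away from 0.\<close>
  have gx: "g x x > 0" for x
  proof -
    define V where "V = {w. r w > r e / 2}"
    have V: "open V" "e \<in> V"
      unfolding V_def by (rule open_Collect_less[OF continuous_on_const r(1)]) (use r(3) in simp)
    have "e \<in> cm_support (conv (dirac (chk x)) (dirac x))" by (simp add: identity_in_support)
    then have "tvar (conv (dirac (chk x)) (dirac x)) V > 0" using V by (auto simp: cm_support_def)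
    then have em: "emeasure (to_measure (conv (dirac (chk x)) (dirac x))) V > 0"
      using tvar_of_measure[OF finite_measure_to_measure[OF conv_dirac_positive] sets_to_measure, of V "chk x" x] V(1)
      by (simp add: of_measure_to_measure[OF conv_dirac_positive])
    show ?thesis
    proof (rule ccontr)
      assume "\<not> ?thesis"
      then have "(LINT w|to_measure (conv (dirac (chk x)) (dirac x)). r w) = 0"
        using gn[of x x] by (simp add: g_def)
      then have "AE w in to_measure (conv (dirac (chk x)) (dirac x)). r w = 0"
        using integral_nonneg_eq_0_iff_AE[OF integrable_conv_dirac_real[OF r(1)]] r(2) by simp
      then have "AE w in to_measure (conv (dirac (chk x)) (dirac x)). w \<notin> V"
        using r(3) by (auto simp: V_def elim!: eventually_mono)
      then have "emeasure (to_measure (conv (dirac (chk x)) (dirac x))) V = 0"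
        by (subst (asm) AE_iff_measurable[of V]) (use V(1) in auto)
      then show False using em by simp
    qed
  qed
  obtain D where D: "finite D" "UNIV \<subseteq> (\<Union>x\<in>D. {z. g x z > 0})"
  proof (rule compactE_image[OF compact_space, of UNIV "\<lambda>x. {z. g x z > 0}"])
    show "open {z. g x z > 0}" for x
      by (rule open_Collect_less[OF continuous_on_const gc])
  qed (use gx in auto)
  have "emeasure haar UNIV \<le> emeasure haar (\<Union>x\<in>D. {z. g x z > 0})"
  proof (rule emeasure_mono)
    have "open (\<Union>x\<in>D. {z. g x z > 0})"
      by (intro open_UN ballI open_Collect_less[OF continuous_on_const gc])
    then show "(\<Union>x\<in>D. {z. g x z > 0}) \<in> sets haar" by simp
  qed (use D in simp)
  also have "\<dots> \<le> (\<Sum>x\<in>D. emeasure haar {z. g x z > 0})"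
  proof (rule emeasure_subadditive_finite[OF D(1)])
    show "(\<lambda>x. {z. g x z > 0}) ` D \<subseteq> sets haar"
      using open_Collect_less[OF continuous_on_const gc] by auto
  qed
  also have "\<dots> = 0" by (simp add: g0)
  finally show False using prob_space.emeasure_space_1[OF prob_space_haar] by simp
qed

text \<open>A compact Hausdorff space is completely regular; the bump is 1 minus a function that is
  0 at \<open>e\<close> and 1 outside \<open>U\<close>.\<close>

lemma bump_exists:
  assumes U: "open U" "e \<in> U"
  shows "\<exists>r :: 'a \<Rightarrow> real. continuous_on UNIV r \<and> (\<forall>x. 0 \<le> r x) \<and> r e > 0 \<and> (\<forall>x. x \<notin> U \<longrightarrow> r x = 0)"
proof -
  have "compact_space (euclidean :: 'a topology)" using compact_space by (simp add: compact_space_def)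
  then have "completely_regular_space (euclidean :: 'a topology)"
    by (intro locally_compact_regular_imp_completely_regular_space compact_imp_locally_compact_space
      disjI1 Hausdorff_space_euclidean_t2)
  moreover have "closedin euclidean (- U)" "e \<in> topspace euclidean - (- U)" using U by auto
  ultimately obtain f :: "'a \<Rightarrow> real" where f: "continuous_map euclidean (top_of_set {0..1}) f" "f e = 0" "f ` (- U) \<subseteq> {1}"
    unfolding completely_regular_space_def by blast
  have fc: "continuous_on UNIV f" and f01: "f x \<in> {0..1}" for x
    using f(1) by (auto simp: continuous_map_in_subtopology)
  show ?thesis
    by (rule exI[of _ "\<lambda>x. 1 - f x"]) (use fc f01 f in \<open>auto intro!: continuous_intros\<close>)
qed

text \<open>The support of the product of the point masses at \<open>chk e\<close> and
  \<open>e\<close> contains \<open>e\<close> by the axiom on supports. The second factor being the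
  identity, this support is contained in the singleton of \<open>chk e\<close>.\<close>

lemma chk_identity: "chk e = e"
  using identity_in_support[of "chk e" e] cm_support_dirac[of "chk e"]
  by (auto simp: identity_right)

text \<open>The kernel \<open>r(chk u * w)\<close> integrates in \<open>u\<close> to the integral of
  \<open>r\<close>, by invariance under \<open>chk\<close> and under left translation, and it lives
  where \<open>h u\<close> is close to \<open>h w\<close>. The bump is not normalised, hence the
  integral of \<open>r\<close> on both sides.\<close>

lemma approximate_identity:
  fixes r :: "'a \<Rightarrow> real" and h :: "'a \<Rightarrow> complex"
  assumes r: "continuous_on UNIV r" "\<And>x. 0 \<le> r x" and h: "continuous_on UNIV h"
    and near: "\<And>u w. cmod (h u - h w) \<ge> \<epsilon> \<Longrightarrow> transl (\<lambda>x. complex_of_real (r x)) (chk u) w = 0"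
  shows "cmod ((LINT u|haar. h u * transl (\<lambda>x. complex_of_real (r x)) (chk u) w) - (LINT x|haar. r x) * h w)
    \<le> \<epsilon> * (LINT x|haar. r x)"
proof -
  define k where "k = (\<lambda>x. complex_of_real (r x))"
  have k: "continuous_on UNIV k" unfolding k_def by (rule continuous_of_real[OF r(1)])
  have kc: "continuous_on UNIV (\<lambda>u. transl k (chk u) w)"
    by (intro continuous_transl k continuous_chk continuous_intros)
  define g where "g = (\<lambda>u. LINT w|to_measure (conv (dirac (chk u)) (dirac w)). r w)"
  have gk: "transl k (chk u) w = complex_of_real (g u)" for u
    unfolding k_def g_def by (rule transl_of_real)
  have gc: "continuous_on UNIV g"
    using continuous_on_Re[OF kc] by (simp add: gk)
  have gn: "g u \<ge> 0" for u unfolding g_def using r by (intro Bochner_Integration.integral_nonneg) auto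
  have "(LINT u|haar. transl k (chk u) w) = (LINT u|haar. transl (\<lambda>x. k (chk x)) (chk w) u)"
    using transl_chk[OF k, of _ "chk w"] by (simp add: chk_chk)
  also have "\<dots> = (LINT u|haar. k u)"
    by (simp add: haar_transl[OF continuous_comp_chk[OF k]] haar_chk[OF k])
  finally have I: "(LINT u|haar. transl k (chk u) w) = complex_of_real (LINT x|haar. r x)"
    by (simp add: k_def)
  then have Ig: "(LINT u|haar. g u) = (LINT x|haar. r x)" by (simp add: gk)
  have i1: "integrable haar (\<lambda>u. h u * transl k (chk u) w)" and i2: "integrable haar (\<lambda>u. h w * transl k (chk u) w)"
    by (intro integrable_haar continuous_intros h kc)+
  have "(LINT u|haar. h u * transl k (chk u) w) - (LINT x|haar. r x) * h w
     = (LINT u|haar. h u * transl k (chk u) w - h w * transl k (chk u) w)"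
    using i1 i2 by (simp add: I)
  also have "cmod \<dots> \<le> (LINT u|haar. cmod (h u * transl k (chk u) w - h w * transl k (chk u) w))"
    by (rule integral_norm_bound)
  also have "\<dots> \<le> (LINT u|haar. \<epsilon> * g u)"
  proof (rule integral_mono)
    show "integrable haar (\<lambda>u. cmod (h u * transl k (chk u) w - h w * transl k (chk u) w))"
      using i1 i2 by auto
    show "integrable haar (\<lambda>u. \<epsilon> * g u)" using integrable_haar_real[OF gc] by auto
    fix u
    show "cmod (h u * transl k (chk u) w - h w * transl k (chk u) w) \<le> \<epsilon> * g u"
    proof (cases "cmod (h u - h w) \<ge> \<epsilon>")
      case True
      then have "g u = 0" using near[of u w] gk[of u] by (simp add: k_def)
      then show ?thesis by (simp add: gk)
    next
      case False
      have "h u * transl k (chk u) w - h w * transl k (chk u) w = (h u - h w) * g u"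
        by (simp add: gk left_diff_distrib)
      then have "cmod (h u * transl k (chk u) w - h w * transl k (chk u) w) = cmod (h u - h w) * g u"
        using gn[of u] by (simp add: norm_mult)
      also have "\<dots> \<le> \<epsilon> * g u" using False gn[of u] by (intro mult_right_mono) auto
      finally show ?thesis .
    qed
  qed
  also have "\<dots> = \<epsilon> * (LINT x|haar. r x)" by (simp add: Ig)
  finally show ?thesis by (simp add: k_def)
qed

text \<open>Both sides are approximated by the integral of \<open>f(u) g(z) k(chk(u) * x * z)\<close> for a bump
  \<open>k\<close> at the identity: integrating first in \<open>u\<close> gives the left-hand side, first in \<open>z\<close> the
  right-hand side.\<close>

lemma transl_adjoint:
  assumes f: "continuous_on UNIV f" and g: "continuous_on UNIV g"
  shows "(LINT y|haar. transl f x y * g y) = (LINT y|haar. f y * transl g (chk x) y)"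
proof -
  obtain Bf where Bf: "Bf > 0" "\<And>x. cmod (f x) \<le> Bf" using compact_bounded_range[OF compact_space f] by blast
  obtain Bg where Bg: "Bg > 0" "\<And>x. cmod (g x) \<le> Bg" using compact_bounded_range[OF compact_space g] by blast
  define L where "L = (LINT y|haar. transl f x y * g y)"
  define R where "R = (LINT y|haar. f y * transl g (chk x) y)"
  have "cmod (L - R) \<le> \<epsilon> * (Bf + Bg)" if \<epsilon>: "\<epsilon> > 0" for \<epsilon>
  proof -
    \<comment> \<open>One set of bad pairs covers \<open>f\<close> and \<open>g\<close>, so that a
      single bump serves both approximations.\<close>
    define W where "W = {(u, w). cmod (f u - f w) \<ge> \<epsilon>} \<union> {(u, w). cmod (g u - g w) \<ge> \<epsilon>}"
    have "closed {(u, w). cmod (h u - h w) \<ge> \<epsilon>}" if h: "continuous_on UNIV h" for h :: "'a \<Rightarrow> complex"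
      unfolding case_prod_unfold
      by (intro closed_Collect_le continuous_intros continuous_on_compose2[OF h]) auto
    then have "closed W" unfolding W_def using f g by (intro closed_Un) auto
    moreover have "(x, x) \<notin> W" for x using \<epsilon> by (auto simp: W_def)
    ultimately obtain U where U: "open U" "e \<in> U"
      "\<And>k u w. (\<forall>x. x \<notin> U \<longrightarrow> k x = 0) \<Longrightarrow> (u, w) \<in> W \<Longrightarrow> transl k (chk u) w = 0"
      using kernel_concentration by metis
    \<comment> \<open>Made symmetric under \<open>chk\<close>, because \<open>r\<close> and also
      \<open>r\<close> composed with \<open>chk\<close> must be supported in \<open>U\<close>; the
      latter is the kernel met when integrating in \<open>z\<close>.\<close>
    define U' where "U' = U \<inter> chk -` U"
    have U': "open U'" "e \<in> U'" using U chk_identity open_vimage[OF U(1) chk_continuous] by (auto simp: U'_def)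
    obtain r :: "'a \<Rightarrow> real" where r: "continuous_on UNIV r" "\<And>x. 0 \<le> r x" "r e > 0" "\<And>x. x \<notin> U' \<Longrightarrow> r x = 0"
      using bump_exists[OF U'] by blast
    define k where "k = (\<lambda>x. complex_of_real (r x))"
    have k: "continuous_on UNIV k" unfolding k_def by (rule continuous_of_real[OF r(1)])
    define c where "c = (LINT x|haar. r x)"
    have c: "c > 0" unfolding c_def by (rule haar_bump_pos[OF r(1-3)])
    have r': "continuous_on UNIV (\<lambda>x. r (chk x))" by (rule continuous_on_compose2[OF r(1) chk_continuous]) auto
    have "complex_of_real (LINT x|haar. r (chk x)) = complex_of_real c"
      using haar_chk[OF k] by (simp add: k_def c_def)
    then have c': "(LINT x|haar. r (chk x)) = c" by simp
    have near: "transl (\<lambda>x. complex_of_real (r x)) (chk u) w = 0"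
       "transl (\<lambda>x. complex_of_real (r (chk x))) (chk u) w = 0" if "(u, w) \<in> W" for u w
      by (rule U(3)[OF _ that]; use r(4) chk_chk in \<open>auto simp: U'_def\<close>)+
    have af: "cmod ((LINT u|haar. f u * transl k (chk u) w) - c * f w) \<le> \<epsilon> * c" for w
      unfolding k_def c_def
      by (rule approximate_identity[OF r(1,2) f]) (rule near, simp add: W_def)
    have ag: "cmod ((LINT z|haar. g z * transl (\<lambda>x. k (chk x)) (chk z) w) - c * g w) \<le> \<epsilon> * c" for w
      using approximate_identity[OF r' r(2) g, of \<epsilon> w] near(2) unfolding c' k_def
      by (auto simp: W_def)
    define T where "T = (\<lambda>u z. transl (\<lambda>w. transl k (chk u) w) x z)"
    \<comment> \<open>Associativity shifts the bracket in \<open>k(chk u * x * z)\<close>, and the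
      involution turns the result into \<open>k\<close> composed with \<open>chk\<close>, taken at
      \<open>chk z * chk x * u\<close>. In this form \<open>z\<close> has the place that
      \<open>u\<close> had before.\<close>
    have T2: "T u z = transl (\<lambda>w. transl (\<lambda>x. k (chk x)) (chk z) w) (chk x) u" for u z
    proof -
      have "T u z = transl (\<lambda>w. transl k w z) (chk u) x"
        unfolding T_def by (rule transl_transl[OF k])
      also have "(\<lambda>w. transl k w z) = (\<lambda>w. transl (\<lambda>x. k (chk x)) (chk z) (chk w))"
        using transl_chk[OF k, of "chk _" "chk z"] by (simp add: chk_chk)
      also have "transl \<dots> (chk u) x = transl (\<lambda>w. transl (\<lambda>x. k (chk x)) (chk z) w) (chk x) u"
        using transl_chk[OF continuous_transl[OF continuous_comp_chk[OF k], of "\<lambda>_. chk z" "\<lambda>w. w"], of "chk x" u]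
          transl_chk[of "\<lambda>w. transl (\<lambda>x. k (chk x)) (chk z) (chk w)" u "chk x"]
          continuous_transl[OF continuous_comp_chk[OF k], of "\<lambda>_. chk z" chk] chk_continuous
        by (simp add: chk_chk)
      finally show ?thesis .
    qed
    have Tc: "continuous_on UNIV (\<lambda>(z, u). f u * g z * T u z)"
      unfolding T_def case_prod_unfold
      by (intro continuous_intros continuous_transl_transl[OF k] continuous_chk
          continuous_on_compose2[OF f] continuous_on_compose2[OF g]) auto
    define J where "J = (LINT z|haar. LINT u|haar. f u * g z * T u z)"
    have fub: "J = (LINT u|haar. LINT z|haar. f u * g z * T u z)"
      unfolding J_def
      using fubini_continuous[OF compact_space compact_space Tc finite_measure_haar sets_haar finite_measure_haar sets_haar]
      by simp
    \<comment> \<open>A translate is an integral against a measure of total mass 1, so the integral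
      in \<open>u\<close> moves inside it by Fubini.\<close>
    have inner: "(LINT u|haar. h u * transl (\<lambda>w. transl k' (chk u) w) a z) = transl (\<lambda>w. LINT u|haar. h u * transl k' (chk u) w) a z"
      if "continuous_on UNIV h" "continuous_on UNIV k'" for h k' a z
    proof -
      define m where "m = to_measure (conv (dirac a) (dirac z))"
      have m: "finite_measure m" "sets m = sets borel"
        by (simp_all add: m_def finite_measure_to_measure conv_dirac_positive)
      have C: "continuous_on UNIV (\<lambda>(u, w). h u * transl k' (chk u) w)"
        unfolding case_prod_unfold
        by (intro continuous_intros continuous_transl that(2) continuous_chk continuous_on_compose2[OF that(1)]) auto
      show ?thesis
        using fubini_continuous[OF compact_space compact_space C finite_measure_haar sets_haar m]
        by (simp add: transl_to_measure m_def)
    qed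
    have tbd: "cmod (transl p a z - c * transl q a z) \<le> \<epsilon> * c"
      if "continuous_on UNIV p" "continuous_on UNIV q" "\<And>w. cmod (p w - c * q w) \<le> \<epsilon> * c" for p q :: "'a \<Rightarrow> complex" and a z
    proof -
      have "transl p a z - c * transl q a z = (LINT w|to_measure (conv (dirac a) (dirac z)). p w - c * q w)"
        using that(1,2)[THEN integrable_conv_dirac] by (simp add: transl_to_measure)
      also have "cmod \<dots> \<le> \<epsilon> * c"
        by (rule norm_integral_le_const[OF prob_conv_dirac that(3)])
          (use that(1,2)[THEN integrable_conv_dirac] in auto)
      finally show ?thesis .
    qed
    have pc: "continuous_on UNIV (\<lambda>w. LINT u|haar. h u * transl k' (chk u) w)"
      if "continuous_on UNIV h" "continuous_on UNIV k'" for h k'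
    proof -
      have C: "continuous_on UNIV (\<lambda>(w, u). h u * transl k' (chk u) w)"
        unfolding case_prod_unfold
        by (intro continuous_intros continuous_transl that(2) continuous_chk continuous_on_compose2[OF that(1)]) auto
      show ?thesis using continuous_param_integral[OF compact_space C finite_measure_haar sets_haar] by simp
    qed
    have obd: "cmod ((LINT z|haar. p z) - c * (LINT z|haar. q z)) \<le> \<epsilon> * c * B"
      if "continuous_on UNIV p" "continuous_on UNIV q" "\<And>z. cmod (p z - c * q z) \<le> \<epsilon> * c * B" for p q :: "'a \<Rightarrow> complex" and B
    proof -
      have "(LINT z|haar. p z) - c * (LINT z|haar. q z) = (LINT z|haar. p z - c * q z)"
        using that(1,2)[THEN integrable_haar] by simp
      also have "cmod \<dots> \<le> \<epsilon> * c * B"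
        by (rule norm_integral_le_const[OF prob_space_haar that(3)])
          (use that(1,2)[THEN integrable_haar] in auto)
      finally show ?thesis .
    qed
    have tfc: "continuous_on UNIV (\<lambda>y. transl f x y)" and tgc: "continuous_on UNIV (\<lambda>y. transl g (chk x) y)"
      by (intro continuous_transl f g continuous_intros)+
    have JL: "cmod (J - c * L) \<le> \<epsilon> * c * Bg"
      unfolding J_def L_def
    proof (rule obd)
      show "continuous_on UNIV (\<lambda>z. LINT u|haar. f u * g z * T u z)"
        using continuous_param_integral[OF compact_space Tc finite_measure_haar sets_haar] by simp
      show "continuous_on UNIV (\<lambda>y. transl f x y * g y)" by (intro continuous_intros tfc g)
      fix z
      have "(LINT u|haar. f u * g z * T u z) = (LINT u|haar. g z * (f u * T u z))"
        by (simp add: mult_ac)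
      also have "\<dots> = g z * (LINT u|haar. f u * T u z)" by simp
      also have "(LINT u|haar. f u * T u z) = transl (\<lambda>w. LINT u|haar. f u * transl k (chk u) w) x z"
        unfolding T_def by (rule inner[OF f k])
      finally have "(LINT u|haar. f u * g z * T u z) - c * (transl f x z * g z)
         = g z * (transl (\<lambda>w. LINT u|haar. f u * transl k (chk u) w) x z - c * transl f x z)"
        by (simp add: algebra_simps)
      also have "cmod \<dots> \<le> Bg * (\<epsilon> * c)"
        unfolding norm_mult using Bg by (intro mult_mono tbd pc f k af) auto
      finally show "cmod ((LINT u|haar. f u * g z * T u z) - c * (transl f x z * g z)) \<le> \<epsilon> * c * Bg"
        by (simp add: mult.commute)
    qed
    have JR: "cmod (J - c * R) \<le> \<epsilon> * c * Bf"
      unfolding fub R_def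
    proof (rule obd)
      have "continuous_on UNIV (\<lambda>(u, z). f u * g z * T u z)"
        unfolding T_def case_prod_unfold
        by (intro continuous_intros continuous_transl_transl[OF k] continuous_chk
          continuous_on_compose2[OF f] continuous_on_compose2[OF g]) auto
      from continuous_param_integral[OF compact_space this finite_measure_haar sets_haar]
      show "continuous_on UNIV (\<lambda>u. LINT z|haar. f u * g z * T u z)" by simp
      show "continuous_on UNIV (\<lambda>y. f y * transl g (chk x) y)" by (intro continuous_intros tgc f)
      fix u
      have "(LINT z|haar. f u * g z * T u z) = f u * (LINT z|haar. g z * T u z)"
        by (simp add: mult.assoc)
      also have "(LINT z|haar. g z * T u z) = transl (\<lambda>w. LINT z|haar. g z * transl (\<lambda>x. k (chk x)) (chk z) w) (chk x) u"
        unfolding T2 by (rule inner[OF g continuous_comp_chk[OF k]])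
      finally have "(LINT z|haar. f u * g z * T u z) - c * (f u * transl g (chk x) u)
         = f u * (transl (\<lambda>w. LINT z|haar. g z * transl (\<lambda>x. k (chk x)) (chk z) w) (chk x) u - c * transl g (chk x) u)"
        by (simp add: algebra_simps)
      also have "cmod \<dots> \<le> Bf * (\<epsilon> * c)"
        unfolding norm_mult using Bf by (intro mult_mono tbd pc g continuous_comp_chk k ag) auto
      finally show "cmod ((LINT z|haar. f u * g z * T u z) - c * (f u * transl g (chk x) u)) \<le> \<epsilon> * c * Bf"
        by (simp add: mult.commute)
    qed
    \<comment> \<open>\<open>J\<close> is close to \<open>c * L\<close> and to \<open>c * R\<close>
      with errors that carry the same factor \<open>c\<close>, the integral of the bump. It is
      positive by \<open>haar_bump_pos\<close> and cancels.\<close>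
    have "c * cmod (L - R) = cmod ((J - c * R) - (J - c * L))"
      using c by (simp add: norm_mult flip: right_diff_distrib)
    also have "\<dots> \<le> \<epsilon> * c * Bf + \<epsilon> * c * Bg"
      by (rule order_trans[OF norm_triangle_ineq4 add_mono[OF JR JL]])
    finally have "c * cmod (L - R) \<le> c * (\<epsilon> * (Bf + Bg))" by (simp add: algebra_simps)
    then show ?thesis using c by simp
  qed
  then have "cmod (L - R) \<le> 0" by (rule nonpos_if_le_eps_mult)
  then show ?thesis by (simp add: L_def R_def)
qed

end

section \<open>Schur's lemma\<close>

lemma mat_adjoint_dim [simp]: "dim_row (mat_adjoint A) = dim_col A" "dim_col (mat_adjoint A) = dim_row A"
  by (auto simp: mat_adjoint_def)

lemma mat_adjoint_index [simp]:
  "i < dim_col A \<Longrightarrow> j < dim_row A \<Longrightarrow> mat_adjoint A $$ (i, j) = conjugate (A $$ (j, i))"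
  by (simp add: mat_adjoint_def mat_of_rows_index)

lemma mat_adjoint_carrier: "A \<in> carrier_mat n m \<Longrightarrow> mat_adjoint A \<in> carrier_mat m n"
  by (intro carrier_matI) auto

lemma mat_adjoint_adjoint [simp]: "mat_adjoint (mat_adjoint A) = (A :: complex mat)"
  by (intro eq_matI) auto

lemma mat_mult_index:
  assumes "A \<in> carrier_mat n m" "B \<in> carrier_mat m k" "i < n" "j < k"
  shows "(A * B) $$ (i, j) = (\<Sum>s<m. A $$ (i, s) * B $$ (s, j))"
  using assms by (auto simp: scalar_prod_def atLeast0LessThan intro!: sum.cong)

lemma mat_adjoint_mult:
  assumes A: "A \<in> carrier_mat n m" and B: "(B :: complex mat) \<in> carrier_mat m k"
  shows "mat_adjoint (A * B) = mat_adjoint B * mat_adjoint A"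
proof (rule eq_matI)
  fix i j assume "i < dim_row (mat_adjoint B * mat_adjoint A)" "j < dim_col (mat_adjoint B * mat_adjoint A)"
  then have ij: "i < k" "j < n" using A B by auto
  have "mat_adjoint (A * B) $$ (i, j) = cnj ((A * B) $$ (j, i))" using ij A B by simp
  also have "\<dots> = (mat_adjoint B * mat_adjoint A) $$ (i, j)"
    unfolding mat_mult_index[OF A B ij(2,1)] mat_mult_index[OF mat_adjoint_carrier[OF B] mat_adjoint_carrier[OF A] ij]
    using A B ij by (auto intro!: sum.cong)
  finally show "mat_adjoint (A * B) $$ (i, j) = (mat_adjoint B * mat_adjoint A) $$ (i, j)" .
qed (use A B in auto)

lemma smult_mult_smult_mat:
  assumes A: "A \<in> carrier_mat d d" and B: "B \<in> carrier_mat d d"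
  shows "(a \<cdot>\<^sub>m A) * (a \<cdot>\<^sub>m B) = (a * a) \<cdot>\<^sub>m (A * (B :: complex mat))"
proof -
  have "(a \<cdot>\<^sub>m A) * (a \<cdot>\<^sub>m B) = a \<cdot>\<^sub>m (a \<cdot>\<^sub>m (A * B))"
    by (simp only: mult_smult_assoc_mat[OF A smult_carrier_mat[OF B]] mult_smult_distrib[OF A B])
  also have "\<dots> = (a * a) \<cdot>\<^sub>m (A * B)" by (rule eq_matI) auto
  finally show ?thesis .
qed

lemma mat_mult_vec_index:
  assumes "A \<in> carrier_mat n m" "v \<in> carrier_vec m" "i < n"
  shows "(A *\<^sub>v v) $ i = (\<Sum>s<m. A $$ (i, s) * v $ s)"
  using assms by (auto simp: scalar_prod_def atLeast0LessThan intro!: sum.cong)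

text \<open>Continuity of a representation is formulated with inner products; unit vectors turn it
  into continuity of the matrix entries.\<close>

lemma mat_entry_inner:
  assumes A: "(A :: complex mat) \<in> carrier_mat n m" and "i < n" "j < m"
  shows "(A *\<^sub>v unit_vec m j) \<bullet>c unit_vec n i = A $$ (i, j)"
proof -
  have 1: "(A *\<^sub>v unit_vec m j) $ s = A $$ (s, j)" if "s < n" for s
  proof -
    have "(A *\<^sub>v unit_vec m j) $ s = (\<Sum>t<m. A $$ (s, t) * unit_vec m j $ t)"
      by (rule mat_mult_vec_index[OF A _ that]) simp
    also have "\<dots> = (\<Sum>t<m. if t = j then A $$ (s, j) else 0)"
      by (rule sum.cong) (use assms(3) in auto)
    finally show ?thesis using assms by simp
  qed
  have "(A *\<^sub>v unit_vec m j) \<bullet>c unit_vec n i = (\<Sum>s<n. (A *\<^sub>v unit_vec m j) $ s * cnj (unit_vec n i $ s))"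
    using A by (simp add: scalar_prod_def atLeast0LessThan)
  also have "\<dots> = (\<Sum>s<n. if s = i then A $$ (i, j) else 0)"
    using A assms by (intro sum.cong) (auto simp: 1 simp del: index_mult_mat_vec)
  finally show ?thesis using assms by simp
qed

section \<open>Matrix coefficients and intertwining operators\<close>

context haar_hypergroup
begin

abbreviation reps :: "'a hg_rep \<Rightarrow> bool" where "reps \<equiv> is_rep conv chk e"

lemma
  assumes r: "reps (d, \<rho>)"
  shows rep_carrier: "\<mu> \<in> complex_measures \<Longrightarrow> \<rho> \<mu> \<in> carrier_mat d d"
    and rep_lincomb: "\<mu> \<in> complex_measures \<Longrightarrow> \<nu> \<in> complex_measures \<Longrightarrow>
        \<rho> (\<lambda>E. a * \<mu> E + b * \<nu> E) = a \<cdot>\<^sub>m \<rho> \<mu> + b \<cdot>\<^sub>m \<rho> \<nu>"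
    and rep_conv: "\<mu> \<in> complex_measures \<Longrightarrow> \<nu> \<in> complex_measures \<Longrightarrow> \<rho> (conv \<mu> \<nu>) = \<rho> \<mu> * \<rho> \<nu>"
    and rep_star: "\<mu> \<in> complex_measures \<Longrightarrow> \<rho> (cm_star chk \<mu>) = mat_adjoint (\<rho> \<mu>)"
    and rep_identity: "\<rho> (dirac e) = 1\<^sub>m d"
    and rep_continuous: "u \<in> carrier_vec d \<Longrightarrow> v \<in> carrier_vec d \<Longrightarrow>
        continuous_map weak_cone_topology euclidean (\<lambda>\<mu>. (\<rho> \<mu> *\<^sub>v u) \<bullet>c v)"
  using r by (auto simp: is_rep_def)

lemma rep_entry_continuous:
  assumes r: "reps (d, \<rho>)" and ij: "i < d" "j < d"
  shows "continuous_map weak_cone_topology euclidean (\<lambda>\<mu>. \<rho> \<mu> $$ (i, j))"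
proof (rule continuous_map_eq[OF rep_continuous[OF r unit_vec_carrier unit_vec_carrier, of j i]])
  fix \<mu> :: "'a cmeas" assume "\<mu> \<in> topspace weak_cone_topology"
  then have "\<rho> \<mu> \<in> carrier_mat d d"
    by (intro rep_carrier[OF r]) (simp add: topspace_weak_cone positive_measures_def)
  then show "(\<rho> \<mu> *\<^sub>v unit_vec d j) \<bullet>c unit_vec d i = \<rho> \<mu> $$ (i, j)"
    by (rule mat_entry_inner) (use ij in auto)
qed

lemma rep_lincomb_entry:
  assumes r: "reps (d, \<rho>)" and ij: "i < d" "j < d"
    and "\<mu> \<in> complex_measures" "\<nu> \<in> complex_measures"
  shows "\<rho> (\<lambda>E. a * \<mu> E + b * \<nu> E) $$ (i, j) = a * \<rho> \<mu> $$ (i, j) + b * \<rho> \<nu> $$ (i, j)"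
  using assms rep_carrier[OF r, of \<mu>] rep_carrier[OF r, of \<nu>] by (simp add: rep_lincomb[OF r])

lemma rep_combination:
  assumes r: "reps (d, \<rho>)" and ij: "i < d" "j < d" and c: "\<And>k. k < n \<Longrightarrow> 0 \<le> c k"
  shows "\<rho> (\<lambda>E. \<Sum>k<n::nat. complex_of_real (c k) * dirac (a k) E) $$ (i, j)
    = (\<Sum>k<n. complex_of_real (c k) * \<rho> (dirac (a k)) $$ (i, j))"
  using c
proof (induction n)
  case 0
  show ?case
    using rep_lincomb_entry[OF r ij dirac_complex[of e] dirac_complex[of e], of 0 0] by simp
next
  case (Suc n)
  have p: "(\<lambda>E. \<Sum>k<n. complex_of_real (c k) * dirac (a k) E) \<in> complex_measures"
    by (rule positive_measures_complex[OF dirac_combination]) (use Suc.prems in auto)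
  show ?case
    using rep_lincomb_entry[OF r ij p dirac_complex, of 1 "c n" "a n"] Suc by simp
qed

text \<open>An entry of \<open>\<rho>\<close> is weakly continuous and additive on the cone, hence
  the integral of its values at point masses.\<close>

lemma
  assumes r: "reps (d, \<rho>)" and ij: "i < d" "j < d"
  shows rep_entry_dirac_continuous: "continuous_on UNIV (\<lambda>x. \<rho> (dirac x) $$ (i, j))"
    and rep_entry_positive: "\<mu> \<in> positive_measures \<Longrightarrow>
      \<rho> \<mu> $$ (i, j) = cm_integral \<mu> (\<lambda>x. \<rho> (dirac x) $$ (i, j))"
  using cone_functional_integral[OF compact_space rep_entry_continuous[OF r ij] rep_combination[OF r ij]]
    dirac_positive by blast+

lemma cm_star_dirac: "cm_star chk (dirac x) = dirac (chk x)"
  using fun_cong[OF cm_check_dirac, of x] by (auto simp: cm_star_def dirac_def of_measure_def)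

lemma rep_dirac_chk:
  assumes r: "reps (d, \<rho>)"
  shows "\<rho> (dirac (chk x)) = mat_adjoint (\<rho> (dirac x))"
  using rep_star[OF r dirac_complex[of x]] by (simp add: cm_star_dirac)

lemma rep_entry_chk:
  assumes r: "reps (d, \<rho>)" and ij: "i < d" "j < d"
  shows "\<rho> (dirac (chk x)) $$ (i, j) = cnj (\<rho> (dirac x) $$ (j, i))"
  using rep_carrier[OF r dirac_complex[of x]] ij by (simp add: rep_dirac_chk[OF r])

lemma rep_entry_transl:
  assumes r: "reps (d, \<rho>)" and ij: "i < d" "j < d"
  shows "transl (\<lambda>w. \<rho> (dirac w) $$ (i, j)) x y = (\<Sum>s<d. \<rho> (dirac x) $$ (i, s) * \<rho> (dirac y) $$ (s, j))"
  unfolding transl_def rep_entry_positive[OF r ij conv_dirac_positive, symmetric]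
    rep_conv[OF r dirac_complex dirac_complex]
  by (rule mat_mult_index[OF rep_carrier[OF r dirac_complex] rep_carrier[OF r dirac_complex] ij])

text \<open>Coefficient integrals give the relation at point masses only, whereas irreducibility and
  equivalence speak of all measures. It is integrated entry by entry over a positive measure and
  then extended linearly.\<close>

lemma intertwiner_extend:
  assumes r: "reps (d, \<rho>)" and s: "reps (d', \<sigma>)" and T: "T \<in> carrier_mat d d'"
    and eq: "\<And>x. \<rho> (dirac x) * T = T * \<sigma> (dirac x)" and \<mu>: "\<mu> \<in> complex_measures"
  shows "\<rho> \<mu> * T = T * \<sigma> \<mu>"
  using \<mu>
proof (induction rule: complex_measures_induct)
  case (positive \<mu>)
  note \<mu>c = positive_measures_complex[OF positive]
  have int: "complex_integrable (to_measure \<mu>) f" if "continuous_on UNIV f" for f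
    by (rule integrable_continuous[OF compact_space that finite_measure_to_measure[OF positive] sets_to_measure])
  show ?case
  proof (rule eq_matI)
    fix i j assume "i < dim_row (T * \<sigma> \<mu>)" "j < dim_col (T * \<sigma> \<mu>)"
    then have ij: "i < d" "j < d'" using T rep_carrier[OF s \<mu>c] by auto
    have "(\<rho> \<mu> * T) $$ (i, j) = (\<Sum>t<d. \<rho> \<mu> $$ (i, t) * T $$ (t, j))"
      by (rule mat_mult_index[OF rep_carrier[OF r \<mu>c] T ij])
    also have "\<dots> = (\<Sum>t<d. (LINT x|to_measure \<mu>. \<rho> (dirac x) $$ (i, t) * T $$ (t, j)))"
      using rep_entry_positive[OF r ij(1) _ positive] cm_integral_to_measure[OF positive] by (intro sum.cong) auto
    also have "\<dots> = (LINT x|to_measure \<mu>. (\<Sum>t<d. \<rho> (dirac x) $$ (i, t) * T $$ (t, j)))"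
      by (rule Bochner_Integration.integral_sum[symmetric])
        (intro integrable_mult_left int rep_entry_dirac_continuous[OF r ij(1)], simp)
    also have "\<dots> = (LINT x|to_measure \<mu>. (\<Sum>t<d'. T $$ (i, t) * \<sigma> (dirac x) $$ (t, j)))"
    proof (rule Bochner_Integration.integral_cong[OF refl])
      fix x
      have "(\<rho> (dirac x) * T) $$ (i, j) = (T * \<sigma> (dirac x)) $$ (i, j)" by (simp add: eq)
      then show "(\<Sum>t<d. \<rho> (dirac x) $$ (i, t) * T $$ (t, j)) = (\<Sum>t<d'. T $$ (i, t) * \<sigma> (dirac x) $$ (t, j))"
        by (simp only: mat_mult_index[OF rep_carrier[OF r dirac_complex] T ij]
            mat_mult_index[OF T rep_carrier[OF s dirac_complex] ij])
    qed
    also have "\<dots> = (\<Sum>t<d'. (LINT x|to_measure \<mu>. T $$ (i, t) * \<sigma> (dirac x) $$ (t, j)))"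
      by (rule Bochner_Integration.integral_sum)
        (intro integrable_mult_right int rep_entry_dirac_continuous[OF s _ ij(2)], simp)
    also have "\<dots> = (\<Sum>t<d'. T $$ (i, t) * \<sigma> \<mu> $$ (t, j))"
      using rep_entry_positive[OF s _ ij(2) positive] cm_integral_to_measure[OF positive] by (intro sum.cong) auto
    also have "\<dots> = (T * \<sigma> \<mu>) $$ (i, j)"
      by (rule mat_mult_index[OF T rep_carrier[OF s \<mu>c] ij, symmetric])
    finally show "(\<rho> \<mu> * T) $$ (i, j) = (T * \<sigma> \<mu>) $$ (i, j)" .
  qed (use T rep_carrier[OF s \<mu>c] rep_carrier[OF r \<mu>c] in auto)
next
  case (lincomb a b \<mu> \<nu>)
  note c = rep_carrier[OF r lincomb(1)] rep_carrier[OF r lincomb(2)] rep_carrier[OF s lincomb(1)] rep_carrier[OF s lincomb(2)]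
  have "(a \<cdot>\<^sub>m \<rho> \<mu> + b \<cdot>\<^sub>m \<rho> \<nu>) * T = a \<cdot>\<^sub>m (\<rho> \<mu> * T) + b \<cdot>\<^sub>m (\<rho> \<nu> * T)"
    using c T by (simp add: add_mult_distrib_mat[of _ d d] mult_smult_assoc_mat[of _ d d])
  also have "\<dots> = T * (a \<cdot>\<^sub>m \<sigma> \<mu> + b \<cdot>\<^sub>m \<sigma> \<nu>)"
    using c T lincomb(3,4) by (simp add: mult_add_distrib_mat[OF T smult_carrier_mat[OF c(3)] smult_carrier_mat[OF c(4)]]
        mult_smult_distrib[OF T c(3)] mult_smult_distrib[OF T c(4)])
  finally show ?case by (simp add: rep_lincomb[OF r lincomb(1,2)] rep_lincomb[OF s lincomb(1,2)])
qed

text \<open>An eigenspace of \<open>T\<close> is nonzero and invariant under the representation,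
  hence the whole space.\<close>

lemma schur_scalar:
  assumes r: "reps (d, \<rho>)" and irr: "irreducible_rep (d, \<rho>)" and T: "T \<in> carrier_mat d d"
    and comm: "\<And>x. \<rho> (dirac x) * T = T * \<rho> (dirac x)"
  shows "\<exists>c. T = c \<cdot>\<^sub>m 1\<^sub>m d"
proof -
  have d: "d > 0" using irr by (simp add: irreducible_rep_def)
  obtain c where "eigenvalue T c" using spectrum_non_empty[OF T d] by (auto simp: spectrum_def)
  then obtain v where v: "v \<in> carrier_vec d" "v \<noteq> 0\<^sub>v d" "T *\<^sub>v v = c \<cdot>\<^sub>v v"
    using T by (auto simp: eigenvalue_def eigenvector_def)
  define W where "W = {w \<in> carrier_vec d. T *\<^sub>v w = c \<cdot>\<^sub>v w}"
  have "W = {0\<^sub>v d} \<or> W = carrier_vec d"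
  proof -
    have "0\<^sub>v d \<in> W" using T by (auto simp: W_def intro!: eq_vecI)
    moreover have "u + w \<in> W" if "u \<in> W" "w \<in> W" for u w
      using that T by (auto simp: W_def mult_add_distrib_mat_vec[of _ d d] smult_add_distrib_vec[of _ d])
    moreover have "a \<cdot>\<^sub>v w \<in> W" if "w \<in> W" for a w
      using that T by (auto simp: W_def mult_mat_vec[of _ d d] smult_smult_assoc mult.commute)
    moreover have "\<rho> \<mu> *\<^sub>v w \<in> W" if \<mu>: "\<mu> \<in> complex_measures" and w: "w \<in> W" for \<mu> w
    proof -
      note R = rep_carrier[OF r \<mu>]
      have w': "w \<in> carrier_vec d" "T *\<^sub>v w = c \<cdot>\<^sub>v w" using w by (auto simp: W_def)
      have "T *\<^sub>v (\<rho> \<mu> *\<^sub>v w) = (T * \<rho> \<mu>) *\<^sub>v w" by (rule assoc_mult_mat_vec[OF T R w'(1), symmetric])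
      also have "\<dots> = (\<rho> \<mu> * T) *\<^sub>v w" by (simp only: intertwiner_extend[OF r r T comm \<mu>])
      also have "\<dots> = \<rho> \<mu> *\<^sub>v (T *\<^sub>v w)" by (rule assoc_mult_mat_vec[OF R T w'(1)])
      also have "\<dots> = c \<cdot>\<^sub>v (\<rho> \<mu> *\<^sub>v w)" by (simp add: w'(2) mult_mat_vec[OF R w'(1)])
      finally show ?thesis using R w' by (auto simp: W_def)
    qed
    moreover have "W \<subseteq> carrier_vec d" by (auto simp: W_def)
    moreover have "X = {0\<^sub>v d} \<or> X = carrier_vec d"
      if "X \<subseteq> carrier_vec d" "0\<^sub>v d \<in> X" "\<And>u w. u \<in> X \<Longrightarrow> w \<in> X \<Longrightarrow> u + w \<in> X"
        "\<And>a w. w \<in> X \<Longrightarrow> a \<cdot>\<^sub>v w \<in> X" "\<And>\<mu> w. \<mu> \<in> complex_measures \<Longrightarrow> w \<in> X \<Longrightarrow> \<rho> \<mu> *\<^sub>v w \<in> X" for X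
      using irr that unfolding irreducible_rep_def by simp
    ultimately show ?thesis by presburger
  qed
  moreover have "v \<in> W" using v by (simp add: W_def)
  ultimately have W: "W = carrier_vec d" using v(2) by auto
  have "T = c \<cdot>\<^sub>m 1\<^sub>m d"
  proof (rule eq_matI)
    fix i j assume "i < dim_row (c \<cdot>\<^sub>m 1\<^sub>m d)" "j < dim_col (c \<cdot>\<^sub>m 1\<^sub>m d)"
    then have ij: "i < d" "j < d" by auto
    have "unit_vec d j \<in> W" using W by simp
    then have "(T *\<^sub>v unit_vec d j) $ i = (c \<cdot>\<^sub>v unit_vec d j) $ i" by (simp add: W_def)
    moreover have "(T *\<^sub>v unit_vec d j) $ i = T $$ (i, j)"
      using T ij by (auto simp: scalar_prod_right_unit)
    ultimately show "T $$ (i, j) = (c \<cdot>\<^sub>m 1\<^sub>m d) $$ (i, j)" using ij by (auto simp: unit_vec_def)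
  qed (use T in auto)
  then show ?thesis ..
qed

text \<open>Adjoints are taken in the relation at \<open>chk x\<close>, where the representing
  matrices are the adjoints of those at \<open>x\<close>.\<close>

lemma adjoint_intertwiner:
  assumes r: "reps (d, \<rho>)" and s: "reps (d', \<sigma>)" and T: "T \<in> carrier_mat d d'"
    and eq: "\<And>x. \<rho> (dirac x) * T = T * \<sigma> (dirac x)"
  shows "\<sigma> (dirac x) * mat_adjoint T = mat_adjoint T * \<rho> (dirac x)"
proof -
  have "mat_adjoint (\<rho> (dirac (chk x)) * T) = mat_adjoint (T * \<sigma> (dirac (chk x)))" by (simp add: eq)
  then have "mat_adjoint T * mat_adjoint (\<rho> (dirac (chk x))) = mat_adjoint (\<sigma> (dirac (chk x))) * mat_adjoint T"
    by (simp only: mat_adjoint_mult[OF rep_carrier[OF r dirac_complex] T] mat_adjoint_mult[OF T rep_carrier[OF s dirac_complex]])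
  then show ?thesis by (simp add: rep_dirac_chk[OF r] rep_dirac_chk[OF s])
qed

text \<open>With \<open>S\<close> the adjoint of \<open>T\<close>, the products \<open>T * S\<close>
  and \<open>S * T\<close> commute with irreducible representations and are scalar. The nonzero
  entry makes the two scalars equal and positive, so a real multiple of \<open>S\<close> is
  unitary.\<close>

lemma schur_equivalent:
  assumes r: "reps (d, \<rho>)" and s: "reps (d', \<sigma>)"
    and irr: "irreducible_rep (d, \<rho>)" "irreducible_rep (d', \<sigma>)" and T: "T \<in> carrier_mat d d'"
    and eq: "\<And>x. \<rho> (dirac x) * T = T * \<sigma> (dirac x)" and nz: "i < d" "m < d'" "T $$ (i, m) \<noteq> 0"
  shows "equivalent_reps (d, \<rho>) (d', \<sigma>)"
proof -
  define S where "S = mat_adjoint T"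
  have S: "S \<in> carrier_mat d' d" unfolding S_def by (rule mat_adjoint_carrier[OF T])
  have eqS: "\<sigma> (dirac x) * S = S * \<rho> (dirac x)" for x
    unfolding S_def by (rule adjoint_intertwiner[OF r s T eq])
  note R = rep_carrier[OF r dirac_complex] rep_carrier[OF s dirac_complex]
  have "\<rho> (dirac x) * (T * S) = (T * S) * \<rho> (dirac x)" for x
  proof -
    have "\<rho> (dirac x) * (T * S) = (\<rho> (dirac x) * T) * S" by (rule assoc_mult_mat[OF R(1) T S, symmetric])
    also have "\<dots> = T * (\<sigma> (dirac x) * S)" unfolding eq by (rule assoc_mult_mat[OF T R(2) S])
    also have "\<dots> = (T * S) * \<rho> (dirac x)" unfolding eqS by (rule assoc_mult_mat[OF T S R(1), symmetric])
    finally show ?thesis .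
  qed
  then obtain c where c: "T * S = c \<cdot>\<^sub>m 1\<^sub>m d"
    using schur_scalar[OF r irr(1) mult_carrier_mat[OF T S]] by blast
  have "\<sigma> (dirac x) * (S * T) = (S * T) * \<sigma> (dirac x)" for x
  proof -
    have "\<sigma> (dirac x) * (S * T) = (\<sigma> (dirac x) * S) * T" by (rule assoc_mult_mat[OF R(2) S T, symmetric])
    also have "\<dots> = S * (\<rho> (dirac x) * T)" unfolding eqS by (rule assoc_mult_mat[OF S R(1) T])
    also have "\<dots> = (S * T) * \<sigma> (dirac x)" unfolding eq by (rule assoc_mult_mat[OF S T R(2), symmetric])
    finally show ?thesis .
  qed
  then obtain c' where c': "S * T = c' \<cdot>\<^sub>m 1\<^sub>m d'"
    using schur_scalar[OF s irr(2) mult_carrier_mat[OF S T]] by blast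
  have cm: "c' = complex_of_real (\<Sum>t<d. (cmod (T $$ (t, n)))\<^sup>2)" if "n < d'" for n
  proof -
    have "c' = (S * T) $$ (n, n)" using that by (simp add: c')
    also have "\<dots> = (\<Sum>t<d. cnj (T $$ (t, n)) * T $$ (t, n))"
      unfolding mat_mult_index[OF S T that that] using T that by (intro sum.cong) (auto simp: S_def)
    finally show ?thesis by (simp add: complex_norm_square mult.commute del: of_real_power)
  qed
  have ci: "c = complex_of_real (\<Sum>t<d'. (cmod (T $$ (n, t)))\<^sup>2)" if "n < d" for n
  proof -
    have "c = (T * S) $$ (n, n)" using that by (simp add: c)
    also have "\<dots> = (\<Sum>t<d'. T $$ (n, t) * cnj (T $$ (n, t)))"
      unfolding mat_mult_index[OF T S that that] using T that by (intro sum.cong) (auto simp: S_def)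
    finally show ?thesis by (simp add: complex_norm_square del: of_real_power)
  qed
  define \<gamma> where "\<gamma> = Re c"
  have \<gamma>: "c = complex_of_real \<gamma>" using ci[OF nz(1)] by (simp add: \<gamma>_def)
  \<comment> \<open>The product of \<open>T\<close>, \<open>S\<close> and \<open>T\<close> is
    bracketed in two ways and compared at the nonzero entry.\<close>
  have "c' = c"
  proof -
    have "(T * S) * T = T * (S * T)" by (rule assoc_mult_mat[OF T S T])
    then have "(c \<cdot>\<^sub>m 1\<^sub>m d * T) $$ (i, m) = (T * (c' \<cdot>\<^sub>m 1\<^sub>m d')) $$ (i, m)" by (simp only: c c')
    then have "c * T $$ (i, m) = c' * T $$ (i, m)"
      using T nz by (simp add: mult_smult_distrib[OF T one_carrier_mat] mult_smult_assoc_mat[OF one_carrier_mat T])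
    then show ?thesis using nz by simp
  qed
  have "\<gamma> = (\<Sum>t<d'. (cmod (T $$ (i, t)))\<^sup>2)" using ci[OF nz(1)] by (simp add: \<gamma>_def)
  also have "\<dots> \<ge> (\<Sum>t\<in>{m}. (cmod (T $$ (i, t)))\<^sup>2)" using nz by (intro sum_mono2) auto
  finally have \<gamma>pos: "\<gamma> > 0" using nz(3) by (simp add: less_le_trans[rotated])
  have gi: "\<gamma> = (\<Sum>t<d'. (cmod (T $$ (n, t)))\<^sup>2)" if "n < d" for n
    using arg_cong[OF ci[OF that], of Re] by (simp only: \<gamma>_def Re_complex_of_real)
  have gm: "\<gamma> = (\<Sum>t<d. (cmod (T $$ (t, n)))\<^sup>2)" if "n < d'" for n
    using arg_cong[OF cm[OF that], of Re] by (simp only: \<gamma>_def Re_complex_of_real \<open>c' = c\<close>)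
  \<comment> \<open>The squared Hilbert-Schmidt norm of \<open>T\<close>, summed by rows and by
    columns; as \<open>\<gamma>\<close> is positive, the dimensions agree.\<close>
  have "real d * \<gamma> = (\<Sum>n<d. \<Sum>t<d'. (cmod (T $$ (n, t)))\<^sup>2)"
    using sum.cong[OF refl gi[symmetric], of "{..<d}" "\<lambda>n. n"] by simp
  also have "\<dots> = (\<Sum>t<d'. \<Sum>n<d. (cmod (T $$ (n, t)))\<^sup>2)" by (rule sum.swap)
  also have "\<dots> = real d' * \<gamma>" using sum.cong[OF refl gm[symmetric], of "{..<d'}" "\<lambda>n. n"] by simp
  finally have dd: "d' = d" using \<gamma>pos by simp
  define a where "a = complex_of_real (1 / sqrt \<gamma>)"
  have "1 / sqrt \<gamma> * (1 / sqrt \<gamma>) * \<gamma> = 1" using \<gamma>pos by simp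
  then have a: "a * a * c = 1" "cnj a = a"
    unfolding a_def \<gamma> by (simp_all only: of_real_mult[symmetric] of_real_1 complex_cnj_complex_of_real)
  have one: "(a * a) \<cdot>\<^sub>m (c \<cdot>\<^sub>m 1\<^sub>m d) = 1\<^sub>m d"
    by (rule eq_matI) (use a in \<open>auto simp: mult.assoc\<close>)
  define U where "U = a \<cdot>\<^sub>m S"
  have U: "U \<in> carrier_mat d d" using S dd by (simp add: U_def)
  have aU: "mat_adjoint U = a \<cdot>\<^sub>m T"
    by (rule eq_matI) (use T dd a in \<open>auto simp: U_def S_def\<close>)
  have "U * mat_adjoint U = (a * a) \<cdot>\<^sub>m (S * T)"
    unfolding aU unfolding U_def using S T unfolding dd by (rule smult_mult_smult_mat)
  also have "\<dots> = 1\<^sub>m d" using one \<open>c' = c\<close> dd by (simp add: c')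
  finally have 1: "U * mat_adjoint U = 1\<^sub>m d" .
  have "mat_adjoint U * U = (a * a) \<cdot>\<^sub>m (T * S)"
    unfolding aU unfolding U_def using T S unfolding dd by (rule smult_mult_smult_mat)
  also have "\<dots> = 1\<^sub>m d" using one by (simp add: c)
  finally have 2: "mat_adjoint U * U = 1\<^sub>m d" .
  have "U * \<rho> \<mu> = \<sigma> \<mu> * U" if \<mu>: "\<mu> \<in> complex_measures" for \<mu>
    unfolding U_def using intertwiner_extend[OF s r S eqS \<mu>] S rep_carrier[OF r \<mu>] rep_carrier[OF s \<mu>] dd
    by (simp add: mult_smult_distrib[of _ d d] mult_smult_assoc_mat[of _ d d])
  then show ?thesis unfolding equivalent_reps_def using U 1 2 dd by auto
qed

text \<open>For fixed columns \<open>j\<close> and \<open>l\<close>, \<open>transl_adjoint\<close>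
  moves the translation by \<open>y\<close> from the coefficient of \<open>\<rho>\<close> to that of
  \<open>\<sigma>\<close>. There the conjugation and the passage to \<open>chk y\<close> cancel and
  leave an entry of \<open>\<sigma> (dirac y)\<close> on the right.\<close>

lemma coeff_intertwiner:
  assumes r: "reps (d, \<rho>)" and s: "reps (d', \<sigma>)" and jl: "j < d" "l < d'"
  defines "T \<equiv> mat d d' (\<lambda>(i, m). LINT x|haar. \<rho> (dirac x) $$ (i, j) * cnj (\<sigma> (dirac x) $$ (m, l)))"
  shows "\<rho> (dirac y) * T = T * \<sigma> (dirac y)"
proof (rule eq_matI)
  note R = rep_carrier[OF r dirac_complex] rep_carrier[OF s dirac_complex]
  have T: "T \<in> carrier_mat d d'" by (simp add: T_def)
  fix i m assume "i < dim_row (T * \<sigma> (dirac y))" "m < dim_col (T * \<sigma> (dirac y))"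
  then have im: "i < d" "m < d'" using T R(2)[of y] by auto
  note rc = rep_entry_dirac_continuous[OF r] and sc = rep_entry_dirac_continuous[OF s]
  define f where "f = (\<lambda>x. \<rho> (dirac x) $$ (i, j))"
  define g where "g = (\<lambda>x. cnj (\<sigma> (dirac x) $$ (m, l)))"
  have f: "continuous_on UNIV f" unfolding f_def by (rule rc[OF im(1) jl(1)])
  have g: "continuous_on UNIV g" unfolding g_def by (intro continuous_on_cnj sc im jl)
  have "(\<rho> (dirac y) * T) $$ (i, m) = (\<Sum>t<d. \<rho> (dirac y) $$ (i, t) * T $$ (t, m))"
    by (rule mat_mult_index[OF R(1) T im])
  also have "\<dots> = (\<Sum>t<d. (LINT x|haar. \<rho> (dirac y) $$ (i, t) * (\<rho> (dirac x) $$ (t, j) * g x)))"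
    using im by (intro sum.cong) (auto simp: T_def g_def)
  also have "\<dots> = (LINT x|haar. (\<Sum>t<d. \<rho> (dirac y) $$ (i, t) * (\<rho> (dirac x) $$ (t, j) * g x)))"
    by (rule Bochner_Integration.integral_sum[symmetric], intro integrable_haar continuous_intros rc g jl) auto
  also have "\<dots> = (LINT x|haar. transl f y x * g x)"
    unfolding f_def rep_entry_transl[OF r im(1) jl(1)] by (simp add: sum_distrib_right mult.assoc)
  also have "\<dots> = (LINT x|haar. f x * transl g (chk y) x)"
    by (rule transl_adjoint[OF f g])
  also have "\<dots> = (LINT x|haar. (\<Sum>t<d'. (f x * cnj (\<sigma> (dirac x) $$ (t, l))) * \<sigma> (dirac y) $$ (t, m)))"
  proof (rule Bochner_Integration.integral_cong[OF refl])
    fix x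
    have "transl g (chk y) x = cnj (transl (\<lambda>x. \<sigma> (dirac x) $$ (m, l)) (chk y) x)"
      by (simp add: transl_to_measure g_def)
    also have "\<dots> = (\<Sum>t<d'. \<sigma> (dirac y) $$ (t, m) * cnj (\<sigma> (dirac x) $$ (t, l)))"
      unfolding rep_entry_transl[OF s im(2) jl(2)] cnj_sum
      using im by (intro sum.cong) (auto simp: rep_entry_chk[OF s])
    finally show "f x * transl g (chk y) x = (\<Sum>t<d'. (f x * cnj (\<sigma> (dirac x) $$ (t, l))) * \<sigma> (dirac y) $$ (t, m))"
      by (simp add: sum_distrib_left mult_ac)
  qed
  also have "\<dots> = (\<Sum>t<d'. (LINT x|haar. (f x * cnj (\<sigma> (dirac x) $$ (t, l))) * \<sigma> (dirac y) $$ (t, m)))"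
    by (rule Bochner_Integration.integral_sum, intro integrable_haar continuous_intros continuous_on_cnj sc f jl) auto
  also have "\<dots> = (\<Sum>t<d'. T $$ (i, t) * \<sigma> (dirac y) $$ (t, m))"
    using im by (intro sum.cong) (auto simp: T_def f_def)
  also have "\<dots> = (T * \<sigma> (dirac y)) $$ (i, m)"
    by (rule mat_mult_index[OF T R(2) im, symmetric])
  finally show "(\<rho> (dirac y) * T) $$ (i, m) = (T * \<sigma> (dirac y)) $$ (i, m)" .
qed (use rep_carrier[OF r dirac_complex[of y]] rep_carrier[OF s dirac_complex[of y]] in \<open>auto simp: T_def\<close>)

end

section \<open>Orthogonality relations\<close>

lemma equivalent_reps_refl: "is_rep conv chk e r \<Longrightarrow> equivalent_reps r r"
proof -
  assume r: "is_rep conv chk e r"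
  obtain d \<rho> where [simp]: "r = (d, \<rho>)" by force
  have "mat_adjoint (1\<^sub>m d) = (1\<^sub>m d :: complex mat)" by (rule eq_matI) auto
  moreover have "\<rho> \<mu> \<in> carrier_mat d d" if "\<mu> \<in> complex_measures" for \<mu>
    using r that by (simp add: is_rep_def)
  then have "\<And>\<mu>. \<mu> \<in> complex_measures \<Longrightarrow> 1\<^sub>m d * \<rho> \<mu> = \<rho> \<mu> * 1\<^sub>m d"
    by (metis left_mult_one_mat right_mult_one_mat)
  ultimately show ?thesis unfolding equivalent_reps_def
    by (auto intro!: bexI[of _ "1\<^sub>m d"])
qed

lemma equivalent_reps_sym:
  assumes r: "is_rep conv chk e r" and s: "is_rep conv chk e s" and eq: "equivalent_reps r s"
  shows "equivalent_reps s r"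
proof -
  obtain d \<rho> where rd: "r = (d, \<rho>)" by force
  obtain \<sigma> where sd: "s = (d, \<sigma>)" using eq by (cases s) (auto simp: equivalent_reps_def rd)
  obtain U where U: "U \<in> carrier_mat d d" "U * mat_adjoint U = 1\<^sub>m d" "mat_adjoint U * U = 1\<^sub>m d"
    "\<And>\<mu>. \<mu> \<in> complex_measures \<Longrightarrow> U * \<rho> \<mu> = \<sigma> \<mu> * U"
    using eq by (auto simp: equivalent_reps_def rd sd)
  define V where "V = mat_adjoint U"
  have V: "V \<in> carrier_mat d d" unfolding V_def by (rule mat_adjoint_carrier[OF U(1)])
  have "V * \<sigma> \<mu> = \<rho> \<mu> * V" if \<mu>: "\<mu> \<in> complex_measures" for \<mu>
  proof -
    have R: "\<rho> \<mu> \<in> carrier_mat d d" "\<sigma> \<mu> \<in> carrier_mat d d"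
      using r s \<mu> by (auto simp: is_rep_def rd sd)
    have "V * \<sigma> \<mu> = V * \<sigma> \<mu> * (U * V)" using V R U by (simp add: V_def)
    also have "\<dots> = V * (\<sigma> \<mu> * U) * V"
      using assoc_mult_mat[OF mult_carrier_mat[OF V R(2)] U(1) V] assoc_mult_mat[OF V R(2) U(1)] by simp
    also have "\<dots> = V * (U * \<rho> \<mu>) * V" by (simp only: U(4)[OF \<mu>])
    also have "\<dots> = (V * U) * \<rho> \<mu> * V" using assoc_mult_mat[OF V U(1) R(1)] by simp
    also have "\<dots> = \<rho> \<mu> * V" using U(3) R by (simp add: V_def)
    finally show ?thesis .
  qed
  then show ?thesis
    using U V unfolding equivalent_reps_def rd sd V_def by (auto intro!: bexI[of _ "mat_adjoint U"])
qed

lemma equivalent_reps_trans: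
  assumes r: "is_rep conv chk e r" "is_rep conv chk e s" "is_rep conv chk e t"
    and eq: "equivalent_reps r s" "equivalent_reps s t"
  shows "equivalent_reps r t"
proof -
  obtain d \<rho> where rd: "r = (d, \<rho>)" by force
  obtain \<sigma> where sd: "s = (d, \<sigma>)" using eq by (cases s) (auto simp: equivalent_reps_def rd)
  obtain \<tau> where td: "t = (d, \<tau>)" using eq by (cases t) (auto simp: equivalent_reps_def sd)
  obtain U where U: "U \<in> carrier_mat d d" "U * mat_adjoint U = 1\<^sub>m d" "mat_adjoint U * U = 1\<^sub>m d"
    "\<And>\<mu>. \<mu> \<in> complex_measures \<Longrightarrow> U * \<rho> \<mu> = \<sigma> \<mu> * U"
    using eq by (auto simp: equivalent_reps_def rd sd)
  obtain V where V: "V \<in> carrier_mat d d" "V * mat_adjoint V = 1\<^sub>m d" "mat_adjoint V * V = 1\<^sub>m d"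
    "\<And>\<mu>. \<mu> \<in> complex_measures \<Longrightarrow> V * \<sigma> \<mu> = \<tau> \<mu> * V"
    using eq by (auto simp: equivalent_reps_def td sd)
  note UA = mat_adjoint_carrier[OF U(1)] and VA = mat_adjoint_carrier[OF V(1)]
  have A: "mat_adjoint (V * U) = mat_adjoint U * mat_adjoint V" by (rule mat_adjoint_mult[OF V(1) U(1)])
  have "(V * U) * (mat_adjoint U * mat_adjoint V) = V * (U * mat_adjoint U) * mat_adjoint V"
    using assoc_mult_mat[OF mult_carrier_mat[OF V(1) U(1)] UA VA] assoc_mult_mat[OF V(1) U(1) UA] by simp
  then have 1: "(V * U) * mat_adjoint (V * U) = 1\<^sub>m d" using U V by (simp add: A)
  have "(mat_adjoint U * mat_adjoint V) * (V * U) = mat_adjoint U * (mat_adjoint V * V) * U"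
    using assoc_mult_mat[OF mult_carrier_mat[OF UA VA] V(1) U(1)] assoc_mult_mat[OF UA VA V(1)] by simp
  then have 2: "mat_adjoint (V * U) * (V * U) = 1\<^sub>m d" using U V UA by (simp add: A)
  have 3: "(V * U) * \<rho> \<mu> = \<tau> \<mu> * (V * U)" if \<mu>: "\<mu> \<in> complex_measures" for \<mu>
  proof -
    have R: "\<rho> \<mu> \<in> carrier_mat d d" "\<sigma> \<mu> \<in> carrier_mat d d" "\<tau> \<mu> \<in> carrier_mat d d"
      using r \<mu> by (auto simp: is_rep_def rd sd td)
    have "(V * U) * \<rho> \<mu> = V * (U * \<rho> \<mu>)" by (rule assoc_mult_mat[OF V(1) U(1) R(1)])
    also have "\<dots> = (V * \<sigma> \<mu>) * U" unfolding U(4)[OF \<mu>] by (rule assoc_mult_mat[OF V(1) R(2) U(1), symmetric])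
    also have "\<dots> = \<tau> \<mu> * (V * U)" unfolding V(4)[OF \<mu>] by (rule assoc_mult_mat[OF R(3) V(1) U(1)])
    finally show ?thesis .
  qed
  show ?thesis
    unfolding equivalent_reps_def rd td
    using 1 2 3 mult_carrier_mat[OF V(1) U(1)] by (auto intro!: bexI[of _ "V * U"])
qed

section \<open>Coefficients of chosen representatives and the hyperdimension\<close>

context haar_hypergroup
begin

abbreviation hg_dual :: "'a hg_rep set set" where "hg_dual \<equiv> dual conv chk e"

lemma rep_of_dual:
  assumes "\<pi> \<in> hg_dual"
  shows "rep_of \<pi> \<in> \<pi>" "rep_of \<pi> \<in> irreps conv chk e"
    and "\<And>r. r \<in> \<pi> \<Longrightarrow> equivalent_reps r (rep_of \<pi>)"
proof -
  define R where "R = {(r, s). r \<in> irreps conv chk e \<and> s \<in> irreps conv chk e \<and> equivalent_reps r s}"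
  obtain r0 where r0: "r0 \<in> irreps conv chk e" "\<pi> = R `` {r0}"
    using assms unfolding dual_def R_def quotient_def by blast
  have "r0 \<in> \<pi>" using r0 equivalent_reps_refl[of conv chk e r0] by (auto simp: R_def irreps_def)
  then show mem: "rep_of \<pi> \<in> \<pi>" unfolding rep_of_def by (rule someI)
  then show irr: "rep_of \<pi> \<in> irreps conv chk e" by (auto simp: r0 R_def)
  fix r assume "r \<in> \<pi>"
  then have "equivalent_reps r0 r" "equivalent_reps r0 (rep_of \<pi>)" "r \<in> irreps conv chk e"
    using mem by (auto simp: r0 R_def)
  then show "equivalent_reps r (rep_of \<pi>)"
    using equivalent_reps_trans[of conv chk e r r0 "rep_of \<pi>"] equivalent_reps_sym[of conv chk e r0 r] irr r0
    by (auto simp: irreps_def)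
qed

lemma dual_eqI:
  assumes "\<pi> \<in> hg_dual" "\<pi>' \<in> hg_dual" "equivalent_reps (rep_of \<pi>) (rep_of \<pi>')"
  shows "\<pi> = \<pi>'"
proof -
  define R where "R = {(r, s). r \<in> irreps conv chk e \<and> s \<in> irreps conv chk e \<and> equivalent_reps r s}"
  have R: "equiv (irreps conv chk e) R"
  proof (rule equivI)
    show "R \<subseteq> irreps conv chk e \<times> irreps conv chk e" by (auto simp: R_def)
    show "refl_on (irreps conv chk e) R"
      by (auto simp: refl_on_def R_def irreps_def intro: equivalent_reps_refl)
    show "sym R" unfolding sym_def R_def irreps_def using equivalent_reps_sym by blast
    show "trans R" unfolding trans_def R_def irreps_def using equivalent_reps_trans by blast
  qed
  have "\<pi> \<in> irreps conv chk e // R" "\<pi>' \<in> irreps conv chk e // R" using assms by (simp_all add: dual_def R_def)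
  moreover have "(rep_of \<pi>, rep_of \<pi>') \<in> R" using assms rep_of_dual by (simp add: R_def)
  ultimately show ?thesis
    using quotient_eqI[OF R] rep_of_dual(1) assms by blast
qed

lemma dual_rep:
  assumes "\<pi> \<in> hg_dual"
  shows "reps (rep_dim \<pi>, snd (rep_of \<pi>))" "irreducible_rep (rep_dim \<pi>, snd (rep_of \<pi>))"
  using rep_of_dual(2)[OF assms] by (auto simp: irreps_def rep_dim_def)

lemma rep_dim_pos: "\<pi> \<in> hg_dual \<Longrightarrow> rep_dim \<pi> > 0"
  using dual_rep(2)[of \<pi>] by (simp add: irreducible_rep_def)

lemma coeff_continuous:
  "\<pi> \<in> hg_dual \<Longrightarrow> i < rep_dim \<pi> \<Longrightarrow> j < rep_dim \<pi> \<Longrightarrow> continuous_on UNIV (rep_coeff \<pi> i j)"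
  using rep_entry_dirac_continuous[OF dual_rep(1)[of \<pi>], of i j] unfolding rep_coeff_def[abs_def] by simp

lemma coeff_chk:
  "\<pi> \<in> hg_dual \<Longrightarrow> i < rep_dim \<pi> \<Longrightarrow> j < rep_dim \<pi> \<Longrightarrow> rep_coeff \<pi> i j (chk x) = cnj (rep_coeff \<pi> j i x)"
  unfolding rep_coeff_def by (rule rep_entry_chk[OF dual_rep(1)])

lemma coeff_transl:
  "\<pi> \<in> hg_dual \<Longrightarrow> i < rep_dim \<pi> \<Longrightarrow> j < rep_dim \<pi> \<Longrightarrow>
    transl (rep_coeff \<pi> i j) x y = (\<Sum>s<rep_dim \<pi>. rep_coeff \<pi> i s x * rep_coeff \<pi> s j y)"
  using rep_entry_transl[OF dual_rep(1)[of \<pi>], of i j x y] unfolding rep_coeff_def[abs_def] by simp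

lemma coeff_identity:
  "\<pi> \<in> hg_dual \<Longrightarrow> i < rep_dim \<pi> \<Longrightarrow> j < rep_dim \<pi> \<Longrightarrow> rep_coeff \<pi> i j e = (if i = j then 1 else 0)"
  using rep_identity[OF dual_rep(1)[of \<pi>]] by (simp add: rep_coeff_def)

text \<open>A nonzero integral would be a nonzero entry of an intertwiner, and the two classes would
  coincide.\<close>

lemma coeff_orthogonal_distinct:
  assumes \<pi>: "\<pi> \<in> hg_dual" "\<pi>' \<in> hg_dual" "\<pi> \<noteq> \<pi>'"
    and ij: "i < rep_dim \<pi>" "j < rep_dim \<pi>" "m < rep_dim \<pi>'" "l < rep_dim \<pi>'"
  shows "(LINT x|haar. rep_coeff \<pi> i j x * cnj (rep_coeff \<pi>' m l x)) = 0"
proof (rule ccontr)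
  assume nz: "\<not> ?thesis"
  define T where "T = mat (rep_dim \<pi>) (rep_dim \<pi>') (\<lambda>(i, m).
      LINT x|haar. snd (rep_of \<pi>) (dirac x) $$ (i, j) * cnj (snd (rep_of \<pi>') (dirac x) $$ (m, l)))"
  have "equivalent_reps (rep_dim \<pi>, snd (rep_of \<pi>)) (rep_dim \<pi>', snd (rep_of \<pi>'))"
  proof (rule schur_equivalent[OF dual_rep(1)[OF \<pi>(1)] dual_rep(1)[OF \<pi>(2)] dual_rep(2)[OF \<pi>(1)] dual_rep(2)[OF \<pi>(2)] _ _ ij(1,3)])
    show "T \<in> carrier_mat (rep_dim \<pi>) (rep_dim \<pi>')" by (simp add: T_def)
    show "snd (rep_of \<pi>) (dirac y) * T = T * snd (rep_of \<pi>') (dirac y)" for y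
      unfolding T_def by (rule coeff_intertwiner[OF dual_rep(1)[OF \<pi>(1)] dual_rep(1)[OF \<pi>(2)] ij(2,4)])
    show "T $$ (i, m) \<noteq> 0" using nz ij by (simp add: T_def rep_coeff_def)
  qed
  then have "\<pi> = \<pi>'" by (intro dual_eqI[OF \<pi>(1,2)]) (simp add: rep_dim_def)
  then show False using \<pi>(3) by simp
qed

text \<open>Schur's lemma settles the row indices: for fixed \<open>j\<close> and \<open>l\<close>
  the integrals form a multiple \<open>c j l\<close> of the identity matrix. The substitution by
  \<open>chk\<close> exchanges rows with columns and settles the column indices. One constant
  \<open>c0\<close> remains, and its positivity makes \<open>k\<close> meaningful.\<close>

lemma coeff_orthogonal_same:
  assumes \<pi>: "\<pi> \<in> hg_dual"
  shows "\<exists>k>0. \<forall>i<rep_dim \<pi>. \<forall>j<rep_dim \<pi>. \<forall>m<rep_dim \<pi>. \<forall>l<rep_dim \<pi>.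
    (LINT x|haar. rep_coeff \<pi> i j x * cnj (rep_coeff \<pi> m l x)) =
      (if i = m \<and> j = l then complex_of_real (1 / k) else 0)"
proof -
  define d where "d = rep_dim \<pi>"
  have d: "d > 0" unfolding d_def by (rule rep_dim_pos[OF \<pi>])
  define I where "I = (\<lambda>i j m l. LINT x|haar. rep_coeff \<pi> i j x * cnj (rep_coeff \<pi> m l x))"
  have "\<exists>c. \<forall>i<d. \<forall>m<d. I i j m l = (if i = m then c else 0)" if jl: "j < d" "l < d" for j l
  proof -
    define T where "T = mat d d (\<lambda>(i, m).
      LINT x|haar. snd (rep_of \<pi>) (dirac x) $$ (i, j) * cnj (snd (rep_of \<pi>) (dirac x) $$ (m, l)))"
    have "\<exists>c. T = c \<cdot>\<^sub>m 1\<^sub>m d"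
    proof (rule schur_scalar[OF dual_rep[OF \<pi>, folded d_def]])
      show "T \<in> carrier_mat d d" by (simp add: T_def)
      show "snd (rep_of \<pi>) (dirac y) * T = T * snd (rep_of \<pi>) (dirac y)" for y
        unfolding T_def d_def
        by (rule coeff_intertwiner[OF dual_rep(1)[OF \<pi>] dual_rep(1)[OF \<pi>] jl[unfolded d_def]])
    qed
    then obtain c where c: "T = c \<cdot>\<^sub>m 1\<^sub>m d" by blast
    have "I i j m l = (if i = m then c else 0)" if "i < d" "m < d" for i m
    proof -
      have "I i j m l = T $$ (i, m)" using that by (simp add: I_def T_def rep_coeff_def)
      also have "\<dots> = (if i = m then c else 0)" using that by (simp add: c)
      finally show ?thesis .
    qed
    then show ?thesis by blast
  qed
  then obtain c where c: "\<And>j l i m. j < d \<Longrightarrow> l < d \<Longrightarrow> i < d \<Longrightarrow> m < d \<Longrightarrow>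
      I i j m l = (if i = m then c j l else 0)" by metis
  \<comment> \<open>\<open>chk\<close> replaces every coefficient by the conjugate of the transposed
    one, which exchanges the two factors of the integrand.\<close>
  have swap: "I i j m l = I l m j i" if "i < d" "j < d" "m < d" "l < d" for i j m l
  proof -
    have cont: "continuous_on UNIV (\<lambda>x. rep_coeff \<pi> i j x * cnj (rep_coeff \<pi> m l x))"
      using that by (intro continuous_intros continuous_on_cnj coeff_continuous[OF \<pi>]) (auto simp: d_def)
    show ?thesis
      unfolding I_def using haar_chk[OF cont] that coeff_chk[OF \<pi>] by (simp add: d_def mult.commute)
  qed
  define c0 where "c0 = I 0 0 0 0"
  have cjl: "c j l = (if j = l then c0 else 0)" if jl: "j < d" "l < d" for j l
  proof -
    have "c j l = I 0 j 0 l" using c[OF jl d d] by simp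
    also have "\<dots> = I l 0 j 0" by (rule swap[OF d jl(1) d jl(2)])
    also have "\<dots> = (if l = j then c 0 0 else 0)" using c[OF d d jl(2,1)] by simp
    also have "c 0 0 = c0" using c[OF d d d d] by (simp add: c0_def)
    finally show ?thesis by auto
  qed
  \<comment> \<open>At the identity the representation is the identity matrix, so
    \<open>r e = 1\<close> and \<open>haar_bump_pos\<close> applies.\<close>
  define r where "r = (\<lambda>x. (cmod (rep_coeff \<pi> 0 0 x))\<^sup>2)"
  have "(LINT x|haar. r x) > 0"
  proof (rule haar_bump_pos)
    show "continuous_on UNIV r"
      unfolding r_def using coeff_continuous[OF \<pi>, of 0 0] d by (intro continuous_intros) (simp add: d_def)
    show "r e > 0" using coeff_identity[OF \<pi>, of 0 0] d by (simp add: r_def d_def)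
  qed (simp add: r_def)
  moreover have "c0 = complex_of_real (LINT x|haar. r x)"
    unfolding c0_def I_def r_def complex_norm_square[symmetric] by (rule integral_complex_of_real)
  ultimately obtain k where k: "k > 0" "c0 = complex_of_real (1 / k)"
    by (metis inverse_eq_divide inverse_inverse_eq inverse_positive_iff_positive)
  have "I i j m l = (if i = m \<and> j = l then complex_of_real (1 / k) else 0)"
    if "i < d" "j < d" "m < d" "l < d" for i j m l
    unfolding c[OF that(2,4,1,3)] cjl[OF that(2,4)] k(2) by auto
  then show ?thesis using k(1) unfolding I_def d_def by blast
qed

text \<open>The description in \<open>hyperdim\<close> ranges over the whole dual. Other classes are
  handled by \<open>coeff_orthogonal_distinct\<close>; uniqueness is read off at the entry with all
  indices 0, which exists because dimensions are positive.\<close>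

lemma hyperdim_eqI:
  assumes \<pi>: "\<pi> \<in> hg_dual"
    and k: "\<And>i j m l. i < rep_dim \<pi> \<Longrightarrow> j < rep_dim \<pi> \<Longrightarrow> m < rep_dim \<pi> \<Longrightarrow> l < rep_dim \<pi> \<Longrightarrow>
    (LINT x|haar. rep_coeff \<pi> i j x * cnj (rep_coeff \<pi> m l x)) =
      (if i = m \<and> j = l then complex_of_real (1 / k) else 0)"
  shows "hyperdim conv chk e haar \<pi> = k"
  unfolding hyperdim_def
proof (rule the_equality)
  show "\<forall>\<pi>'\<in>hg_dual. \<forall>i<rep_dim \<pi>. \<forall>j<rep_dim \<pi>. \<forall>m<rep_dim \<pi>'. \<forall>l<rep_dim \<pi>'.
       (LINT x|haar. rep_coeff \<pi> i j x * cnj (rep_coeff \<pi>' m l x)) =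
         (if i = m \<and> j = l \<and> \<pi> = \<pi>' then complex_of_real (1 / k) else 0)"
  proof (intro ballI allI impI)
    fix \<pi>' i j m l assume "\<pi>' \<in> hg_dual" "i < rep_dim \<pi>" "j < rep_dim \<pi>" "m < rep_dim \<pi>'" "l < rep_dim \<pi>'"
    then show "(LINT x|haar. rep_coeff \<pi> i j x * cnj (rep_coeff \<pi>' m l x)) =
         (if i = m \<and> j = l \<and> \<pi> = \<pi>' then complex_of_real (1 / k) else 0)"
      using k[of i j m l] coeff_orthogonal_distinct[OF \<pi>, of \<pi>' i j m l] by (cases "\<pi> = \<pi>'") auto
  qed
next
  fix k' :: real
  assume "\<forall>\<pi>'\<in>hg_dual. \<forall>i<rep_dim \<pi>. \<forall>j<rep_dim \<pi>. \<forall>m<rep_dim \<pi>'. \<forall>l<rep_dim \<pi>'.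
       (LINT x|haar. rep_coeff \<pi> i j x * cnj (rep_coeff \<pi>' m l x)) =
         (if i = m \<and> j = l \<and> \<pi> = \<pi>' then complex_of_real (1 / k') else 0)"
  then have "(LINT x|haar. rep_coeff \<pi> 0 0 x * cnj (rep_coeff \<pi> 0 0 x)) = complex_of_real (1 / k')"
    using \<pi> rep_dim_pos[OF \<pi>] by simp
  then have "complex_of_real (1 / k') = complex_of_real (1 / k)"
    using k[of 0 0 0 0] rep_dim_pos[OF \<pi>] by simp
  \<comment> \<open>With \<open>1 / 0 = 0\<close> the reciprocal is injective on all reals.\<close>
  then show "k' = k" by simp
qed

lemma
  assumes \<pi>: "\<pi> \<in> hg_dual"
  shows hyperdim_pos: "hyperdim conv chk e haar \<pi> > 0"
    and coeff_orthogonal: "\<And>i j m l. i < rep_dim \<pi> \<Longrightarrow> j < rep_dim \<pi> \<Longrightarrow> m < rep_dim \<pi> \<Longrightarrow> l < rep_dim \<pi> \<Longrightarrow>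
    (LINT x|haar. rep_coeff \<pi> i j x * cnj (rep_coeff \<pi> m l x)) =
      (if i = m \<and> j = l then complex_of_real (1 / hyperdim conv chk e haar \<pi>) else 0)"
proof -
  obtain k where k: "k > 0" "\<And>i j m l. i < rep_dim \<pi> \<Longrightarrow> j < rep_dim \<pi> \<Longrightarrow> m < rep_dim \<pi> \<Longrightarrow> l < rep_dim \<pi> \<Longrightarrow>
    (LINT x|haar. rep_coeff \<pi> i j x * cnj (rep_coeff \<pi> m l x)) =
      (if i = m \<and> j = l then complex_of_real (1 / k) else 0)"
    using coeff_orthogonal_same[OF \<pi>] by blast
  have "hyperdim conv chk e haar \<pi> = k" by (rule hyperdim_eqI[OF \<pi> k(2)])
  then show "hyperdim conv chk e haar \<pi> > 0"
    and "\<And>i j m l. i < rep_dim \<pi> \<Longrightarrow> j < rep_dim \<pi> \<Longrightarrow> m < rep_dim \<pi> \<Longrightarrow> l < rep_dim \<pi> \<Longrightarrow>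
    (LINT x|haar. rep_coeff \<pi> i j x * cnj (rep_coeff \<pi> m l x)) =
      (if i = m \<and> j = l then complex_of_real (1 / hyperdim conv chk e haar \<pi>) else 0)"
    using k by auto
qed

text \<open>With \<open>H\<close> the largest Hilbert-Schmidt norm, \<open>\<pi>(x)\<^sup>* \<pi>(x)\<close> is an average of matrices
  \<open>\<pi>(w)\<close>, whose traces are at most \<open>sqrt d * H\<close>; hence \<open>H\<^sup>2 \<le> sqrt d * H\<close>.\<close>

lemma coeff_hs_le:
  assumes \<pi>: "\<pi> \<in> hg_dual"
  shows "(\<Sum>i<rep_dim \<pi>. \<Sum>j<rep_dim \<pi>. (cmod (rep_coeff \<pi> i j x))\<^sup>2) \<le> rep_dim \<pi>"
proof -
  define d where "d = rep_dim \<pi>"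
  define S where "S = (\<lambda>x. \<Sum>i<d. \<Sum>j<d. (cmod (rep_coeff \<pi> i j x))\<^sup>2)"
  note cont = coeff_continuous[OF \<pi>, folded d_def]
  have "continuous_on UNIV S"
    unfolding S_def by (intro continuous_intros cont) auto
  then obtain x0 where x0: "\<And>x. S x \<le> S x0"
    using continuous_attains_sup[OF compact_space] by blast
  define H where "H = sqrt (S x0)"
  have S0: "S x \<ge> 0" for x unfolding S_def by (intro sum_nonneg) auto
  have H: "H \<ge> 0" "H\<^sup>2 = S x0" using S0[of x0] by (auto simp: H_def)
  \<comment> \<open>Cauchy-Schwarz between the diagonal of the matrix and the constant vector 1,
    which produces the factor \<open>sqrt d\<close>.\<close>
  have tr: "cmod (\<Sum>j<d. rep_coeff \<pi> j j w) \<le> sqrt d * H" for w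
  proof -
    have "(\<Sum>j<d. cmod (rep_coeff \<pi> j j w) * 1)\<^sup>2 \<le> (\<Sum>j<d. (cmod (rep_coeff \<pi> j j w))\<^sup>2) * (\<Sum>j<d. 1\<^sup>2)"
      by (rule Cauchy_Schwarz_ineq_sum)
    also have "\<dots> \<le> S w * d"
    proof -
      have "(\<Sum>j<d. (cmod (rep_coeff \<pi> j j w))\<^sup>2) \<le> S w"
        unfolding S_def
      proof (rule sum_mono)
        fix j assume "j \<in> {..<d}"
        then show "(cmod (rep_coeff \<pi> j j w))\<^sup>2 \<le> (\<Sum>l<d. (cmod (rep_coeff \<pi> j l w))\<^sup>2)"
          using member_le_sum[of j "{..<d}" "\<lambda>l. (cmod (rep_coeff \<pi> j l w))\<^sup>2"] by simp
      qed
      then show ?thesis by (simp add: mult_right_mono)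
    qed
    also have "\<dots> \<le> H\<^sup>2 * d" using x0[of w] H by (intro mult_right_mono) auto
    also have "\<dots> = (sqrt d * H)\<^sup>2" by (simp add: power_mult_distrib)
    finally have "(\<Sum>j<d. cmod (rep_coeff \<pi> j j w))\<^sup>2 \<le> (sqrt d * H)\<^sup>2" by simp
    then have "(\<Sum>j<d. cmod (rep_coeff \<pi> j j w)) \<le> sqrt d * H"
      by (rule power2_le_imp_le) (use H in simp)
    then show ?thesis using norm_sum[of "\<lambda>j. rep_coeff \<pi> j j w" "{..<d}"] by linarith
  qed
  \<comment> \<open>The squared Hilbert-Schmidt norm is the trace of adjoint times matrix. The
    adjoint at \<open>x0\<close> is the value at \<open>chk x0\<close>, so every diagonal entry of
    the product is a translate of a coefficient.\<close>
  have "complex_of_real (S x0) = (\<Sum>j<d. \<Sum>i<d. cnj (rep_coeff \<pi> i j x0) * rep_coeff \<pi> i j x0)"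
    unfolding S_def by (subst sum.swap) (simp add: complex_norm_square mult.commute del: of_real_power)
  also have "\<dots> = (\<Sum>j<d. transl (rep_coeff \<pi> j j) (chk x0) x0)"
    using coeff_transl[OF \<pi>] coeff_chk[OF \<pi>] by (simp add: d_def)
  also have "\<dots> = (LINT w|to_measure (conv (dirac (chk x0)) (dirac x0)). (\<Sum>j<d. rep_coeff \<pi> j j w))"
    unfolding transl_to_measure
    by (rule Bochner_Integration.integral_sum[symmetric]) (intro integrable_conv_dirac cont, auto)
  finally have "S x0 = cmod (LINT w|to_measure (conv (dirac (chk x0)) (dirac x0)). (\<Sum>j<d. rep_coeff \<pi> j j w))"
    using S0[of x0] by (metis abs_of_nonneg norm_of_real)
  also have "\<dots> \<le> sqrt d * H"
    by (rule norm_integral_le_const[OF prob_conv_dirac tr])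
      (intro integrable_conv_dirac continuous_intros cont, auto)
  finally have "H * H \<le> sqrt d * H" using H(2) by (simp add: power2_eq_square)
  then have "H \<le> sqrt d" using H(1) by (cases "H = 0") auto
  then have "H\<^sup>2 \<le> d" using H(1) by (metis real_sqrt_le_iff real_sqrt_unique)
  then show ?thesis using x0[of x] H(2) by (simp add: S_def d_def)
qed

text \<open>The bound of \<open>coeff_hs_le\<close> is integrated: each of the \<open>d * d\<close>
  entries contributes \<open>1 / k\<close>, and the sum is at most \<open>d\<close>.\<close>

lemma rep_dim_le_hyperdim:
  assumes \<pi>: "\<pi> \<in> hg_dual"
  shows "rep_dim \<pi> \<le> hyperdim conv chk e haar \<pi>"
proof -
  define d where "d = rep_dim \<pi>"
  define k where "k = hyperdim conv chk e haar \<pi>"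
  have d: "d > 0" unfolding d_def by (rule rep_dim_pos[OF \<pi>])
  have k: "k > 0" unfolding k_def by (rule hyperdim_pos[OF \<pi>])
  note cont = coeff_continuous[OF \<pi>, folded d_def]
  have one: "(LINT x|haar. (cmod (rep_coeff \<pi> i j x))\<^sup>2) = 1 / k" if "i < d" "j < d" for i j
  proof -
    have "complex_of_real (LINT x|haar. (cmod (rep_coeff \<pi> i j x))\<^sup>2)
      = (LINT x|haar. rep_coeff \<pi> i j x * cnj (rep_coeff \<pi> i j x))"
      unfolding complex_norm_square[symmetric] by (rule integral_complex_of_real[symmetric])
    also have "\<dots> = complex_of_real (1 / k)"
      using coeff_orthogonal[OF \<pi>, of i j i j] that by (simp add: k_def d_def)
    finally show ?thesis by (simp only: of_real_eq_iff)
  qed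
  have i: "integrable haar (\<lambda>x. (cmod (rep_coeff \<pi> i j x))\<^sup>2)" if "i < d" "j < d" for i j
    by (intro integrable_haar_real continuous_intros cont that)
  have "real d * real d * (1 / k) = (\<Sum>i<d. \<Sum>j<d. LINT x|haar. (cmod (rep_coeff \<pi> i j x))\<^sup>2)"
    using one by simp
  also have "\<dots> = (LINT x|haar. (\<Sum>i<d. \<Sum>j<d. (cmod (rep_coeff \<pi> i j x))\<^sup>2))"
    using i by (subst Bochner_Integration.integral_sum) (auto intro!: sum.cong)
  also have "\<dots> \<le> (LINT x|haar. real d)"
  proof (rule integral_mono)
    show "integrable haar (\<lambda>x. (\<Sum>i<d. \<Sum>j<d. (cmod (rep_coeff \<pi> i j x))\<^sup>2))"
      by (intro Bochner_Integration.integrable_sum i) auto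
    show "integrable haar (\<lambda>x. real d)" by (rule finite_measure.integrable_const[OF finite_measure_haar])
    show "(\<Sum>i<d. \<Sum>j<d. (cmod (rep_coeff \<pi> i j x))\<^sup>2) \<le> real d" for x
      using coeff_hs_le[OF \<pi>] by (simp add: d_def)
  qed
  also have "\<dots> = real d" by (simp add: measure_haar_UNIV)
  finally have "real d * real d \<le> real d * k" using k by (simp add: field_simps)
  then have "real d \<le> k" using d by simp
  then show ?thesis by (simp add: d_def k_def)
qed

end

section \<open>Paley and Hausdorff-Young inequalities\<close>

text \<open>Layer-cake weights: a positive power is an integral over the thresholds below a value,
  and a negative power, in the next lemma, one over the thresholds above it.\<close>

lemma nn_integral_powr_Ioc:
  assumes s: "s > 0" and c: "c \<ge> 0"
  shows "(\<integral>\<^sup>+y. ennreal (y powr (s - 1)) * indicator {0<..c} y \<partial>lborel) = ennreal (c powr s / s)"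
proof -
  define f where "f = (\<lambda>y::real. if y \<in> {0..c} then y powr (s - 1) else 0)"
  have "((\<lambda>y. y powr (s - 1)) has_integral (c powr s / s)) {0..c}"
    using has_integral_powr_from_0[of "s - 1" c] s c by simp
  then have I: "(f has_integral (c powr s / s)) UNIV"
    unfolding f_def by (subst has_integral_restrict_UNIV)
  have [measurable]: "f \<in> borel_measurable borel" unfolding f_def by measurable
  have "(\<integral>\<^sup>+y. ennreal (f y) \<partial>lborel) = ennreal (c powr s / s)"
    by (rule nn_integral_has_integral_lborel[OF _ _ I]) (auto simp: f_def)
  also have "(\<integral>\<^sup>+y. ennreal (f y) \<partial>lborel) = (\<integral>\<^sup>+y. ennreal (y powr (s - 1)) * indicator {0<..c} y \<partial>lborel)"
    by (intro nn_integral_cong_AE) (auto simp: f_def indicator_def intro!: AE_I2)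
  finally show ?thesis by simp
qed

lemma nn_integral_powr_Ici:
  assumes s: "s < 0" and c: "c > 0"
  shows "(\<integral>\<^sup>+y. ennreal (y powr (s - 1)) * indicator {c..} y \<partial>lborel) = ennreal (c powr s / (- s))"
proof -
  define f where "f = (\<lambda>y::real. if y \<in> {c..} then y powr (s - 1) else 0)"
  have "((\<lambda>y. y powr (s - 1)) has_integral (c powr s / (- s))) {c..}"
    using has_integral_powr_to_inf[of "s - 1" c] s c by simp
  then have I: "(f has_integral (c powr s / (- s))) UNIV"
    unfolding f_def by (subst has_integral_restrict_UNIV)
  have [measurable]: "f \<in> borel_measurable borel" unfolding f_def by measurable
  have "(\<integral>\<^sup>+y. ennreal (f y) \<partial>lborel) = ennreal (c powr s / (- s))"
    by (rule nn_integral_has_integral_lborel[OF _ _ I]) (auto simp: f_def)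
  also have "(\<integral>\<^sup>+y. ennreal (f y) \<partial>lborel) = (\<integral>\<^sup>+y. ennreal (y powr (s - 1)) * indicator {c..} y \<partial>lborel)"
    by (intro nn_integral_cong) (auto simp: f_def indicator_def)
  finally show ?thesis by simp
qed

lemma ennreal_mult3:
  "0 \<le> a \<Longrightarrow> 0 \<le> b \<Longrightarrow> 0 \<le> c \<Longrightarrow> ennreal a * ennreal b * ennreal c = ennreal (a * b * c)"
  by (simp add: ennreal_mult)

text \<open>The two endpoint bounds satisfied by \<open>a f \<pi> = \<parallel>f^(\<pi>)\<parallel> / sqrt k\<close> with the weights
  \<open>w \<pi> = k\<^sup>2\<close>: type \<open>(1, \<infinity>)\<close> and type \<open>(2, 2)\<close>.\<close>

locale fourier_type = prob_space N for N :: "'x measure" +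
  fixes I :: "'i set" and w :: "'i \<Rightarrow> real" and a :: "('x \<Rightarrow> complex) \<Rightarrow> 'i \<Rightarrow> real"
  assumes w_nonneg: "\<And>i. i \<in> I \<Longrightarrow> 0 \<le> w i"
    and a_nonneg: "\<And>f i. i \<in> I \<Longrightarrow> 0 \<le> a f i"
    and a_add: "\<And>f g i. i \<in> I \<Longrightarrow> integrable N f \<Longrightarrow> integrable N g \<Longrightarrow>
        a (\<lambda>x. f x + g x) i \<le> a f i + a g i"
    and a_L1: "\<And>f i. i \<in> I \<Longrightarrow> integrable N f \<Longrightarrow> a f i \<le> (LINT x|N. cmod (f x))"
    and a_L2: "\<And>f F. finite F \<Longrightarrow> F \<subseteq> I \<Longrightarrow> f \<in> borel_measurable N \<Longrightarrow>
        integrable N (\<lambda>x. (cmod (f x))\<^sup>2) \<Longrightarrow>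
        (\<Sum>i\<in>F. w i * (a f i)\<^sup>2) \<le> (LINT x|N. (cmod (f x))\<^sup>2)"
begin

text \<open>The truncations distribute \<open>f\<close> over the two endpoint bounds: the bounded
  part \<open>low\<close> goes to the type (2, 2) estimate, the part \<open>high\<close> to the type
  (1, \<infinity>) estimate. Points with modulus exactly \<open>t\<close> belong to
  \<open>low\<close>.\<close>

definition low :: "real \<Rightarrow> ('x \<Rightarrow> complex) \<Rightarrow> 'x \<Rightarrow> complex" where
  "low t f x = (if cmod (f x) \<le> t then f x else 0)"

definition high :: "real \<Rightarrow> ('x \<Rightarrow> complex) \<Rightarrow> 'x \<Rightarrow> complex" where
  "high t f x = (if cmod (f x) \<le> t then 0 else f x)"

lemma low_high_measurable [measurable]:
  assumes [measurable]: "f \<in> borel_measurable N"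
  shows "low t f \<in> borel_measurable N" "high t f \<in> borel_measurable N"
  unfolding low_def[abs_def] high_def[abs_def] by measurable

lemma integrable_low:
  assumes f: "f \<in> borel_measurable N"
  shows "integrable N (low t f)" "integrable N (\<lambda>x. (cmod (low t f x))\<^sup>2)"
proof -
  note [measurable] = f
  have b: "cmod (low t f x) \<le> \<bar>t\<bar>" for x by (auto simp: low_def)
  then show "integrable N (low t f)" by (intro integrable_const_bound[of _ "\<bar>t\<bar>"]) auto
  have "(cmod (low t f x))\<^sup>2 \<le> t\<^sup>2" for x using b[of x] by (metis abs_le_square_iff abs_norm_cancel)
  then show "integrable N (\<lambda>x. (cmod (low t f x))\<^sup>2)" by (intro integrable_const_bound[of _ "t\<^sup>2"]) auto
qed

text \<open>The modulus is at most 1, or else at most its own \<open>p\<close>-th power; constants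
  are integrable on a probability space.\<close>

lemma integrable_Lp:
  assumes "1 \<le> p" and f: "f \<in> borel_measurable N" "integrable N (\<lambda>x. cmod (f x) powr p)"
  shows "integrable N f"
proof (rule Bochner_Integration.integrable_bound[OF _ f(1)])
  show "integrable N (\<lambda>x. 1 + cmod (f x) powr p)" using f(2) by simp
  have "cmod (f x) \<le> 1 + cmod (f x) powr p" for x
  proof (cases "cmod (f x) \<le> 1")
    case False
    then have "cmod (f x) powr 1 \<le> cmod (f x) powr p" using assms(1) by (intro powr_mono) auto
    then show ?thesis using False by simp
  qed (simp add: add_increasing2)
  then show "AE x in N. norm (f x) \<le> norm (1 + cmod (f x) powr p)" by (intro AE_I2) (simp add: add_nonneg_nonneg)
qed

lemma integrable_high:
  assumes "f \<in> borel_measurable N" "integrable N f"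
  shows "integrable N (high t f)"
  by (rule Bochner_Integration.integrable_bound[OF assms(2)]) (use assms in \<open>auto simp: high_def\<close>)

lemma a_le_low_high:
  assumes "i \<in> I" "f \<in> borel_measurable N" "integrable N f"
  shows "a f i \<le> a (high t f) i + a (low t f) i"
proof -
  have "(\<lambda>x. high t f x + low t f x) = f" by (auto simp: high_def low_def)
  then show ?thesis
    using a_add[OF assms(1) integrable_high[OF assms(2,3), of t] integrable_low(1)[OF assms(2), of t]] by simp
qed

text \<open>Marcinkiewicz interpolation, with the truncation level chosen so that the \<open>L\<^sup>1\<close> part
  contributes at most half of the threshold \<open>y\<close>.\<close>

lemma hausdorff_young:
  assumes p: "1 < p" "p < 2" and q: "1 / p + 1 / q = 1"
    and f [measurable]: "f \<in> borel_measurable N" and fp: "integrable N (\<lambda>x. cmod (f x) powr p)"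
    and F: "finite F" "F \<subseteq> I"
  defines "A \<equiv> (LINT x|N. cmod (f x) powr p)"
  shows "(\<Sum>i\<in>F. w i * a f i powr q) \<le> 4 * 2 powr (q - 2) * A powr (q - 1)"
proof -
  have fi: "integrable N f" by (rule integrable_Lp[OF _ f fp]) (use p in simp)
  have q0: "q = p / (p - 1)"
  proof -
    have "1 / q = (p - 1) / p" using q p by (simp add: field_simps)
    then show ?thesis using p by (metis inverse_divide inverse_eq_divide inverse_inverse_eq)
  qed
  have q2: "q > 2" using p unfolding q0 by (simp add: field_simps)
  have qp: "(p - 1) * (q - 2) = 2 - p" "(p - 1) * (q - 1) = 1" using p unfolding q0 by (simp_all add: field_simps)
  have A0: "A \<ge> 0" unfolding A_def by simp
  \<comment> \<open>For \<open>A > 0\<close> this solves \<open>t powr (1 - p) * A = y / 2\<close>.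
    Where the modulus of \<open>f\<close> exceeds \<open>t\<close>, it is at most
    \<open>t powr (1 - p)\<close> times its \<open>p\<close>-th power.\<close>
  define t where "t = (\<lambda>y. (2 * A / y) powr (1 / (p - 1)))"
  have t0: "t y \<ge> 0" for y by (simp add: t_def)
  have high_bd: "(LINT x|N. cmod (high (t y) f x)) \<le> y / 2" if y: "y > 0" for y
  proof (cases "A = 0")
    \<comment> \<open>Here the level is 0, as \<open>0 powr\<close> any exponent is 0, and
      \<open>f\<close> vanishes almost everywhere.\<close>
    case True
    have "AE x in N. cmod (f x) powr p = 0"
      using True integral_nonneg_eq_0_iff_AE[OF fp] unfolding A_def by simp
    then have "AE x in N. cmod (high (t y) f x) = 0" by (auto simp: high_def elim!: eventually_mono)
    then have "(LINT x|N. cmod (high (t y) f x)) = 0" by (rule integral_eq_zero_AE)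
    then show ?thesis using y by simp
  next
    case False
    then have Ap: "A > 0" using A0 by simp
    have tp: "t y > 0" using Ap y by (simp add: t_def)
    have "t y powr (p - 1) = 2 * A / y" using p Ap y by (simp add: t_def powr_powr)
    then have t1: "t y powr (1 - p) = y / (2 * A)" using powr_minus_divide[of "t y" "p - 1"] by simp
    have "cmod (high (t y) f x) \<le> t y powr (1 - p) * cmod (f x) powr p" for x
    proof (cases "cmod (f x) \<le> t y")
      case False
      then have "cmod (f x) powr (1 - p) \<le> t y powr (1 - p)"
        using tp p by (intro powr_mono2') auto
      then have "cmod (f x) powr (1 - p) * cmod (f x) powr p \<le> t y powr (1 - p) * cmod (f x) powr p"
        by (rule mult_right_mono) simp
      moreover have "cmod (f x) powr (1 - p) * cmod (f x) powr p = cmod (f x)"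
        using False tp by (simp flip: powr_add)
      ultimately show ?thesis using False by (simp add: high_def)
    qed (simp add: high_def)
    then have "(LINT x|N. cmod (high (t y) f x)) \<le> (LINT x|N. t y powr (1 - p) * cmod (f x) powr p)"
      using integrable_high[OF f fi, of "t y"] fp by (intro integral_mono) auto
    also have "\<dots> = y / (2 * A) * A" by (simp add: t1 A_def)
    finally show ?thesis using Ap by simp
  qed
  define G where "G = (\<lambda>y. \<integral>\<^sup>+x. ennreal (4 * (cmod (f x))\<^sup>2) * indicator {x. cmod (f x) \<le> t y} x \<partial>N)"
  \<comment> \<open>At a threshold \<open>y \<le> a f i\<close> the high part accounts for at most
    half of \<open>a f i\<close>. So \<open>a f i\<close> is at most twice the value of the low
    part, and squaring gives the factor 4.\<close>
  have sumG: "(\<Sum>i\<in>F. ennreal (w i * (a f i)\<^sup>2) * indicator {0<..a f i} y) \<le> G y * indicator {0<..} y" for y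
  proof (cases "y > 0")
    case True
    have "ennreal (w i * (a f i)\<^sup>2) * indicator {0<..a f i} y \<le> ennreal (4 * (w i * (a (low (t y) f) i)\<^sup>2))" if "i \<in> F" for i
    proof (cases "y \<le> a f i")
      case ya: True
      have i: "i \<in> I" using that F by auto
      have "a f i \<le> y / 2 + a (low (t y) f) i"
        using a_le_low_high[OF i f fi, of "t y"] a_L1[OF i integrable_high[OF f fi, of "t y"]] high_bd[OF True] by linarith
      then have "a f i \<le> 2 * a (low (t y) f) i" using ya by linarith
      then have "(a f i)\<^sup>2 \<le> (2 * a (low (t y) f) i)\<^sup>2" by (rule power_mono) (rule a_nonneg[OF i])
      then have "w i * (a f i)\<^sup>2 \<le> w i * (2 * a (low (t y) f) i)\<^sup>2" by (rule mult_left_mono) (rule w_nonneg[OF i])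
      then show ?thesis using True ya by (auto intro!: ennreal_leI simp: power_mult_distrib mult_ac)
    qed simp
    then have "(\<Sum>i\<in>F. ennreal (w i * (a f i)\<^sup>2) * indicator {0<..a f i} y) \<le> (\<Sum>i\<in>F. ennreal (4 * (w i * (a (low (t y) f) i)\<^sup>2)))"
      by (rule sum_mono)
    also have "\<dots> = ennreal (4 * (\<Sum>i\<in>F. w i * (a (low (t y) f) i)\<^sup>2))"
      using F w_nonneg by (subst sum_ennreal) (auto simp: sum_distrib_left intro!: mult_nonneg_nonneg)
    also have "\<dots> \<le> ennreal (4 * (LINT x|N. (cmod (low (t y) f x))\<^sup>2))"
      using a_L2[OF F, of "low (t y) f"] integrable_low(2)[OF f] by (intro ennreal_leI) auto
    also have "\<dots> = ennreal (LINT x|N. 4 * (cmod (low (t y) f x))\<^sup>2)" by simp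
    also have "\<dots> = (\<integral>\<^sup>+x. ennreal (4 * (cmod (low (t y) f x))\<^sup>2) \<partial>N)"
      using integrable_low(2)[OF f, of "t y"] by (intro nn_integral_eq_integral[symmetric]) auto
    also have "\<dots> = G y" unfolding G_def by (intro nn_integral_cong) (auto simp: low_def indicator_def)
    finally show ?thesis using True by simp
  qed simp
  have "ennreal (\<Sum>i\<in>F. w i * a f i powr q) = (\<Sum>i\<in>F. ennreal (w i * a f i powr q))"
    using F w_nonneg by (subst sum_ennreal) auto
  \<comment> \<open>Layer cake for the exponent \<open>q - 2\<close> rather than \<open>q\<close>:
    the factor \<open>(a f i)\<^sup>2\<close> is retained so that the square-sum bound can be used
    at every threshold.\<close>
  also have "\<dots> = (\<Sum>i\<in>F. \<integral>\<^sup>+y. ennreal (q - 2) * (ennreal (y powr (q - 3)) * (ennreal (w i * (a f i)\<^sup>2) * indicator {0<..a f i} y)) \<partial>lborel)"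
  proof (rule sum.cong[OF refl])
    fix i assume "i \<in> F"
    then have i: "i \<in> I" using F by auto
    have "(\<integral>\<^sup>+y. ennreal (q - 2) * (ennreal (y powr (q - 3)) * (ennreal (w i * (a f i)\<^sup>2) * indicator {0<..a f i} y)) \<partial>lborel)
       = (\<integral>\<^sup>+y. (ennreal (q - 2) * ennreal (w i * (a f i)\<^sup>2)) * (ennreal (y powr ((q - 2) - 1)) * indicator {0<..a f i} y) \<partial>lborel)"
      by (intro nn_integral_cong) (simp add: mult_ac)
    also have "\<dots> = (ennreal (q - 2) * ennreal (w i * (a f i)\<^sup>2)) * ennreal (a f i powr (q - 2) / (q - 2))"
      using nn_integral_powr_Ioc[of "q - 2" "a f i"] q2 a_nonneg[OF i] by (subst nn_integral_cmult) auto
    also have "\<dots> = ennreal ((q - 2) * (w i * (a f i)\<^sup>2) * (a f i powr (q - 2) / (q - 2)))"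
      using q2 w_nonneg[OF i] by (intro ennreal_mult3) auto
    also have "(q - 2) * (w i * (a f i)\<^sup>2) * (a f i powr (q - 2) / (q - 2)) = w i * ((a f i)\<^sup>2 * a f i powr (q - 2))"
      using q2 by simp
    also have "(a f i)\<^sup>2 * a f i powr (q - 2) = a f i powr q"
      using a_nonneg[OF i, of f] by (cases "a f i = 0") (auto simp flip: powr_numeral powr_add)
    finally show "ennreal (w i * a f i powr q) = (\<integral>\<^sup>+y. ennreal (q - 2) * (ennreal (y powr (q - 3)) * (ennreal (w i * (a f i)\<^sup>2) * indicator {0<..a f i} y)) \<partial>lborel)" by simp
  qed
  also have "\<dots> = (\<integral>\<^sup>+y. (\<Sum>i\<in>F. ennreal (q - 2) * (ennreal (y powr (q - 3)) * (ennreal (w i * (a f i)\<^sup>2) * indicator {0<..a f i} y))) \<partial>lborel)"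
    by (rule nn_integral_sum[symmetric]) auto
  also have "\<dots> \<le> (\<integral>\<^sup>+y. ennreal (q - 2) * (ennreal (y powr (q - 3)) * (G y * indicator {0<..} y)) \<partial>lborel)"
    by (intro nn_integral_mono, simp only: sum_distrib_left[symmetric], intro mult_left_mono sumG) auto
  also have "\<dots> = (\<integral>\<^sup>+y. \<integral>\<^sup>+x. ennreal (q - 2) * ennreal (y powr (q - 3)) * indicator {0<..} y *
      (ennreal (4 * (cmod (f x))\<^sup>2) * indicator {x. cmod (f x) \<le> t y} x) \<partial>N \<partial>lborel)"
    unfolding G_def by (subst nn_integral_cmult) (auto simp: mult_ac)
  also have "\<dots> = (\<integral>\<^sup>+x. \<integral>\<^sup>+y. ennreal (q - 2) * ennreal (y powr (q - 3)) * indicator {0<..} y *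
      (ennreal (4 * (cmod (f x))\<^sup>2) * indicator {x. cmod (f x) \<le> t y} x) \<partial>lborel \<partial>N)"
  proof -
    interpret P: pair_sigma_finite N lborel ..
    have [measurable]: "t \<in> borel_measurable borel" unfolding t_def by measurable
    show ?thesis
      by (rule P.Fubini') (simp add: indicator_def, measurable)
  qed
  also have "\<dots> \<le> (\<integral>\<^sup>+x. ennreal (4 * (2 * A) powr (q - 2)) * ennreal (cmod (f x) powr p) \<partial>N)"
  proof (rule nn_integral_mono)
    fix x
    show "(\<integral>\<^sup>+y. ennreal (q - 2) * ennreal (y powr (q - 3)) * indicator {0<..} y *
      (ennreal (4 * (cmod (f x))\<^sup>2) * indicator {x. cmod (f x) \<le> t y} x) \<partial>lborel)
      \<le> ennreal (4 * (2 * A) powr (q - 2)) * ennreal (cmod (f x) powr p)"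
    proof (cases "f x = 0")
      case False
      define c where "c = cmod (f x)"
      have c: "c > 0" using False by (simp add: c_def)
      \<comment> \<open>Inverts the level function: for \<open>y > 0\<close>,
        \<open>c \<le> t y\<close> amounts to \<open>y \<le> z\<close>.\<close>
      define z where "z = 2 * A * c powr (1 - p)"
      have z: "z \<ge> 0" using A0 by (simp add: z_def)
      have yz: "y \<le> z" if "y > 0" "c \<le> t y" for y
      proof -
        have "c powr (p - 1) \<le> t y powr (p - 1)" using that c p by (intro powr_mono2) auto
        also have "\<dots> = 2 * A / y" using p A0 that by (simp add: t_def powr_powr)
        finally have "y * c powr (p - 1) \<le> 2 * A" using that by (simp add: field_simps)
        then have "y * c powr (p - 1) * c powr (1 - p) \<le> z" unfolding z_def by (rule mult_right_mono) simp
        then show ?thesis using c by (simp add: mult.assoc flip: powr_add)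
      qed
      have "(\<integral>\<^sup>+y. ennreal (q - 2) * ennreal (y powr (q - 3)) * indicator {0<..} y *
        (ennreal (4 * (cmod (f x))\<^sup>2) * indicator {x. cmod (f x) \<le> t y} x) \<partial>lborel)
        \<le> (\<integral>\<^sup>+y. (ennreal (q - 2) * ennreal (4 * c\<^sup>2)) * (ennreal (y powr ((q - 2) - 1)) * indicator {0<..z} y) \<partial>lborel)"
        using yz by (intro nn_integral_mono) (auto simp: indicator_def c_def mult_ac)
      also have "\<dots> = (ennreal (q - 2) * ennreal (4 * c\<^sup>2)) * ennreal (z powr (q - 2) / (q - 2))"
        using nn_integral_powr_Ioc[of "q - 2" z] q2 z by (subst nn_integral_cmult) auto
      also have "\<dots> = ennreal ((q - 2) * (4 * c\<^sup>2) * (z powr (q - 2) / (q - 2)))"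
        using q2 by (intro ennreal_mult3) auto
      also have "(q - 2) * (4 * c\<^sup>2) * (z powr (q - 2) / (q - 2)) = 4 * (c\<^sup>2 * z powr (q - 2))"
        using q2 by simp
      also have "z powr (q - 2) = (2 * A) powr (q - 2) * c powr (p - 2)"
      proof -
        have "(1 - p) * (q - 2) = p - 2" using qp by (simp add: algebra_simps)
        then show ?thesis using A0 c by (simp add: z_def powr_mult powr_powr)
      qed
      also have "4 * (c\<^sup>2 * ((2 * A) powr (q - 2) * c powr (p - 2))) = 4 * (2 * A) powr (q - 2) * (c powr 2 * c powr (p - 2))"
        using c by simp
      also have "c powr 2 * c powr (p - 2) = c powr p" by (simp flip: powr_add)
      finally show ?thesis by (simp add: c_def ennreal_mult)
    qed simp
  qed
  also have "\<dots> = ennreal (4 * (2 * A) powr (q - 2)) * ennreal A"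
    using nn_integral_eq_integral[OF fp] by (subst nn_integral_cmult) (auto simp: A_def)
  also have "\<dots> = ennreal (4 * (2 * A) powr (q - 2) * A)"
    using A0 by (simp add: ennreal_mult)
  also have "4 * (2 * A) powr (q - 2) * A = 4 * 2 powr (q - 2) * A powr (q - 1)"
  proof -
    have "A powr (q - 2) * A = A powr (q - 1)"
    proof -
      have "A powr (q - 2) * A powr 1 = A powr (q - 1)" unfolding powr_add[symmetric] by simp
      then show ?thesis using A0 by simp
    qed
    then show ?thesis using A0 by (simp add: powr_mult)
  qed
  finally show ?thesis by (subst (asm) ennreal_le_iff) auto
qed

text \<open>The square of \<open>\<phi> i\<close> is the integral of \<open>2 * y\<close> over the
  thresholds up to \<open>\<phi> i\<close>. At each threshold \<open>y \<le> v\<close> the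
  hypothesis bounds the sum over the indices by \<open>2 * M\<close>, and integration up to
  \<open>v\<close> makes this linear in \<open>v\<close>.\<close>

lemma weight_sum_bound:
  assumes F: "finite F" "F \<subseteq> I" and \<phi>: "\<And>i. i \<in> F \<Longrightarrow> \<phi> i > (0::real)"
    and M: "\<And>y. y > 0 \<Longrightarrow> y * (\<Sum>i\<in>{i\<in>F. \<phi> i \<ge> y}. w i) \<le> M" and v: "v \<ge> 0"
  shows "(\<Sum>i\<in>{i\<in>F. \<phi> i \<le> v}. w i * (\<phi> i)\<^sup>2) \<le> 2 * M * v"
proof -
  have M0: "M \<ge> 0"
  proof -
    have "0 \<le> (\<Sum>i\<in>{i\<in>F. \<phi> i \<ge> 1}. w i)" by (rule sum_nonneg) (use F w_nonneg in auto)
    then show ?thesis using M[of 1] by simp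
  qed
  have "ennreal (\<Sum>i\<in>{i\<in>F. \<phi> i \<le> v}. w i * (\<phi> i)\<^sup>2) = (\<Sum>i\<in>{i\<in>F. \<phi> i \<le> v}. ennreal (w i * (\<phi> i)\<^sup>2))"
    using F w_nonneg by (subst sum_ennreal) auto
  also have "\<dots> = (\<Sum>i\<in>{i\<in>F. \<phi> i \<le> v}. \<integral>\<^sup>+y. ennreal (2 * y * w i) * indicator {0<..\<phi> i} y \<partial>lborel)"
  proof (rule sum.cong[OF refl])
    fix i assume i: "i \<in> {i\<in>F. \<phi> i \<le> v}"
    then have wi: "w i \<ge> 0" "\<phi> i > 0" using F w_nonneg \<phi> by auto
    have "(\<integral>\<^sup>+y. ennreal (2 * y * w i) * indicator {0<..\<phi> i} y \<partial>lborel)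
      = (\<integral>\<^sup>+y. ennreal (2 * w i) * (ennreal (y powr (2 - 1)) * indicator {0<..\<phi> i} y) \<partial>lborel)"
      using wi by (intro nn_integral_cong) (auto simp: indicator_def ennreal_mult[symmetric] mult_ac)
    also have "\<dots> = ennreal (2 * w i) * ennreal (\<phi> i powr 2 / 2)"
      using nn_integral_powr_Ioc[of 2 "\<phi> i"] wi by (subst nn_integral_cmult) auto
    also have "\<dots> = ennreal (w i * (\<phi> i)\<^sup>2)"
      using wi by (simp add: ennreal_mult[symmetric])
    finally show "ennreal (w i * (\<phi> i)\<^sup>2) = (\<integral>\<^sup>+y. ennreal (2 * y * w i) * indicator {0<..\<phi> i} y \<partial>lborel)" by simp
  qed
  also have "\<dots> = (\<integral>\<^sup>+y. (\<Sum>i\<in>{i\<in>F. \<phi> i \<le> v}. ennreal (2 * y * w i) * indicator {0<..\<phi> i} y) \<partial>lborel)"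
    by (rule nn_integral_sum[symmetric]) auto
  also have "\<dots> \<le> (\<integral>\<^sup>+y. ennreal (2 * M) * indicator {0..v} y \<partial>lborel)"
  proof (rule nn_integral_mono)
    fix y :: real
    show "(\<Sum>i\<in>{i\<in>F. \<phi> i \<le> v}. ennreal (2 * y * w i) * indicator {0<..\<phi> i} y) \<le> ennreal (2 * M) * indicator {0..v} y"
    proof (cases "0 < y \<and> y \<le> v")
      case True
      have "(\<Sum>i\<in>{i\<in>F. \<phi> i \<le> v}. ennreal (2 * y * w i) * indicator {0<..\<phi> i} y)
        \<le> (\<Sum>i\<in>F. if \<phi> i \<ge> y then ennreal (2 * y * w i) else 0)"
        using F True by (intro order_trans[OF _ sum_mono2[of F "{i\<in>F. \<phi> i \<le> v}"]] sum_mono) (auto simp: indicator_def)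
      also have "\<dots> = (\<Sum>i\<in>{i\<in>F. \<phi> i \<ge> y}. ennreal (2 * y * w i))"
        using F by (simp add: sum.inter_filter)
      also have "\<dots> = ennreal (2 * (y * (\<Sum>i\<in>{i\<in>F. \<phi> i \<ge> y}. w i)))"
        using F w_nonneg True by (subst sum_ennreal) (auto simp: sum_distrib_left mult_ac intro!: mult_nonneg_nonneg)
      also have "\<dots> \<le> ennreal (2 * M)" using M[of y] True by (intro ennreal_leI) auto
      finally show ?thesis using True by simp
    next
      case False
      have "(\<Sum>i\<in>{i\<in>F. \<phi> i \<le> v}. ennreal (2 * y * w i) * indicator {0<..\<phi> i} y) = 0"
        using False by (intro sum.neutral) (auto simp: indicator_def)
      then show ?thesis by simp
    qed
  qed
  also have "\<dots> = ennreal (2 * M * v)"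
    using v M0 by (simp add: nn_integral_cmult ennreal_mult[symmetric])
  finally show ?thesis using M0 v by (subst (asm) ennreal_le_iff) auto
qed

text \<open>With \<open>u i = w i * (\<phi> i)\<^sup>2\<close> and
  \<open>r i = a f i / \<phi> i\<close> the left-hand side is the sum of
  \<open>u i * r i powr p\<close>, to which interpolation applies. Truncating \<open>f\<close> at
  the level \<open>M * y\<close> makes both parts scale alike, each with the factor
  \<open>M powr (2 - p)\<close>.\<close>

lemma paley:
  assumes p: "1 < p" "p < 2"
    and f [measurable]: "f \<in> borel_measurable N" and fp: "integrable N (\<lambda>x. cmod (f x) powr p)"
    and F: "finite F" "F \<subseteq> I" and \<phi>: "\<And>i. i \<in> F \<Longrightarrow> \<phi> i > (0::real)" and M0: "M > 0"
    and M: "\<And>y. y > 0 \<Longrightarrow> y * (\<Sum>i\<in>{i\<in>F. \<phi> i \<ge> y}. w i) \<le> M"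
  defines "A \<equiv> (LINT x|N. cmod (f x) powr p)"
  shows "(\<Sum>i\<in>F. w i * a f i powr p * \<phi> i powr (2 - p)) \<le> (4 * p / (p - 1) + 4 * p / (2 - p)) * M powr (2 - p) * A"
proof -
  have fi: "integrable N f" by (rule integrable_Lp[OF _ f fp]) (use p in simp)
  have A0: "A \<ge> 0" unfolding A_def by simp
  define r where "r = (\<lambda>i. a f i / \<phi> i)"
  have r0: "r i \<ge> 0" if "i \<in> F" for i
    using a_nonneg[of i f] \<phi>[OF that] that F by (auto simp: r_def intro!: divide_nonneg_pos)
  define u where "u = (\<lambda>i. w i * (\<phi> i)\<^sup>2)"
  have u0: "u i \<ge> 0" if "i \<in> F" for i using w_nonneg that F by (auto simp: u_def)
  \<comment> \<open>The first summand comes from \<open>weight_sum_bound\<close> for the high part,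
    the second from the square-sum bound for the low part.\<close>
  define G where "G = (\<lambda>y x. ennreal (4 * M / y * cmod (f x)) * indicator {x. cmod (f x) > M * y} x
      + ennreal (4 / y\<^sup>2 * (cmod (f x))\<^sup>2) * indicator {x. cmod (f x) \<le> M * y} x)"
  have sumG: "(\<Sum>i\<in>F. ennreal (u i) * indicator {0<..r i} y) \<le> (\<integral>\<^sup>+x. G y x \<partial>N) * indicator {0<..} y" for y
  proof (cases "y > 0")
    case y: True
    define f1 where "f1 = high (M * y) f"
    define f2 where "f2 = low (M * y) f"
    have f1i: "integrable N f1" unfolding f1_def by (rule integrable_high[OF f fi])
    have f2m: "f2 \<in> borel_measurable N" unfolding f2_def by measurable
    have f2i: "integrable N (\<lambda>x. (cmod (f2 x))\<^sup>2)" unfolding f2_def by (rule integrable_low(2)[OF f])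
    \<comment> \<open>If \<open>\<phi> i > v\<close>, the high part contributes at most
      \<open>y * \<phi> i / 2\<close>, half of what \<open>r i \<ge> y\<close> demands, and the low
      part must supply the rest. The indices with \<open>\<phi> i \<le> v\<close> are counted by
      \<open>weight_sum_bound\<close>.\<close>
    define v where "v = 2 * (LINT x|N. cmod (f1 x)) / y"
    have v0: "v \<ge> 0" using y by (simp add: v_def)
    have one: "ennreal (u i) * indicator {0<..r i} y
       \<le> ennreal (if \<phi> i \<le> v then u i else 0) + ennreal (4 / y\<^sup>2 * (w i * (a f2 i)\<^sup>2))" if i: "i \<in> F" for i
    proof (cases "y \<le> r i")
      case yr: True
      have iI: "i \<in> I" using i F by auto
      have yp: "y * \<phi> i \<le> a f i" using yr \<phi>[OF i] by (simp add: r_def field_simps)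
      show ?thesis
      proof (cases "\<phi> i \<le> v")
        case False
        have "a f1 i \<le> (LINT x|N. cmod (f1 x))" by (rule a_L1[OF iI f1i])
        also have "\<dots> = y * v / 2" using y by (simp add: v_def)
        also have "\<dots> \<le> y * \<phi> i / 2" using False y by simp
        finally have "y * \<phi> i / 2 \<le> a f2 i"
          using a_le_low_high[OF iI f fi, of "M * y"] yp unfolding f1_def f2_def by linarith
        then have "(y * \<phi> i / 2)\<^sup>2 \<le> (a f2 i)\<^sup>2" using y \<phi>[OF i] by (intro power_mono) auto
        then have "w i * (y * \<phi> i / 2)\<^sup>2 \<le> w i * (a f2 i)\<^sup>2" by (rule mult_left_mono) (rule w_nonneg[OF iI])
        then have "4 / y\<^sup>2 * (w i * (y * \<phi> i / 2)\<^sup>2) \<le> 4 / y\<^sup>2 * (w i * (a f2 i)\<^sup>2)" by (rule mult_left_mono) simp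
        moreover have "4 / y\<^sup>2 * (w i * (y * \<phi> i / 2)\<^sup>2) = u i" using y by (simp add: u_def power_mult_distrib power_divide)
        ultimately show ?thesis using False yr y by (auto intro!: ennreal_leI)
      qed (use yr y in simp)
    qed simp
    have "(\<Sum>i\<in>F. ennreal (u i) * indicator {0<..r i} y)
      \<le> (\<Sum>i\<in>F. ennreal (if \<phi> i \<le> v then u i else 0) + ennreal (4 / y\<^sup>2 * (w i * (a f2 i)\<^sup>2)))"
      by (rule sum_mono[OF one])
    also have "\<dots> = ennreal (\<Sum>i\<in>F. if \<phi> i \<le> v then u i else 0) + ennreal (4 / y\<^sup>2 * (\<Sum>i\<in>F. w i * (a f2 i)\<^sup>2))"
    proof -
      have "(\<Sum>i\<in>F. ennreal (if \<phi> i \<le> v then u i else 0)) = ennreal (\<Sum>i\<in>F. if \<phi> i \<le> v then u i else 0)"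
        using u0 by (intro sum_ennreal) auto
      moreover have "(\<Sum>i\<in>F. ennreal (4 / y\<^sup>2 * (w i * (a f2 i)\<^sup>2))) = ennreal (4 / y\<^sup>2 * (\<Sum>i\<in>F. w i * (a f2 i)\<^sup>2))"
        unfolding sum_distrib_left using w_nonneg F by (intro sum_ennreal mult_nonneg_nonneg) auto
      ultimately show ?thesis by (simp only: sum.distrib)
    qed
    also have "\<dots> \<le> ennreal (2 * M * v) + ennreal (4 / y\<^sup>2 * (LINT x|N. (cmod (f2 x))\<^sup>2))"
    proof (intro add_mono ennreal_leI mult_left_mono a_L2[OF F f2m f2i])
      show "(\<Sum>i\<in>F. if \<phi> i \<le> v then u i else 0) \<le> 2 * M * v"
        unfolding u_def using weight_sum_bound[OF F \<phi> M v0] F by (simp add: sum.inter_filter)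
    qed simp
    also have "ennreal (2 * M * v) = (\<integral>\<^sup>+x. ennreal (4 * M / y * cmod (f1 x)) \<partial>N)"
      using f1i M0 y by (subst nn_integral_eq_integral) (auto simp: v_def)
    also have "ennreal (4 / y\<^sup>2 * (LINT x|N. (cmod (f2 x))\<^sup>2)) = (\<integral>\<^sup>+x. ennreal (4 / y\<^sup>2 * (cmod (f2 x))\<^sup>2) \<partial>N)"
      using f2i by (subst nn_integral_eq_integral) auto
    also have "(\<integral>\<^sup>+x. ennreal (4 * M / y * cmod (f1 x)) \<partial>N) + (\<integral>\<^sup>+x. ennreal (4 / y\<^sup>2 * (cmod (f2 x))\<^sup>2) \<partial>N) = (\<integral>\<^sup>+x. G y x \<partial>N)"
    proof (subst nn_integral_add[symmetric])
      show "(\<integral>\<^sup>+x. ennreal (4 * M / y * cmod (f1 x)) + ennreal (4 / y\<^sup>2 * (cmod (f2 x))\<^sup>2) \<partial>N) = (\<integral>\<^sup>+x. G y x \<partial>N)"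
        by (intro nn_integral_cong) (auto simp: G_def f1_def f2_def low_def high_def indicator_def)
    qed (use f1i f2m in auto)
    finally show ?thesis using y by simp
  qed simp
  have "ennreal (\<Sum>i\<in>F. w i * a f i powr p * \<phi> i powr (2 - p)) = (\<Sum>i\<in>F. ennreal (w i * a f i powr p * \<phi> i powr (2 - p)))"
    using F w_nonneg by (subst sum_ennreal) auto
  also have "\<dots> = (\<Sum>i\<in>F. \<integral>\<^sup>+y. ennreal p * (ennreal (y powr (p - 1)) * (ennreal (u i) * indicator {0<..r i} y)) \<partial>lborel)"
  proof (rule sum.cong[OF refl])
    fix i assume i: "i \<in> F"
    have "(\<integral>\<^sup>+y. ennreal p * (ennreal (y powr (p - 1)) * (ennreal (u i) * indicator {0<..r i} y)) \<partial>lborel)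
       = (\<integral>\<^sup>+y. (ennreal p * ennreal (u i)) * (ennreal (y powr (p - 1)) * indicator {0<..r i} y) \<partial>lborel)"
      by (intro nn_integral_cong) (simp add: mult_ac)
    also have "\<dots> = (ennreal p * ennreal (u i)) * ennreal (r i powr p / p)"
      using nn_integral_powr_Ioc[of p "r i"] p r0[OF i] by (subst nn_integral_cmult) auto
    also have "\<dots> = ennreal (p * u i * (r i powr p / p))"
      using p u0[OF i] by (intro ennreal_mult3) auto
    also have "p * u i * (r i powr p / p) = w i * a f i powr p * \<phi> i powr (2 - p)"
    proof -
      have "r i powr p = a f i powr p * \<phi> i powr (- p)"
        using a_nonneg[of i f] i F \<phi>[OF i] by (auto simp: r_def powr_divide powr_minus_divide)
      moreover have "(\<phi> i)\<^sup>2 * \<phi> i powr (- p) = \<phi> i powr (2 - p)"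
        using \<phi>[OF i] by (simp flip: powr_numeral powr_add)
      ultimately show ?thesis using p by (simp add: u_def mult_ac)
    qed
    finally show "ennreal (w i * a f i powr p * \<phi> i powr (2 - p)) = (\<integral>\<^sup>+y. ennreal p * (ennreal (y powr (p - 1)) * (ennreal (u i) * indicator {0<..r i} y)) \<partial>lborel)" by simp
  qed
  also have "\<dots> = (\<integral>\<^sup>+y. (\<Sum>i\<in>F. ennreal p * (ennreal (y powr (p - 1)) * (ennreal (u i) * indicator {0<..r i} y))) \<partial>lborel)"
    by (rule nn_integral_sum[symmetric]) auto
  also have "\<dots> \<le> (\<integral>\<^sup>+y. ennreal p * (ennreal (y powr (p - 1)) * ((\<integral>\<^sup>+x. G y x \<partial>N) * indicator {0<..} y)) \<partial>lborel)"
    by (intro nn_integral_mono, simp only: sum_distrib_left[symmetric], intro mult_left_mono sumG) auto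
  also have "\<dots> = (\<integral>\<^sup>+y. \<integral>\<^sup>+x. ennreal p * ennreal (y powr (p - 1)) * indicator {0<..} y * G y x \<partial>N \<partial>lborel)"
    unfolding G_def by (subst nn_integral_cmult) (auto simp: mult_ac)
  also have "\<dots> = (\<integral>\<^sup>+x. \<integral>\<^sup>+y. ennreal p * ennreal (y powr (p - 1)) * indicator {0<..} y * G y x \<partial>lborel \<partial>N)"
  proof -
    interpret P: pair_sigma_finite N lborel ..
    show ?thesis
      by (rule P.Fubini') (simp add: indicator_def G_def, measurable)
  qed
  also have "\<dots> \<le> (\<integral>\<^sup>+x. ennreal ((4 * p / (p - 1) + 4 * p / (2 - p)) * M powr (2 - p)) * ennreal (cmod (f x) powr p) \<partial>N)"
  proof (rule nn_integral_mono)
    fix x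
    show "(\<integral>\<^sup>+y. ennreal p * ennreal (y powr (p - 1)) * indicator {0<..} y * G y x \<partial>lborel)
      \<le> ennreal ((4 * p / (p - 1) + 4 * p / (2 - p)) * M powr (2 - p)) * ennreal (cmod (f x) powr p)"
    proof (cases "f x = 0")
      case True
      then show ?thesis by (simp add: G_def)
    next
      case False
      define c where "c = cmod (f x)"
      have c: "c > 0" using False by (simp add: c_def)
      \<comment> \<open>The threshold at which the level \<open>M * y\<close> reaches
        \<open>cmod (f x)\<close> and the point passes from the high to the low part.\<close>
      define z where "z = c / M"
      have z: "z > 0" using M0 c by (simp add: z_def)
      \<comment> \<open>The first integral on the right converges at 0 because \<open>p > 1\<close>,
        the second at infinity because \<open>p < 2\<close>; this is the origin of the denominators
        \<open>p - 1\<close> and \<open>2 - p\<close>.\<close>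
      have "(\<integral>\<^sup>+y. ennreal p * ennreal (y powr (p - 1)) * indicator {0<..} y * G y x \<partial>lborel)
        \<le> (\<integral>\<^sup>+y. ennreal (4 * p * M * c) * (ennreal (y powr ((p - 1) - 1)) * indicator {0<..z} y)
            + ennreal (4 * p * c\<^sup>2) * (ennreal (y powr ((p - 2) - 1)) * indicator {z..} y) \<partial>lborel)"
      proof (rule nn_integral_mono)
        fix y :: real
        show "ennreal p * ennreal (y powr (p - 1)) * indicator {0<..} y * G y x
          \<le> ennreal (4 * p * M * c) * (ennreal (y powr ((p - 1) - 1)) * indicator {0<..z} y)
            + ennreal (4 * p * c\<^sup>2) * (ennreal (y powr ((p - 2) - 1)) * indicator {z..} y)"
        proof (cases "y > 0")
          case y: True
          have e1: "p * y powr (p - 1) * (4 * M / y * c) = 4 * p * M * c * y powr ((p - 1) - 1)"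
            using y powr_diff[of y "p - 1" 1] by simp
          have e2: "p * y powr (p - 1) * (4 / y\<^sup>2 * c\<^sup>2) = 4 * p * c\<^sup>2 * y powr ((p - 2) - 1)"
            using y powr_diff[of y "p - 1" 2] by simp
          show ?thesis
          proof (cases "c \<le> M * y")
            case True
            then have "z \<le> y" using M0 by (simp add: z_def field_simps)
            have "ennreal p * ennreal (y powr (p - 1)) * indicator {0<..} y * G y x = ennreal (p * y powr (p - 1) * (4 / y\<^sup>2 * c\<^sup>2))"
              using True y p by (simp add: G_def c_def[symmetric] ennreal_mult[symmetric])
            also have "\<dots> = ennreal (4 * p * c\<^sup>2) * (ennreal (y powr ((p - 2) - 1)) * indicator {z..} y)"
              unfolding e2 using \<open>z \<le> y\<close> p by (simp add: ennreal_mult)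
            finally show ?thesis by simp
          next
            case False
            then have "y \<le> z" using M0 by (simp add: z_def field_simps)
            have "ennreal p * ennreal (y powr (p - 1)) * indicator {0<..} y * G y x = ennreal (p * y powr (p - 1) * (4 * M / y * c))"
              using False y p M0 c by (simp add: G_def c_def[symmetric] ennreal_mult[symmetric])
            also have "\<dots> = ennreal (4 * p * M * c) * (ennreal (y powr ((p - 1) - 1)) * indicator {0<..z} y)"
              unfolding e1 using \<open>y \<le> z\<close> y p M0 c by (simp add: ennreal_mult)
            finally show ?thesis by simp
          qed
        qed simp
      qed
      also have "\<dots> = ennreal (4 * p * M * c) * ennreal (z powr (p - 1) / (p - 1)) + ennreal (4 * p * c\<^sup>2) * ennreal (z powr (p - 2) / (- (p - 2)))"
        using nn_integral_powr_Ioc[of "p - 1" z] nn_integral_powr_Ici[of "p - 2" z] p z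
        by (subst nn_integral_add) (auto simp: nn_integral_cmult)
      also have "\<dots> = ennreal (4 * p * M * c * (z powr (p - 1) / (p - 1)) + 4 * p * c\<^sup>2 * (z powr (p - 2) / (2 - p)))"
      proof -
        have "ennreal (4 * p * M * c) * ennreal (z powr (p - 1) / (p - 1)) = ennreal (4 * p * M * c * (z powr (p - 1) / (p - 1)))"
          by (rule ennreal_mult[symmetric]) (use p M0 c in auto)
        moreover have "ennreal (4 * p * c\<^sup>2) * ennreal (z powr (p - 2) / (- (p - 2))) = ennreal (4 * p * c\<^sup>2 * (z powr (p - 2) / (2 - p)))"
          unfolding minus_diff_eq by (rule ennreal_mult[symmetric]) (use p M0 c in auto)
        ultimately show ?thesis
          using p M0 c by (simp only:) (subst ennreal_plus, auto)
      qed
      also have "4 * p * M * c * (z powr (p - 1) / (p - 1)) + 4 * p * c\<^sup>2 * (z powr (p - 2) / (2 - p))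
         = (4 * p / (p - 1) + 4 * p / (2 - p)) * M powr (2 - p) * c powr p"
      proof -
        have zq: "z powr r = c powr r * M powr (- r)" for r
          using M0 c by (simp add: z_def powr_divide powr_minus_divide)
        have "M * c * z powr (p - 1) = M powr (2 - p) * c powr p"
        proof -
          have "M * c * z powr (p - 1) = (M powr 1 * M powr (- (p - 1))) * (c powr 1 * c powr (p - 1))"
            unfolding zq using M0 c by (simp add: mult_ac)
          then show ?thesis unfolding powr_add[symmetric] by simp
        qed
        moreover have "c\<^sup>2 * z powr (p - 2) = M powr (2 - p) * c powr p"
        proof -
          have "c\<^sup>2 * z powr (p - 2) = M powr (- (p - 2)) * (c powr 2 * c powr (p - 2))"
            unfolding zq using M0 c by (simp add: mult_ac)
          then show ?thesis unfolding powr_add[symmetric] by simp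
        qed
        ultimately have "4 * p / (p - 1) * (M * c * z powr (p - 1)) + 4 * p / (2 - p) * (c\<^sup>2 * z powr (p - 2))
          = (4 * p / (p - 1) + 4 * p / (2 - p)) * (M powr (2 - p) * c powr p)" by (simp add: distrib_right)
        then show ?thesis by (simp add: mult_ac)
      qed
      finally show ?thesis using p by (simp add: c_def ennreal_mult)
    qed
  qed
  also have "\<dots> = ennreal ((4 * p / (p - 1) + 4 * p / (2 - p)) * M powr (2 - p)) * ennreal A"
    using nn_integral_eq_integral[OF fp] by (subst nn_integral_cmult) (auto simp: A_def)
  also have "\<dots> = ennreal ((4 * p / (p - 1) + 4 * p / (2 - p)) * M powr (2 - p) * A)"
    using A0 p by (simp add: ennreal_mult)
  finally show ?thesis using A0 p by (subst (asm) ennreal_le_iff) auto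
qed

text \<open>Hoelder's inequality, from Young's inequality for the normalised terms
  \<open>x i / X\<close> and \<open>y i / Y\<close>. The alternative \<open>z i = 0\<close> keeps
  zero terms apart, Young's inequality being applied to positive numbers.\<close>

lemma interpolation_sum:
  fixes X Y s :: real
  assumes s: "0 \<le> s" "s \<le> 1" and XY: "X > 0" "Y > 0"
    and x: "(\<Sum>i\<in>F. x i) \<le> X" and y: "(\<Sum>i\<in>F. y i) \<le> Y"
    and z: "\<And>i. i \<in> F \<Longrightarrow> x i \<ge> 0 \<and> y i \<ge> 0 \<and> (z i = 0 \<or> x i > 0 \<and> y i > 0 \<and> z i = x i powr s * y i powr (1 - s))"
  shows "(\<Sum>i\<in>F. z i) \<le> X powr s * Y powr (1 - s)"
proof -
  have t: "z i \<le> X powr s * Y powr (1 - s) * (s * (x i / X) + (1 - s) * (y i / Y))" if i: "i \<in> F" for i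
  proof (cases "z i = 0")
    case True
    then show ?thesis using s XY z[OF i] by simp
  next
    case False
    then have p: "x i > 0" "y i > 0" "z i = x i powr s * y i powr (1 - s)" using z[OF i] by auto
    have "(x i / X) powr s * (y i / Y) powr (1 - s) \<le> s * (x i / X) + (1 - s) * (y i / Y)"
      by (rule Youngs_inequality_0) (use s XY p in auto)
    then have "X powr s * Y powr (1 - s) * ((x i / X) powr s * (y i / Y) powr (1 - s))
      \<le> X powr s * Y powr (1 - s) * (s * (x i / X) + (1 - s) * (y i / Y))"
      by (rule mult_left_mono) simp
    moreover have "X powr s * Y powr (1 - s) * ((x i / X) powr s * (y i / Y) powr (1 - s)) = z i"
      using XY p by (simp add: powr_divide)
    ultimately show ?thesis by simp
  qed
  have "(\<Sum>i\<in>F. z i) \<le> (\<Sum>i\<in>F. X powr s * Y powr (1 - s) * (s * (x i / X) + (1 - s) * (y i / Y)))"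
    by (rule sum_mono[OF t])
  also have "\<dots> = X powr s * Y powr (1 - s) * (s * ((\<Sum>i\<in>F. x i) / X) + (1 - s) * ((\<Sum>i\<in>F. y i) / Y))"
    by (simp only: sum_divide_distrib sum_distrib_left sum.distrib distrib_left)
  also have "\<dots> \<le> X powr s * Y powr (1 - s) * (s * 1 + (1 - s) * 1)"
    using s x y XY by (intro mult_left_mono add_mono) auto
  finally show ?thesis by simp
qed

lemma paley_hausdorff_young:
  assumes p: "1 < p" and b: "p \<le> b" "b \<le> q" and q: "1 / p + 1 / q = 1"
  shows "\<exists>C>0. \<forall>F \<phi> M f. finite F \<longrightarrow> F \<subseteq> I \<longrightarrow> (\<forall>i\<in>F. \<phi> i > 0) \<longrightarrow> M > 0 \<longrightarrow>
    (\<forall>y>0. y * (\<Sum>i\<in>{i\<in>F. \<phi> i \<ge> y}. w i) \<le> M) \<longrightarrow>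
    f \<in> borel_measurable N \<longrightarrow> integrable N (\<lambda>x. cmod (f x) powr p) \<longrightarrow>
    (\<Sum>i\<in>F. w i * (a f i * \<phi> i powr (1 / b - 1 / q)) powr b)
      \<le> (C * M powr (1 / b - 1 / q) * (LINT x|N. cmod (f x) powr p) powr (1 / p)) powr b"
proof (cases "p = 2")
  \<comment> \<open>The endpoints coincide: \<open>b\<close> and \<open>q\<close> are 2, the
    exponent \<open>1 / b - 1 / q\<close> is 0, and the square-sum bound gives the constant
    1.\<close>
  case True
  then have b2: "b = 2" "q = 2" using q b by (auto simp: field_simps)
  have "(\<Sum>i\<in>F. w i * (a f i * \<phi> i powr (1 / b - 1 / q)) powr b)
      \<le> (1 * M powr (1 / b - 1 / q) * (LINT x|N. cmod (f x) powr p) powr (1 / p)) powr b"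
    if F: "finite F" "F \<subseteq> I" and "\<forall>i\<in>F. \<phi> i > 0" "M > 0" "f \<in> borel_measurable N"
      "integrable N (\<lambda>x. cmod (f x) powr p)" for F \<phi> M f
  proof -
    have "(\<Sum>i\<in>F. w i * (a f i * \<phi> i powr (1 / b - 1 / q)) powr b) = (\<Sum>i\<in>F. w i * (a f i)\<^sup>2)"
    proof (rule sum.cong[OF refl])
      fix i assume "i \<in> F"
      then have "a f i \<ge> 0" "\<phi> i > 0" using that a_nonneg by auto
      then show "w i * (a f i * \<phi> i powr (1 / b - 1 / q)) powr b = w i * (a f i)\<^sup>2" by (simp add: b2)
    qed
    also have "\<dots> \<le> (LINT x|N. (cmod (f x))\<^sup>2)"
      by (rule a_L2[OF F]) (use that in \<open>auto simp: True\<close>)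
    also have "\<dots> = ((LINT x|N. cmod (f x) powr p) powr (1 / p)) powr b"
      by (simp add: True b2 powr_powr)
    finally show ?thesis using that by (simp add: b2)
  qed
  then show ?thesis by (intro exI[of _ 1]) auto
next
  case False
  have p2: "p < 2"
  proof (rule ccontr)
    assume "\<not> p < 2"
    then have "p > 2" "q > 2" using False b by auto
    then have "1 / p < 1 / 2" "1 / q < 1 / 2" by (auto simp: field_simps)
    then show False using q by simp
  qed
  have q0: "q = p / (p - 1)"
  proof -
    have "q \<noteq> 0" using p b by auto
    then show ?thesis using q p by (simp add: field_simps)
  qed
  have q2: "q > 2" using p p2 unfolding q0 by (simp add: field_simps)
  \<comment> \<open>Determined by \<open>b = p * s + q * (1 - s)\<close>: the value 1 is the Paley
    endpoint \<open>b = p\<close>, the value 0 the Hausdorff-Young endpoint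
    \<open>b = q\<close>.\<close>
  define s where "s = (q - b) / (q - p)"
  have s01: "0 \<le> s" "s \<le> 1" using b p2 q2 by (auto simp: s_def field_simps)
  have e1: "p * s + q * (1 - s) = b"
  proof -
    have "s * (q - p) = q - b" using p2 q2 by (simp add: s_def)
    then show ?thesis by (simp add: algebra_simps)
  qed
  have qq: "q * (p - 1) = p" using p unfolding q0 by simp
  \<comment> \<open>The common exponent of \<open>\<phi>\<close> and \<open>M\<close> after
    interpolation, which equals \<open>(1 / b - 1 / q) * b\<close>.\<close>
  have e2: "(2 - p) * s = 1 - b / q"
  proof -
    have "q * (2 - p) = q - p" using qq by (simp add: algebra_simps)
    then have "q * ((2 - p) * s) = (q - p) * s" by (metis mult.assoc)
    also have "\<dots> = q - b" using p2 q2 by (simp add: s_def)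
    finally show ?thesis using q2 by (simp add: field_simps)
  qed
  \<comment> \<open>The exponent of \<open>A\<close> after interpolation, as required for the
    \<open>b\<close>-th power of the norm \<open>A powr (1 / p)\<close>.\<close>
  have e3: "s + (q - 1) * (1 - s) = b / p"
  proof -
    have "p * (q - 1) = q" using qq by (simp add: algebra_simps)
    then have "p * (s + (q - 1) * (1 - s)) = p * s + q * (1 - s)" by (metis distrib_left mult.assoc)
    then show ?thesis using e1 p by (simp add: field_simps)
  qed
  have b0: "b > 0" using p b by simp
  define C1 where "C1 = 4 * p / (p - 1) + 4 * p / (2 - p)"
  define C2 where "C2 = 4 * (2::real) powr (q - 2)"
  have C12: "C1 > 0" "C2 > 0" using p p2 by (auto simp: C1_def C2_def intro!: add_pos_pos divide_pos_pos)
  define C where "C = (C1 powr s * C2 powr (1 - s)) powr (1 / b)"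
  have C: "C > 0" using C12 by (simp add: C_def)
  have "(\<Sum>i\<in>F. w i * (a f i * \<phi> i powr (1 / b - 1 / q)) powr b)
      \<le> (C * M powr (1 / b - 1 / q) * (LINT x|N. cmod (f x) powr p) powr (1 / p)) powr b"
    if F: "finite F" "F \<subseteq> I" and \<phi>: "\<forall>i\<in>F. \<phi> i > 0" and M: "M > 0"
      "\<forall>y>0. y * (\<Sum>i\<in>{i\<in>F. \<phi> i \<ge> y}. w i) \<le> M"
      and f: "f \<in> borel_measurable N" "integrable N (\<lambda>x. cmod (f x) powr p)" for F \<phi> M f
  proof -
    define A where "A = (LINT x|N. cmod (f x) powr p)"
    have A0: "A \<ge> 0" by (simp add: A_def)
    have fi: "integrable N f" by (rule integrable_Lp[OF _ f]) (use p in simp)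
    show ?thesis
    proof (cases "A = 0")
      \<comment> \<open>\<open>interpolation_sum\<close> asks for positive bounds, so functions
        vanishing almost everywhere are treated apart.\<close>
      case True
      have "AE x in N. cmod (f x) powr p = 0"
        using True integral_nonneg_eq_0_iff_AE[OF f(2)] unfolding A_def by simp
      then have "AE x in N. cmod (f x) = 0" by (auto elim!: eventually_mono)
      then have "(LINT x|N. cmod (f x)) = 0" by (rule integral_eq_zero_AE)
      then have "a f i = 0" if "i \<in> F" for i
        using a_L1[OF _ fi, of i] a_nonneg[of i f] that F by force
      then have "(\<Sum>i\<in>F. w i * (a f i * \<phi> i powr (1 / b - 1 / q)) powr b) = 0" by simp
      then show ?thesis by simp
    next
      case False
      then have Ap: "A > 0" using A0 by simp
      define X where "X = C1 * M powr (2 - p) * A"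
      define Y where "Y = C2 * A powr (q - 1)"
      have XY: "X > 0" "Y > 0" using C12 M Ap by (auto simp: X_def Y_def)
      have sb: "0 \<le> s" "s \<le> 1" by (rule s01)+
      have "(\<Sum>i\<in>F. w i * (a f i * \<phi> i powr (1 / b - 1 / q)) powr b) \<le> X powr s * Y powr (1 - s)"
      proof (rule interpolation_sum[OF sb XY])
        show "(\<Sum>i\<in>F. w i * a f i powr p * \<phi> i powr (2 - p)) \<le> X"
          unfolding X_def C1_def A_def by (rule paley[OF p p2 f F]) (use \<phi> M in auto)
        show "(\<Sum>i\<in>F. w i * a f i powr q) \<le> Y"
          unfolding Y_def C2_def A_def by (rule hausdorff_young[OF p p2 q f F])
        fix i assume i: "i \<in> F"
        have wi: "w i \<ge> 0" and ai: "a f i \<ge> 0" and \<phi>i: "\<phi> i > 0" using i F w_nonneg a_nonneg \<phi> by auto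
        have "w i * (a f i * \<phi> i powr (1 / b - 1 / q)) powr b
          = (w i * a f i powr p * \<phi> i powr (2 - p)) powr s * (w i * a f i powr q) powr (1 - s)"
          if pos: "w i > 0" "a f i > 0"
        proof -
          have "(w i * a f i powr p * \<phi> i powr (2 - p)) powr s * (w i * a f i powr q) powr (1 - s)
            = (w i powr s * w i powr (1 - s)) * (a f i powr (p * s) * a f i powr (q * (1 - s))) * \<phi> i powr ((2 - p) * s)"
            using pos \<phi>i by (simp add: powr_mult powr_powr)
          also have "\<dots> = w i * a f i powr b * \<phi> i powr (1 - b / q)"
            unfolding powr_add[symmetric] e1 e2 using pos by simp
          also have "1 - b / q = (1 / b - 1 / q) * b" using b0 by (simp add: left_diff_distrib)
          finally show ?thesis using pos \<phi>i by (simp add: powr_mult powr_powr)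
        qed
        then show "w i * a f i powr p * \<phi> i powr (2 - p) \<ge> 0 \<and> w i * a f i powr q \<ge> 0 \<and>
          (w i * (a f i * \<phi> i powr (1 / b - 1 / q)) powr b = 0 \<or>
           w i * a f i powr p * \<phi> i powr (2 - p) > 0 \<and> w i * a f i powr q > 0 \<and>
           w i * (a f i * \<phi> i powr (1 / b - 1 / q)) powr b
            = (w i * a f i powr p * \<phi> i powr (2 - p)) powr s * (w i * a f i powr q) powr (1 - s))"
          using wi ai \<phi>i by (cases "w i = 0 \<or> a f i = 0") auto
      qed
      also have "X powr s * Y powr (1 - s) = (C1 powr s * C2 powr (1 - s)) * M powr ((2 - p) * s) * (A powr s * A powr ((q - 1) * (1 - s)))"
        using C12 M Ap by (simp add: X_def Y_def powr_mult powr_powr)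
      also have "\<dots> = (C1 powr s * C2 powr (1 - s)) * M powr (1 - b / q) * A powr (b / p)"
        unfolding powr_add[symmetric] e2 e3 ..
      also have "\<dots> = (C * M powr (1 / b - 1 / q) * A powr (1 / p)) powr b"
      proof -
        have "1 - b / q = (1 / b - 1 / q) * b" using b0 by (simp add: left_diff_distrib)
        then show ?thesis using C12 M Ap b0 by (simp add: C_def powr_mult powr_powr)
      qed
      finally show ?thesis by (simp add: A_def)
    qed
  qed
  then show ?thesis using C by blast
qed

end

section \<open>The Fourier transform\<close>

context haar_hypergroup
begin

lemma integrable_mult_continuous:
  assumes f: "integrable haar f" and g: "continuous_on UNIV (g :: 'a \<Rightarrow> complex)"
  shows "integrable haar (\<lambda>x. f x * g x)"
proof -
  obtain B where B: "B > 0" "\<And>x. cmod (g x) \<le> B" using compact_bounded_range[OF compact_space g] by blast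
  have [measurable]: "g \<in> borel_measurable haar"
    using borel_measurable_continuous_onI[OF g] by (simp cong: measurable_cong_sets)
  note [measurable] = borel_measurable_integrable[OF f]
  show ?thesis
  proof (rule Bochner_Integration.integrable_bound)
    show "integrable haar (\<lambda>x. B * cmod (f x))" using f by auto
    show "AE x in haar. norm (f x * g x) \<le> norm (B * cmod (f x))"
      using mult_right_mono[OF B(2) norm_ge_zero, of _ "f _"] B(1) by (intro AE_I2) (simp add: norm_mult mult.commute)
  qed measurable
qed

text \<open>Expands the nonnegative integral of the squared modulus of \<open>f - P\<close>, where
  \<open>P\<close> is the orthogonal projection of \<open>f\<close> to the span of the
  \<open>u s\<close>. The number \<open>\<kappa> s\<close> is the reciprocal of the squared norm of
  \<open>u s\<close>.\<close>

lemma bessel: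
  fixes u :: "'i \<Rightarrow> 'a \<Rightarrow> complex" and \<kappa> :: "'i \<Rightarrow> real"
  assumes S: "finite S" and u: "\<And>s. s \<in> S \<Longrightarrow> continuous_on UNIV (u s)"
    and \<kappa>: "\<And>s. s \<in> S \<Longrightarrow> \<kappa> s > 0"
    and orth: "\<And>s t. s \<in> S \<Longrightarrow> t \<in> S \<Longrightarrow> (LINT x|haar. u s x * cnj (u t x)) = (if s = t then complex_of_real (1 / \<kappa> s) else 0)"
    and f: "f \<in> borel_measurable haar" "integrable haar (\<lambda>x. (cmod (f x))\<^sup>2)"
  shows "(\<Sum>s\<in>S. \<kappa> s * (cmod (LINT x|haar. f x * cnj (u s x)))\<^sup>2) \<le> (LINT x|haar. (cmod (f x))\<^sup>2)"
proof -
  interpret prob_space haar by (rule prob_space_haar)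
  have fi: "integrable haar f"
  proof (rule Bochner_Integration.integrable_bound[OF _ f(1)])
    show "integrable haar (\<lambda>x. 1 + (cmod (f x))\<^sup>2)" using f(2) by simp
    have "cmod (f x) \<le> 1 + (cmod (f x))\<^sup>2" for x
      using sum_power2_ge_zero[of "cmod (f x) - 1" 0] by (simp add: power2_eq_square algebra_simps)
        (smt (verit) norm_ge_zero)
    then show "AE x in haar. norm (f x) \<le> norm (1 + (cmod (f x))\<^sup>2)" by (intro AE_I2) (simp add: add_nonneg_nonneg)
  qed
  define c where "c = (\<lambda>s. LINT x|haar. f x * cnj (u s x))"
  define P where "P = (\<lambda>x. \<Sum>s\<in>S. \<kappa> s * c s * u s x)"
  define B where "B = (\<Sum>s\<in>S. \<kappa> s * (cmod (c s))\<^sup>2)"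
  have P: "continuous_on UNIV P" unfolding P_def by (intro continuous_intros u)
  have cP: "continuous_on UNIV (\<lambda>x. cnj (P x))" by (intro continuous_on_cnj P)
  have fP: "integrable haar (\<lambda>x. f x * cnj (P x))" by (rule integrable_mult_continuous[OF fi cP])
  have fu: "integrable haar (\<lambda>x. f x * cnj (u s x))" if "s \<in> S" for s
    by (rule integrable_mult_continuous[OF fi continuous_on_cnj[OF u[OF that]]])
  have PP: "integrable haar (\<lambda>x. P x * cnj (P x))" by (intro integrable_haar continuous_intros P cP)
  have I1: "(LINT x|haar. f x * cnj (P x)) = complex_of_real B"
  proof -
    have "(LINT x|haar. f x * cnj (P x)) = (LINT x|haar. (\<Sum>s\<in>S. (\<kappa> s * cnj (c s)) * (f x * cnj (u s x))))"
      by (simp add: P_def sum_distrib_left mult_ac)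
    also have "\<dots> = (\<Sum>s\<in>S. LINT x|haar. (\<kappa> s * cnj (c s)) * (f x * cnj (u s x)))"
      by (rule Bochner_Integration.integral_sum) (intro integrable_mult_right fu)
    also have "\<dots> = (\<Sum>s\<in>S. \<kappa> s * (c s * cnj (c s)))"
      unfolding integral_mult_right_zero by (simp add: c_def mult_ac)
    also have "\<dots> = complex_of_real B"
      unfolding B_def of_real_sum of_real_mult complex_norm_square ..
    finally show ?thesis .
  qed
  have I2: "(LINT x|haar. P x * cnj (P x)) = complex_of_real B"
  proof -
    have i: "integrable haar (\<lambda>x. u s x * cnj (P x))" if "s \<in> S" for s
      by (intro integrable_haar continuous_intros u cP that)
    have us: "(LINT x|haar. u s x * cnj (P x)) = cnj (c s)" if s: "s \<in> S" for s
    proof -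
      have "(LINT x|haar. u s x * cnj (P x)) = (LINT x|haar. (\<Sum>t\<in>S. (\<kappa> t * cnj (c t)) * (u s x * cnj (u t x))))"
        by (simp add: P_def sum_distrib_left mult_ac)
      also have "\<dots> = (\<Sum>t\<in>S. LINT x|haar. (\<kappa> t * cnj (c t)) * (u s x * cnj (u t x)))"
        by (rule Bochner_Integration.integral_sum)
          (intro integrable_mult_right integrable_haar continuous_intros continuous_on_cnj u s)
      also have "\<dots> = (\<Sum>t\<in>S. if t = s then cnj (c s) else 0)"
      proof (rule sum.cong[OF refl])
        fix t assume t: "t \<in> S"
        then show "(LINT x|haar. (\<kappa> t * cnj (c t)) * (u s x * cnj (u t x))) = (if t = s then cnj (c s) else 0)"
          using orth[OF s t] \<kappa>[OF s] by (cases "t = s") auto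
      qed
      finally show ?thesis using S s by simp
    qed
    have "(LINT x|haar. P x * cnj (P x)) = (LINT x|haar. (\<Sum>s\<in>S. (\<kappa> s * c s) * (u s x * cnj (P x))))"
      by (subst P_def) (simp only: sum_distrib_right mult.assoc)
    also have "\<dots> = (\<Sum>s\<in>S. LINT x|haar. (\<kappa> s * c s) * (u s x * cnj (P x)))"
      by (rule Bochner_Integration.integral_sum) (intro integrable_mult_right i)
    also have "\<dots> = (\<Sum>s\<in>S. \<kappa> s * (c s * cnj (c s)))"
      unfolding integral_mult_right_zero by (simp add: us mult.assoc)
    also have "\<dots> = complex_of_real B"
      unfolding B_def of_real_sum of_real_mult complex_norm_square ..
    finally show ?thesis .
  qed
  have e: "(cmod (f x - P x))\<^sup>2 = (cmod (f x))\<^sup>2 - 2 * Re (f x * cnj (P x)) + Re (P x * cnj (P x))" for x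
    unfolding cmod_power2 by (simp add: power2_eq_square algebra_simps)
  have "0 \<le> (LINT x|haar. (cmod (f x - P x))\<^sup>2)" by simp
  also have "\<dots> = (LINT x|haar. (cmod (f x))\<^sup>2) - 2 * Re (LINT x|haar. f x * cnj (P x)) + Re (LINT x|haar. P x * cnj (P x))"
    unfolding e using f(2) integrable_Re[OF fP] integrable_Re[OF PP] fP PP
    by (simp only: Bochner_Integration.integral_add Bochner_Integration.integral_diff
        Bochner_Integration.integrable_diff integrable_mult_right integral_mult_right_zero integral_Re)
  also have "\<dots> = (LINT x|haar. (cmod (f x))\<^sup>2) - B" unfolding I1 I2 by simp
  finally show ?thesis by (simp add: B_def c_def)
qed

definition coefficient :: "('a \<Rightarrow> complex) \<Rightarrow> 'a hg_rep set \<Rightarrow> nat \<times> nat \<Rightarrow> complex" where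
  "coefficient f \<pi> = (\<lambda>(i, j). LINT x|haar. f x * cnj (rep_coeff \<pi> i j x))"

lemma hs_norm_fourier:
  "hs_norm (fourier haar f \<pi>) = L2_set (\<lambda>s. cmod (coefficient f \<pi> s)) ({..<rep_dim \<pi>} \<times> {..<rep_dim \<pi>})"
  unfolding hs_norm_def L2_set_def sum.cartesian_product[symmetric]
  by (simp add: fourier_def coefficient_def sum.cartesian_product case_prod_unfold)

lemma coeff_cnj_continuous:
  "\<pi> \<in> hg_dual \<Longrightarrow> i < rep_dim \<pi> \<Longrightarrow> j < rep_dim \<pi> \<Longrightarrow> continuous_on UNIV (\<lambda>x. cnj (rep_coeff \<pi> i j x))"
  by (intro continuous_on_cnj coeff_continuous)

lemma hs_norm_fourier_add:
  assumes \<pi>: "\<pi> \<in> hg_dual" and f: "integrable haar f" and g: "integrable haar g"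
  shows "hs_norm (fourier haar (\<lambda>x. f x + g x) \<pi>) \<le> hs_norm (fourier haar f \<pi>) + hs_norm (fourier haar g \<pi>)"
proof -
  define S where "S = {..<rep_dim \<pi>} \<times> {..<rep_dim \<pi>}"
  have "coefficient (\<lambda>x. f x + g x) \<pi> s = coefficient f \<pi> s + coefficient g \<pi> s" if sS: "s \<in> S" for s
  proof -
    obtain i j where s: "s = (i, j)" "i < rep_dim \<pi>" "j < rep_dim \<pi>" using sS by (auto simp: S_def)
    show ?thesis
      using integrable_mult_continuous[OF f coeff_cnj_continuous[OF \<pi> s(2,3)]]
        integrable_mult_continuous[OF g coeff_cnj_continuous[OF \<pi> s(2,3)]]
      by (simp add: s coefficient_def distrib_right)
  qed
  then have "L2_set (\<lambda>s. cmod (coefficient (\<lambda>x. f x + g x) \<pi> s)) S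
     \<le> L2_set (\<lambda>s. cmod (coefficient f \<pi> s) + cmod (coefficient g \<pi> s)) S"
    by (intro L2_set_mono) (auto intro: norm_triangle_ineq)
  also have "\<dots> \<le> L2_set (\<lambda>s. cmod (coefficient f \<pi> s)) S + L2_set (\<lambda>s. cmod (coefficient g \<pi> s)) S"
    by (rule L2_set_triangle_ineq)
  finally show ?thesis by (simp add: hs_norm_fourier S_def)
qed

text \<open>Duality: the squared norm \<open>X * X\<close> is the integral of \<open>f\<close>
  against a combination of coefficients with the entries of the transform itself as weights.
  Pointwise Cauchy-Schwarz and \<open>coeff_hs_le\<close> bound this by \<open>X * sqrt d\<close>
  times the integral of the modulus, and one factor \<open>X\<close> cancels.\<close>

lemma hs_norm_fourier_L1:
  assumes \<pi>: "\<pi> \<in> hg_dual" and f: "integrable haar f"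
  shows "hs_norm (fourier haar f \<pi>) \<le> sqrt (hyperdim conv chk e haar \<pi>) * (LINT x|haar. cmod (f x))"
proof -
  define d where "d = rep_dim \<pi>"
  define S where "S = {..<d} \<times> {..<d}"
  define c where "c = coefficient f \<pi>"
  define X where "X = L2_set (\<lambda>s. cmod (c s)) S"
  have X0: "X \<ge> 0" by (simp add: X_def)
  define \<rho> where "\<rho> = (\<lambda>s x. cnj (rep_coeff \<pi> (fst s) (snd s) x))"
  have \<rho>c: "continuous_on UNIV (\<rho> s)" if "s \<in> S" for s
    unfolding \<rho>_def using that by (intro coeff_cnj_continuous[OF \<pi>]) (auto simp: S_def d_def)
  have fr: "integrable haar (\<lambda>x. f x * \<rho> s x)" if "s \<in> S" for s
    by (rule integrable_mult_continuous[OF f \<rho>c[OF that]])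
  have hs: "L2_set (\<lambda>s. cmod (\<rho> s x)) S \<le> sqrt d" for x
    unfolding L2_set_def S_def \<rho>_def using coeff_hs_le[OF \<pi>, of x]
    by (intro real_sqrt_le_mono) (simp add: d_def sum.cartesian_product case_prod_unfold)
  have "complex_of_real (X\<^sup>2) = (\<Sum>s\<in>S. cnj (c s) * c s)"
    unfolding X_def L2_set_def
    by (simp add: sum_nonneg complex_norm_square mult.commute del: of_real_power)
  also have "\<dots> = (\<Sum>s\<in>S. LINT x|haar. cnj (c s) * (f x * \<rho> s x))"
    by (simp add: c_def coefficient_def \<rho>_def case_prod_unfold)
  also have "\<dots> = (LINT x|haar. (\<Sum>s\<in>S. cnj (c s) * (f x * \<rho> s x)))"
    by (rule Bochner_Integration.integral_sum[symmetric]) (intro integrable_mult_right fr)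
  finally have "X\<^sup>2 = cmod (LINT x|haar. (\<Sum>s\<in>S. cnj (c s) * (f x * \<rho> s x)))"
    by (metis norm_of_real abs_power2)
  also have "\<dots> \<le> (LINT x|haar. cmod (\<Sum>s\<in>S. cnj (c s) * (f x * \<rho> s x)))"
    by (rule integral_norm_bound)
  also have "\<dots> \<le> (LINT x|haar. (X * sqrt d) * cmod (f x))"
  proof (rule integral_mono)
    show "integrable haar (\<lambda>x. cmod (\<Sum>s\<in>S. cnj (c s) * (f x * \<rho> s x)))"
      by (intro integrable_norm Bochner_Integration.integrable_sum integrable_mult_right fr)
    show "integrable haar (\<lambda>x. (X * sqrt d) * cmod (f x))" using f by auto
    fix x
    have "cmod (\<Sum>s\<in>S. cnj (c s) * (f x * \<rho> s x)) \<le> (\<Sum>s\<in>S. cmod (cnj (c s) * (f x * \<rho> s x)))"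
      by (rule norm_sum)
    also have "\<dots> = cmod (f x) * (\<Sum>s\<in>S. \<bar>cmod (c s)\<bar> * \<bar>cmod (\<rho> s x)\<bar>)"
      by (simp add: norm_mult sum_distrib_left mult_ac)
    also have "\<dots> \<le> cmod (f x) * (X * L2_set (\<lambda>s. cmod (\<rho> s x)) S)"
      unfolding X_def by (intro mult_left_mono L2_set_mult_ineq) auto
    also have "\<dots> \<le> cmod (f x) * (X * sqrt d)"
      using hs X0 by (intro mult_left_mono) auto
    finally show "cmod (\<Sum>s\<in>S. cnj (c s) * (f x * \<rho> s x)) \<le> (X * sqrt d) * cmod (f x)" by (simp add: mult_ac)
  qed
  finally have "X * X \<le> X * (sqrt d * (LINT x|haar. cmod (f x)))" by (simp add: power2_eq_square mult_ac)
  then have "X \<le> sqrt d * (LINT x|haar. cmod (f x))"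
    using X0 by (cases "X = 0") (auto simp: mult_le_cancel_left)
  also have "\<dots> \<le> sqrt (hyperdim conv chk e haar \<pi>) * (LINT x|haar. cmod (f x))"
    using rep_dim_le_hyperdim[OF \<pi>] by (intro mult_right_mono) (auto simp: d_def)
  finally show ?thesis by (simp add: hs_norm_fourier X_def S_def d_def c_def)
qed

text \<open>Bessel's inequality for the coefficients of all classes in \<open>F\<close> together;
  the reciprocal squared norm of each is the hyperdimension.\<close>

lemma hs_norm_fourier_L2:
  assumes F: "finite F" "F \<subseteq> hg_dual" and f: "f \<in> borel_measurable haar" "integrable haar (\<lambda>x. (cmod (f x))\<^sup>2)"
  shows "(\<Sum>\<pi>\<in>F. hyperdim conv chk e haar \<pi> * (hs_norm (fourier haar f \<pi>))\<^sup>2) \<le> (LINT x|haar. (cmod (f x))\<^sup>2)"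
proof -
  define S where "S = Sigma F (\<lambda>\<pi>. {..<rep_dim \<pi>} \<times> {..<rep_dim \<pi>})"
  define u :: "'a hg_rep set \<times> nat \<times> nat \<Rightarrow> 'a \<Rightarrow> complex" where "u = (\<lambda>(\<pi>, i, j). rep_coeff \<pi> i j)"
  define \<kappa> :: "'a hg_rep set \<times> nat \<times> nat \<Rightarrow> real" where "\<kappa> = (\<lambda>(\<pi>, s :: nat \<times> nat). hyperdim conv chk e haar \<pi>)"
  have "(\<Sum>\<pi>\<in>F. hyperdim conv chk e haar \<pi> * (hs_norm (fourier haar f \<pi>))\<^sup>2)
     = (\<Sum>\<pi>\<in>F. \<Sum>s\<in>{..<rep_dim \<pi>} \<times> {..<rep_dim \<pi>}. hyperdim conv chk e haar \<pi> * (cmod (coefficient f \<pi> s))\<^sup>2)"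
    by (simp add: hs_norm_fourier L2_set_def sum_nonneg sum_distrib_left)
  also have "\<dots> = (\<Sum>(\<pi>, s)\<in>S. hyperdim conv chk e haar \<pi> * (cmod (coefficient f \<pi> s))\<^sup>2)"
    unfolding S_def using F by (intro sum.Sigma) auto
  also have "\<dots> = (\<Sum>s\<in>S. \<kappa> s * (cmod (LINT x|haar. f x * cnj (u s x)))\<^sup>2)"
    by (rule sum.cong) (auto simp: \<kappa>_def u_def coefficient_def)
  also have "\<dots> \<le> (LINT x|haar. (cmod (f x))\<^sup>2)"
  proof (rule bessel[OF _ _ _ _ f])
    show "finite S" unfolding S_def using F by auto
    show "continuous_on UNIV (u s)" if "s \<in> S" for s
      using that F coeff_continuous by (auto simp: S_def u_def)
    show "\<kappa> s > 0" if "s \<in> S" for s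
      using that F hyperdim_pos by (auto simp: S_def \<kappa>_def)
    fix s t assume st: "s \<in> S" "t \<in> S"
    obtain \<pi> i j where s: "s = (\<pi>, i, j)" "\<pi> \<in> hg_dual" "i < rep_dim \<pi>" "j < rep_dim \<pi>" using st F by (auto simp: S_def)
    obtain \<pi>' m l where t: "t = (\<pi>', m, l)" "\<pi>' \<in> hg_dual" "m < rep_dim \<pi>'" "l < rep_dim \<pi>'" using st F by (auto simp: S_def)
    show "(LINT x|haar. u s x * cnj (u t x)) = (if s = t then complex_of_real (1 / \<kappa> s) else 0)"
    proof (cases "\<pi> = \<pi>'")
      case True
      then show ?thesis
        using coeff_orthogonal[OF s(2), of i j m l] s t by (simp add: u_def \<kappa>_def)
    next
      case False
      then show ?thesis
        using coeff_orthogonal_distinct[OF s(2) t(2) False s(3,4) t(3,4)] s t by (simp add: u_def)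
    qed
  qed
  finally show ?thesis .
qed

text \<open>With \<open>h\<close> the Hilbert-Schmidt norm,
  \<open>k\<^sup>2 * (h / sqrt k)\<^sup>2 = k * h\<^sup>2\<close>, so the weights are those of
  Bessel's inequality, while the division by \<open>sqrt k\<close> absorbs the factor of the
  integral bound.\<close>

lemma fourier_type_hypergroup:
  "fourier_type haar hg_dual (\<lambda>\<pi>. (hyperdim conv chk e haar \<pi>)\<^sup>2)
     (\<lambda>f \<pi>. hs_norm (fourier haar f \<pi>) / sqrt (hyperdim conv chk e haar \<pi>))"
proof -
  interpret prob_space haar by (rule prob_space_haar)
  show ?thesis
  proof
    fix f :: "'a \<Rightarrow> complex" and \<pi> assume \<pi>: "\<pi> \<in> hg_dual"
    note k = hyperdim_pos[OF \<pi>]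
    show "0 \<le> hs_norm (fourier haar f \<pi>) / sqrt (hyperdim conv chk e haar \<pi>)"
      using k by (simp add: hs_norm_fourier)
    show "hs_norm (fourier haar f \<pi>) / sqrt (hyperdim conv chk e haar \<pi>) \<le> (LINT x|haar. cmod (f x))"
      if "integrable haar f"
      using hs_norm_fourier_L1[OF \<pi> that] k by (simp add: divide_le_eq mult.commute)
    fix g :: "'a \<Rightarrow> complex" assume "integrable haar f" "integrable haar g"
    then show "hs_norm (fourier haar (\<lambda>x. f x + g x) \<pi>) / sqrt (hyperdim conv chk e haar \<pi>)
      \<le> hs_norm (fourier haar f \<pi>) / sqrt (hyperdim conv chk e haar \<pi>) + hs_norm (fourier haar g \<pi>) / sqrt (hyperdim conv chk e haar \<pi>)"
      using hs_norm_fourier_add[OF \<pi>] k by (simp add: divide_right_mono flip: add_divide_distrib)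
  next
    fix f :: "'a \<Rightarrow> complex" and F
    assume F: "finite F" "F \<subseteq> hg_dual" and f: "f \<in> borel_measurable haar" "integrable haar (\<lambda>x. (cmod (f x))\<^sup>2)"
    have "(\<Sum>\<pi>\<in>F. (hyperdim conv chk e haar \<pi>)\<^sup>2 * (hs_norm (fourier haar f \<pi>) / sqrt (hyperdim conv chk e haar \<pi>))\<^sup>2)
      = (\<Sum>\<pi>\<in>F. hyperdim conv chk e haar \<pi> * (hs_norm (fourier haar f \<pi>))\<^sup>2)"
    proof (rule sum.cong[OF refl])
      fix \<pi> assume "\<pi> \<in> F"
      then have "hyperdim conv chk e haar \<pi> > 0" using F hyperdim_pos by auto
      then show "(hyperdim conv chk e haar \<pi>)\<^sup>2 * (hs_norm (fourier haar f \<pi>) / sqrt (hyperdim conv chk e haar \<pi>))\<^sup>2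
        = hyperdim conv chk e haar \<pi> * (hs_norm (fourier haar f \<pi>))\<^sup>2"
        by (simp add: power_divide power2_eq_square)
    qed
    also have "\<dots> \<le> (LINT x|haar. (cmod (f x))\<^sup>2)" by (rule hs_norm_fourier_L2[OF F f])
    finally show "(\<Sum>\<pi>\<in>F. (hyperdim conv chk e haar \<pi>)\<^sup>2 * (hs_norm (fourier haar f \<pi>) / sqrt (hyperdim conv chk e haar \<pi>))\<^sup>2)
      \<le> (LINT x|haar. (cmod (f x))\<^sup>2)" .
  qed simp
qed

text \<open>Passes from the extended-valued supremum of infinite sums to real inequalities for
  finite sums, the form in which interpolation uses the hypothesis.\<close>

lemma M_sup_bound:
  assumes M: "M_sup conv chk e haar \<phi> < \<infinity>" and F: "finite F" "F \<subseteq> hg_dual" and y: "y > 0"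
  shows "y * (\<Sum>\<pi>\<in>{\<pi>\<in>F. \<phi> \<pi> \<ge> y}. (hyperdim conv chk e haar \<pi>)\<^sup>2) \<le> enn2real (M_sup conv chk e haar \<phi>)"
proof -
  let ?k = "\<lambda>\<pi>. (hyperdim conv chk e haar \<pi>)\<^sup>2"
  have "ennreal (y * (\<Sum>\<pi>\<in>{\<pi>\<in>F. \<phi> \<pi> \<ge> y}. ?k \<pi>)) = ennreal y * (\<Sum>\<pi>\<in>{\<pi>\<in>F. \<phi> \<pi> \<ge> y}. ennreal (?k \<pi>))"
    using y by (simp add: ennreal_mult sum_nonneg)
  also have "(\<Sum>\<pi>\<in>{\<pi>\<in>F. \<phi> \<pi> \<ge> y}. ennreal (?k \<pi>)) = (\<Sum>\<^sub>\<infinity>\<pi>\<in>{\<pi>\<in>F. \<phi> \<pi> \<ge> y}. ennreal (?k \<pi>))"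
    using F by simp
  also have "ennreal y * \<dots> \<le> ennreal y * (\<Sum>\<^sub>\<infinity>\<pi>\<in>{\<pi> \<in> hg_dual. \<phi> \<pi> \<ge> y}. ennreal (?k \<pi>))"
    using F by (intro mult_left_mono infsum_mono_neutral nonneg_summable_on_complete) auto
  also have "\<dots> \<le> M_sup conv chk e haar \<phi>"
    unfolding M_sup_def by (rule SUP_upper) (use y in simp)
  finally have "ennreal (y * (\<Sum>\<pi>\<in>{\<pi>\<in>F. \<phi> \<pi> \<ge> y}. ?k \<pi>)) \<le> M_sup conv chk e haar \<phi>" .
  then have "enn2real (ennreal (y * (\<Sum>\<pi>\<in>{\<pi>\<in>F. \<phi> \<pi> \<ge> y}. ?k \<pi>))) \<le> enn2real (M_sup conv chk e haar \<phi>)"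
    by (rule enn2real_mono) (use M in simp)
  then show ?thesis using y by (simp add: sum_nonneg)
qed

end

theorem theorem1p5:
  fixes conv :: "'a::t2_space cmeas \<Rightarrow> 'a cmeas \<Rightarrow> 'a cmeas"
    and chk :: "'a \<Rightarrow> 'a"
    and e :: 'a
    and haar :: "'a measure"
    and p b p' :: real
  assumes "compact_hypergroup conv chk e"
    and "metrizable_space (euclidean :: 'a topology)"
    and "normalized_haar_measure conv haar"
    and "1 < p" and "p \<le> b" and "b \<le> p'" and "1 / p + 1 / p' = 1"
  shows "\<exists>C>0. \<forall>\<phi> :: 'a hg_rep set \<Rightarrow> real.
    (\<forall>\<pi>\<in>dual conv chk e. \<phi> \<pi> > 0) \<and> M_sup conv chk e haar \<phi> < \<infinity> \<longrightarrow>
    (\<forall>f\<in>Lp_space p haar.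
      (\<lambda>\<pi>. (hyperdim conv chk e haar \<pi>)\<^sup>2 *
         (hs_norm (fourier haar f \<pi>) / sqrt (hyperdim conv chk e haar \<pi>)
            * \<phi> \<pi> powr (1 / b - 1 / p')) powr b) summable_on dual conv chk e \<and>
      (\<Sum>\<^sub>\<infinity>\<pi>\<in>dual conv chk e. (hyperdim conv chk e haar \<pi>)\<^sup>2 *
         (hs_norm (fourier haar f \<pi>) / sqrt (hyperdim conv chk e haar \<pi>)
            * \<phi> \<pi> powr (1 / b - 1 / p')) powr b) powr (1 / b)
      \<le> C * enn2real (M_sup conv chk e haar \<phi>) powr (1 / b - 1 / p') * Lp_norm p haar f)"
proof -
  interpret compact_hypergroup conv chk e by fact
  interpret haar_hypergroup conv chk e haar by unfold_locales fact
  let ?k = "hyperdim conv chk e haar"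
  interpret fourier_type haar "dual conv chk e" "\<lambda>\<pi>. (?k \<pi>)\<^sup>2" "\<lambda>f \<pi>. hs_norm (fourier haar f \<pi>) / sqrt (?k \<pi>)"
    by (rule fourier_type_hypergroup)
  have b0: "b > 0" using assms(4,5) by simp
  obtain C where C: "C > 0" "\<And>F \<phi> M f. finite F \<Longrightarrow> F \<subseteq> hg_dual \<Longrightarrow> \<forall>\<pi>\<in>F. \<phi> \<pi> > 0 \<Longrightarrow> M > 0 \<Longrightarrow>
    \<forall>y>0. y * (\<Sum>\<pi>\<in>{\<pi>\<in>F. \<phi> \<pi> \<ge> y}. (?k \<pi>)\<^sup>2) \<le> M \<Longrightarrow>
    f \<in> borel_measurable haar \<Longrightarrow> integrable haar (\<lambda>x. cmod (f x) powr p) \<Longrightarrow>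
    (\<Sum>\<pi>\<in>F. (?k \<pi>)\<^sup>2 * (hs_norm (fourier haar f \<pi>) / sqrt (?k \<pi>) * \<phi> \<pi> powr (1 / b - 1 / p')) powr b)
      \<le> (C * M powr (1 / b - 1 / p') * (LINT x|haar. cmod (f x) powr p) powr (1 / p)) powr b"
    using paley_hausdorff_young[OF assms(4-7)] by auto
  show ?thesis
  proof (intro exI[of _ C] conjI allI impI ballI C(1))
    fix \<phi> :: "'a hg_rep set \<Rightarrow> real" and f
    assume \<phi>: "(\<forall>\<pi>\<in>hg_dual. \<phi> \<pi> > 0) \<and> M_sup conv chk e haar \<phi> < \<infinity>" and "f \<in> Lp_space p haar"
    then have f: "f \<in> borel_measurable haar" "integrable haar (\<lambda>x. cmod (f x) powr p)" by (auto simp: Lp_space_def)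
    define M where "M = enn2real (M_sup conv chk e haar \<phi>)"
    define t where "t = (\<lambda>\<pi>. (?k \<pi>)\<^sup>2 * (hs_norm (fourier haar f \<pi>) / sqrt (?k \<pi>) * \<phi> \<pi> powr (1 / b - 1 / p')) powr b)"
    define R where "R = C * M powr (1 / b - 1 / p') * Lp_norm p haar f"
    have R0: "R \<ge> 0" using C(1) by (simp add: R_def Lp_norm_def)
    have t0: "t \<pi> \<ge> 0" for \<pi> by (simp add: t_def)
    have bd: "sum t F \<le> R powr b" if F: "finite F" "F \<subseteq> hg_dual" for F
    proof (cases "F = {}")
      case False
      then obtain \<pi> where \<pi>: "\<pi> \<in> F" by blast
      then have \<phi>\<pi>: "\<phi> \<pi> > 0" and k: "?k \<pi> > 0" using F \<phi> hyperdim_pos by auto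
      \<comment> \<open>The threshold is the value of \<open>\<phi>\<close> at a member of
        \<open>F\<close>, so that at least this class is counted, with positive weight. Hence
        \<open>M > 0\<close>, as \<open>C(2)\<close> demands; for empty \<open>F\<close> the bound
        is immediate.\<close>
      have "0 < \<phi> \<pi> * (\<Sum>\<pi>'\<in>{\<pi>'\<in>F. \<phi> \<pi>' \<ge> \<phi> \<pi>}. (?k \<pi>')\<^sup>2)"
        using F \<pi> k \<phi>\<pi> by (intro mult_pos_pos sum_pos2[of _ \<pi>]) auto
      also have "\<dots> \<le> M" unfolding M_def by (rule M_sup_bound) (use \<phi> F \<phi>\<pi> in auto)
      finally have "M > 0" .
      then show ?thesis
        unfolding t_def R_def Lp_norm_def
        by (intro C(2) F f) (use \<phi> F M_sup_bound[OF _ F] in \<open>auto simp: M_def\<close>)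
    qed simp
    have s: "t summable_on hg_dual"
      using t0 bd by (intro nonneg_bdd_above_summable_on) (auto simp: bdd_above_def)
    then show "(\<lambda>\<pi>. (?k \<pi>)\<^sup>2 * (hs_norm (fourier haar f \<pi>) / sqrt (?k \<pi>) * \<phi> \<pi> powr (1 / b - 1 / p')) powr b) summable_on hg_dual" unfolding t_def .
    have "infsum t hg_dual \<le> R powr b" by (rule infsum_le_finite_sums[OF s bd])
    then have "infsum t hg_dual powr (1 / b) \<le> (R powr b) powr (1 / b)"
      using b0 t0 by (intro powr_mono2 infsum_nonneg) auto
    also have "\<dots> = R" using R0 b0 by (simp add: powr_powr)
    finally show "(\<Sum>\<^sub>\<infinity>\<pi>\<in>hg_dual. (?k \<pi>)\<^sup>2 * (hs_norm (fourier haar f \<pi>) / sqrt (?k \<pi>) * \<phi> \<pi> powr (1 / b - 1 / p')) powr b) powr (1 / b) \<le> C * enn2real (M_sup conv chk e haar \<phi>) powr (1 / b - 1 / p') * Lp_norm p haar f"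
      by (simp add: R_def M_def t_def)
  qed
qed

end
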